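(* Let $d\in\mathbb N$ and let $q\in\ell^1_+(\mathbb Z^d)$ with $q(0)=0$. Suppose that: (i) $f:\mathbb R_+\to\mathbb R$ is globally Lipschitz with $f(0)=0$; (ii) $\sigma:\mathbb R_+\to\mathbb R_+$ is continuous, $\sigma(0)=0$, $\sigma(x)>0$ for $x>0$, and there exist constants $C\ge 1$ and $\theta\in(0,1)$ such that $\sigma(x)\le C(x^\theta+x)$ for all $x\ge 0$; (iii) for some $\gamma\in(0,1/2)$, $\liminf_{x\downarrow 0}\sigma(x)/x^\gamma>0$. Let $X=(X_t)_{t\ge 0}$ be a continuous $\ell^1_+$-valued solution to $$dX_t(i)=\Big(\sum_{j\in\mathbb Z^d}q(i-j)\big(X_t(j)-X_t(i)\big)\Big)dt+f(X_t(i))\,dt+\sigma(X_t(i))\,dB_t(i),\qquad i\in\mathbb Z^d,$$ with compactly supported initial state. Then for every $T>0$, with probability one, $$\mathrm{Leb}\big(\{t\in[0,T]:\mathrm{supp}(X_t)\text{ is compact}\}\big)=T.$$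
   Context: $\mathbb R_+=[0,\infty)$. $\ell^1(\mathbb Z^d)$ is the space of absolutely summable real functions on $\mathbb Z^d$ with its usual norm, and $\ell^1_+(\mathbb Z^d)$ is the set of its elements with non-negative entries. $\mathrm{Leb}$ is one-dimensional Lebesgue measure. The support of $x\in\ell^1_+$ is $\mathrm{supp}(x)=\{i\in\mathbb Z^d:x(i)\neq 0\}$; since $\mathbb Z^d$ is discrete, compact means finite. Solution: on a filtered probability space $(\Omega,\mathscr F,(\mathscr F_t)_{t\ge0},\mathbb P)$ carrying a family $\{(B_t(i))_{t\ge 0}:i\in\mathbb Z^d\}$ of independent $(\mathscr F_t)$-Brownian motions, an $\mathbb R_+^{\mathbb Z^d}$-valued process $X$ is a (non-negative) solution of the system if for each $i\in\mathbb Z^d$ and $t\geq 0$, $\sum_j q(i-j)|X_t(j)-X_t(i)|<\infty$ a.s., and for each $i$, $(X_t(i))_{t\ge0}$ is a continuous, non-negative, $(\mathscr F_t)$-adapted process a.s. satisfying, for all $t\ge0$, $$X_t(i)=X_0(i)+\int_0^t \sum_j q(i-j)(X_s(j)-X_s(i))\,ds+\int_0^t f(X_s(i))\,ds+\int_0^t\sigma(X_s(i))\,dB_s(i).$$ It is a continuous $\ell^1_+$-valued solution if moreover $X_t\in\ell^1_+(\mathbb Z^d)$ for all $t$ and $t\mapsto X_t$ is continuous in $\ell^1$, a.s. *)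

theory Defs
  imports "HOL-Probability.Probability"
begin

section \<open>The sequence space over the lattice\<close>

text \<open>The lattice \<open>\<int>\<^sup>d\<close> is \<^typ>\<open>int ^ 'd\<close>, with \<open>d = CARD('d)\<close>.\<close>

definition ell1_nonneg :: "((int ^ 'd) \<Rightarrow> real) set" where
  "ell1_nonneg = {x. (\<lambda>i. \<bar>x i\<bar>) summable_on UNIV \<and> (\<forall>i. 0 \<le> x i)}"

definition ell1_norm :: "((int ^ 'd) \<Rightarrow> real) \<Rightarrow> real" where
  "ell1_norm x = (\<Sum>\<^sub>\<infinity>i. \<bar>x i\<bar>)"

definition supp :: "((int ^ 'd) \<Rightarrow> real) \<Rightarrow> (int ^ 'd) set" where
  "supp x = {i. x i \<noteq> 0}"

section \<open>Filtrations and Brownian motions\<close>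

text \<open>Processes are indexed by \<^typ>\<open>real\<close>; only their values at times \<open>t \<ge> 0\<close> are constrained
  or used. Neither completeness nor right-continuity of the filtration is required.\<close>

definition filtered_prob_space :: "'a measure \<Rightarrow> (real \<Rightarrow> 'a measure) \<Rightarrow> bool" where
  "filtered_prob_space M F \<longleftrightarrow>
     prob_space M \<and> (\<forall>t\<ge>0. subalgebra M (F t)) \<and>
     (\<forall>s t. 0 \<le> s \<longrightarrow> s \<le> t \<longrightarrow> sets (F s) \<subseteq> sets (F t))"

definition adapted :: "(real \<Rightarrow> 'a measure) \<Rightarrow> (real \<Rightarrow> 'a \<Rightarrow> real) \<Rightarrow> bool" where
  "adapted F Y \<longleftrightarrow> (\<forall>t\<ge>0. Y t \<in> borel_measurable (F t))"

definition brownian_motion ::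
  "'a measure \<Rightarrow> (real \<Rightarrow> 'a measure) \<Rightarrow> (real \<Rightarrow> 'a \<Rightarrow> real) \<Rightarrow> bool" where
  "brownian_motion M F B \<longleftrightarrow>
     adapted F B \<and>
     (AE \<omega> in M. B 0 \<omega> = 0) \<and>
     (AE \<omega> in M. continuous_on {0..} (\<lambda>t. B t \<omega>)) \<and>
     (\<forall>s t. 0 \<le> s \<longrightarrow> s < t \<longrightarrow>
        distributed M lborel (\<lambda>\<omega>. B t \<omega> - B s \<omega>) (normal_density 0 (sqrt (t - s))) \<and>
        prob_space.indep_set M (sets (F s))
          {(\<lambda>\<omega>. B t \<omega> - B s \<omega>) -` U \<inter> space M | U. U \<in> sets borel})"

text \<open>The independence is that of the whole processes, as random elements of
  \<open>\<real>\<close> to the power \<open>[0,\<infinity>)\<close> with the product \<open>\<sigma>\<close>-algebra.\<close>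

definition independent_brownian_motions ::
  "'a measure \<Rightarrow> (real \<Rightarrow> 'a measure) \<Rightarrow> ('i \<Rightarrow> real \<Rightarrow> 'a \<Rightarrow> real) \<Rightarrow> bool" where
  "independent_brownian_motions M F B \<longleftrightarrow>
     (\<forall>i. brownian_motion M F (B i)) \<and>
     prob_space.indep_vars M (\<lambda>i. Pi\<^sub>M {0..} (\<lambda>_. borel)) (\<lambda>i \<omega>. \<lambda>t\<in>{0..}. B i t \<omega>) UNIV"

section \<open>The Ito integral\<close>

text \<open>Convergence to 0 in probability of \<open>[0,\<infinity>]\<close>-valued functions. The exceptional event is only
  required to contain the set where \<open>Z n\<close> exceeds \<open>\<epsilon>\<close>: for random variables this is the
  usual notion, and it stays meaningful for functions that agree with a measurable one merely off
  a null set (\<open>M\<close> need not be complete), whereas \<^const>\<open>measure\<close> is 0 on non-measurable sets.\<close>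

definition tendsto_zero_in_prob :: "'a measure \<Rightarrow> (nat \<Rightarrow> 'a \<Rightarrow> ennreal) \<Rightarrow> bool" where
  "tendsto_zero_in_prob M Z \<longleftrightarrow>
     (\<forall>\<epsilon>>0. \<forall>\<delta>>0. \<forall>\<^sub>F n in sequentially.
        \<exists>A\<in>sets M. measure M A < \<delta> \<and> (\<forall>\<omega>\<in>space M - A. Z n \<omega> \<le> ennreal \<epsilon>))"

text \<open>A bounded simple process is given by a number \<open>n\<close> of intervals, their endpoints \<open>\<tau>\<close> and the
  values \<open>\<xi>\<close>: it equals \<open>\<xi> k\<close> on \<open>(\<tau> k, \<tau> (k+1)]\<close> for \<open>k < n\<close>.\<close>

type_synonym 'a simple_process = "nat \<times> (nat \<Rightarrow> real) \<times> (nat \<Rightarrow> 'a \<Rightarrow> real)"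

definition is_simple_process ::
  "'a measure \<Rightarrow> (real \<Rightarrow> 'a measure) \<Rightarrow> 'a simple_process \<Rightarrow> bool" where
  "is_simple_process M F S = (case S of (n, \<tau>, \<xi>) \<Rightarrow>
     0 \<le> \<tau> 0 \<and> (\<forall>k<n. \<tau> k \<le> \<tau> (Suc k)) \<and>
     (\<forall>k<n. \<xi> k \<in> borel_measurable (F (\<tau> k))) \<and>
     (\<exists>c. \<forall>k<n. \<forall>\<omega>\<in>space M. \<bar>\<xi> k \<omega>\<bar> \<le> c))"

definition simple_value :: "'a simple_process \<Rightarrow> real \<Rightarrow> 'a \<Rightarrow> real" where
  "simple_value S t \<omega> = (case S of (n, \<tau>, \<xi>) \<Rightarrow>
     \<Sum>k<n. \<xi> k \<omega> * indicator {\<tau> k<..\<tau> (Suc k)} t)"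

definition simple_integral ::
  "'a simple_process \<Rightarrow> (real \<Rightarrow> 'a \<Rightarrow> real) \<Rightarrow> real \<Rightarrow> 'a \<Rightarrow> real" where
  "simple_integral S B t \<omega> = (case S of (n, \<tau>, \<xi>) \<Rightarrow>
     \<Sum>k<n. \<xi> k \<omega> * (B (min t (\<tau> (Suc k))) \<omega> - B (min t (\<tau> k)) \<omega>))"

text \<open>\<open>I\<close> is (a continuous version of) the Ito integral process of \<open>H\<close> against the Brownian
  motion \<open>B\<close>: it is a limit in probability of integrals of simple processes \<open>S n\<close> for which
  \<open>\<integral>\<^sub>0\<^sup>t (S n - H)\<^sup>2 ds\<close> tends to 0 in probability. By the Ito isometry and localization
  the limit does not depend on the approximating sequence.\<close>

definition is_ito_integral ::
  "'a measure \<Rightarrow> (real \<Rightarrow> 'a measure) \<Rightarrow> (real \<Rightarrow> 'a \<Rightarrow> real) \<Rightarrow> (real \<Rightarrow> 'a \<Rightarrow> real) \<Rightarrow>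
     (real \<Rightarrow> 'a \<Rightarrow> real) \<Rightarrow> bool" where
  "is_ito_integral M F B H I \<longleftrightarrow>
     (\<forall>t\<ge>0. I t \<in> borel_measurable M) \<and>
     (AE \<omega> in M. continuous_on {0..} (\<lambda>t. I t \<omega>)) \<and>
     (\<exists>S. (\<forall>n. is_simple_process M F (S n)) \<and>
       (\<forall>t\<ge>0.
          tendsto_zero_in_prob M
            (\<lambda>n \<omega>. \<integral>\<^sup>+ s\<in>{0..t}. ennreal ((simple_value (S n) s \<omega> - H s \<omega>)\<^sup>2) \<partial>lborel) \<and>
          tendsto_zero_in_prob M
            (\<lambda>n \<omega>. ennreal \<bar>simple_integral (S n) B t \<omega> - I t \<omega>\<bar>)))"

section \<open>Solutions of the system\<close>

definition drift :: "((int ^ 'd) \<Rightarrow> real) \<Rightarrow> ((int ^ 'd) \<Rightarrow> real) \<Rightarrow> (int ^ 'd) \<Rightarrow> real" where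
  "drift q x i = (\<Sum>\<^sub>\<infinity>j. q (i - j) * (x j - x i))"

text \<open>The \<^const>\<open>set_integrable\<close> conjuncts express that the two time integrals exist, since
  the Bochner integral of a non-integrable function is 0 in HOL.\<close>

definition is_solution ::
  "'a measure \<Rightarrow> (real \<Rightarrow> 'a measure) \<Rightarrow> ((int ^ 'd) \<Rightarrow> real \<Rightarrow> 'a \<Rightarrow> real) \<Rightarrow>
     ((int ^ 'd) \<Rightarrow> real) \<Rightarrow> (real \<Rightarrow> real) \<Rightarrow> (real \<Rightarrow> real) \<Rightarrow>
     (real \<Rightarrow> 'a \<Rightarrow> (int ^ 'd) \<Rightarrow> real) \<Rightarrow> bool" where
  "is_solution M F B q f \<sigma> X \<longleftrightarrow>
     (\<forall>t\<ge>0. \<forall>\<omega>\<in>space M. \<forall>i. 0 \<le> X t \<omega> i) \<and>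
     (\<forall>i. \<forall>t\<ge>0. AE \<omega> in M. (\<lambda>j. q (i - j) * \<bar>X t \<omega> j - X t \<omega> i\<bar>) summable_on UNIV) \<and>
     (\<forall>i. adapted F (\<lambda>t \<omega>. X t \<omega> i) \<and>
          (AE \<omega> in M. continuous_on {0..} (\<lambda>t. X t \<omega> i)) \<and>
          (\<exists>I. is_ito_integral M F (B i) (\<lambda>t \<omega>. \<sigma> (X t \<omega> i)) I \<and>
             (AE \<omega> in M. \<forall>t\<ge>0.
                set_integrable lborel {0..t} (\<lambda>s. drift q (X s \<omega>) i) \<and>
                set_integrable lborel {0..t} (\<lambda>s. f (X s \<omega> i)) \<and>
                X t \<omega> i = X 0 \<omega> i
                  + (LINT s:{0..t}|lborel. drift q (X s \<omega>) i)
                  + (LINT s:{0..t}|lborel. f (X s \<omega> i))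
                  + I t \<omega>)))"

definition is_continuous_ell1_solution ::
  "'a measure \<Rightarrow> (real \<Rightarrow> 'a measure) \<Rightarrow> ((int ^ 'd) \<Rightarrow> real \<Rightarrow> 'a \<Rightarrow> real) \<Rightarrow>
     ((int ^ 'd) \<Rightarrow> real) \<Rightarrow> (real \<Rightarrow> real) \<Rightarrow> (real \<Rightarrow> real) \<Rightarrow>
     (real \<Rightarrow> 'a \<Rightarrow> (int ^ 'd) \<Rightarrow> real) \<Rightarrow> bool" where
  "is_continuous_ell1_solution M F B q f \<sigma> X \<longleftrightarrow>
     is_solution M F B q f \<sigma> X \<and>
     (AE \<omega> in M. (\<forall>t\<ge>0. X t \<omega> \<in> ell1_nonneg) \<and>
        (\<forall>t\<ge>0. ((\<lambda>s. ell1_norm (\<lambda>i. X s \<omega> i - X t \<omega> i)) \<longlongrightarrow> 0) (at t within {0..})))"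

end

theory Submission
  imports Defs
begin

text \<open>Apply the convex function \<open>x + (exp (- l x) - 1) / l\<close> to each coordinate. Up to the time when
  the total mass exceeds \<open>R\<close>, the drift costs at most a multiple of the mass, so the Ito correction
  bounds the expectation of \<open>\<Sum>i \<integral> l exp (- l X(i)) \<sigma>(X(i))\<^sup>2 ds\<close> uniformly in \<open>l\<close>. As \<open>\<sigma>(x)\<^sup>2 \<ge> k x\<^sup>2\<^sup>\<gamma>\<close>
  near 0 with \<open>2 \<gamma> < 1\<close>, the bounds for \<open>l = 2\<^sup>n\<close> with geometric weights dominate the expected time
  that coordinates spend in \<open>(0, x0]\<close>, summed over all sites. Hence at almost every time only finitely
  many coordinates lie in \<open>(0, x0]\<close>, and summability leaves only finitely many above \<open>x0\<close>.

  The Ito formula is replaced by a second-order Taylor expansion over a fine time grid, where the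
  increments of the Ito integral are approximated by those of stopped simple processes, whose
  moments are explicit. Whether the mass has exceeded \<open>R\<close> is decided at grid points only, which avoids
  stopping times.\<close>

section \<open>Predictable blocks of a Brownian motion\<close>

text \<open>On the half-line the test function has slope \<open>1 - exp (- l x)\<close> in [0,1],
  curvature \<open>l exp (- l x)\<close>, and lies between 0 and x. So neither its size nor the cost
  of the drift depends on \<open>l\<close>; both are controlled by the total mass, and the estimate
  survives summation over all sites. At x of order 1/l the correction is at least of order l^(1 - 2
  \<gamma>), which grows because \<gamma> < 1/2: this growth pays for the geometric weights. The Ito
  integral is known only through convergence in probability, so its increments have no moments at
  hand. They are traded for discrete integrals with capped quadratic variation, off events of small
  probability on which everything else is bounded. A second obstacle is that zero means need an
  event of the past, while the a priori bounds need the mass to be controlled up to the end of the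
  step. The mismatch is an exit event. Exits in different steps are disjoint, so their probabilities
  sum to at most 1, and they carry a factor that vanishes with the mesh. Errors are multiplied by
  the number of sites, so the mesh goes to 0 for a fixed finite set of sites before that set
  grows.\<close>

lemma nn_integral_normal_exp:
  fixes h a :: real
  assumes "0 < h"
  shows "(\<integral>\<^sup>+ z. ennreal (normal_density 0 (sqrt h) z) * ennreal (exp (a * z - a\<^sup>2 * h / 2)) \<partial>lborel) = 1"
proof -
  \<comment> \<open>Completing the square: the exponential tilt only moves the mean of the Gaussian
    from 0 to \<open>a * h\<close>.\<close>
  have eq: "normal_density 0 (sqrt h) z * exp (a * z - a\<^sup>2 * h / 2) = normal_density (a * h) (sqrt h) z" for z
  proof -
    have "-(z\<^sup>2) / (2 * h) + (a * z - a\<^sup>2 * h / 2) = - (z - a * h)\<^sup>2 / (2 * h)"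
      using assms by (simp add: field_simps power2_eq_square)
    then show ?thesis
      using assms by (simp add: normal_density_def exp_add[symmetric])
  qed
  have "(\<integral>\<^sup>+ z. ennreal (normal_density 0 (sqrt h) z) * ennreal (exp (a * z - a\<^sup>2 * h / 2)) \<partial>lborel)
     = (\<integral>\<^sup>+ z. ennreal (normal_density (a * h) (sqrt h) z) \<partial>lborel)"
    by (intro nn_integral_cong) (simp add: ennreal_mult[symmetric] eq)
  also have "\<dots> = ennreal 1"
    using assms by (subst nn_integral_eq_integral) (auto simp: normal_density_nonneg)
  finally show ?thesis by simp
qed

lemma integrable_bounded_mult:
  fixes f g :: "'a \<Rightarrow> real"
  assumes "integrable M f" "g \<in> borel_measurable M" "\<And>\<omega>. \<omega> \<in> space M \<Longrightarrow> \<bar>g \<omega>\<bar> \<le> c"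
  shows "integrable M (\<lambda>\<omega>. g \<omega> * f \<omega>)"
proof (rule Bochner_Integration.integrable_bound[OF integrable_mult_right[OF integrable_abs[OF assms(1)], of c]])
  show "AE \<omega> in M. norm (g \<omega> * f \<omega>) \<le> norm (c * \<bar>f \<omega>\<bar>)"
  proof (rule AE_I2)
    fix \<omega> assume w: "\<omega> \<in> space M"
    have "0 \<le> c" using assms(3)[OF w] by linarith
    then show "norm (g \<omega> * f \<omega>) \<le> norm (c * \<bar>f \<omega>\<bar>)"
      using mult_right_mono[OF assms(3)[OF w], of "\<bar>f \<omega>\<bar>"] by (simp add: abs_mult)
  qed
qed (use assms in measurable)

section \<open>Brownian increments relative to the past\<close>

locale filtered_brownian = prob_space M for M :: "'a measure" +
  fixes F :: "real \<Rightarrow> 'a measure" and B :: "real \<Rightarrow> 'a \<Rightarrow> real"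
  assumes filtration: "filtered_prob_space M F"
    and brownian: "brownian_motion M F B"
begin

lemma subalg: "0 \<le> t \<Longrightarrow> subalgebra M (F t)"
  using filtration by (simp add: filtered_prob_space_def)

lemma space_F: "0 \<le> t \<Longrightarrow> space (F t) = space M"
  using subalg by (simp add: subalgebra_def)

lemma F_mono: "0 \<le> s \<Longrightarrow> s \<le> t \<Longrightarrow> sets (F s) \<subseteq> sets (F t)"
  using filtration by (simp add: filtered_prob_space_def)

lemma measurable_F_mono:
  assumes "g \<in> measurable (F s) N" "0 \<le> s" "s \<le> t"
  shows "g \<in> measurable (F t) N"
proof -
  have "subalgebra (F t) (F s)"
    using assms space_F[of s] space_F[of t] F_mono[of s t] by (auto simp: subalgebra_def)
  then show ?thesis using assms(1) measurable_from_subalg by blast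
qed

lemma measurable_F_M: "g \<in> measurable (F s) N \<Longrightarrow> 0 \<le> s \<Longrightarrow> g \<in> measurable M N"
  using subalg measurable_from_subalg by blast

lemma B_adapted: "0 \<le> t \<Longrightarrow> B t \<in> borel_measurable (F t)"
  using brownian by (simp add: brownian_motion_def adapted_def)

lemma B_measurable [measurable]: "0 \<le> t \<Longrightarrow> B t \<in> borel_measurable M"
  using B_adapted measurable_F_M by blast

text \<open>The hypothesis on the Brownian motion is independence of set families, whereas
  \<open>indep_var\<close> is about generated \<sigma>-algebras. The preimage families are stable
  under intersection, so independence carries over. The value spaces are arbitrary so that
  \<open>U\<close> can be a pair.\<close>

lemma indep_increment:
  assumes "0 \<le> s" "s < t" and U: "U \<in> measurable (F s) N" and g: "g \<in> measurable borel N'"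
  shows "indep_var N U N' (\<lambda>\<omega>. g (B t \<omega> - B s \<omega>))"
proof -
  have UM: "U \<in> measurable M N" using measurable_F_M[OF U] assms by simp
  have Z: "(\<lambda>\<omega>. B t \<omega> - B s \<omega>) \<in> borel_measurable M"
    using B_measurable[of s] B_measurable[of t] assms by simp
  have gZ: "(\<lambda>\<omega>. g (B t \<omega> - B s \<omega>)) \<in> measurable M N'"
    using measurable_compose[OF Z g] .
  have ind: "indep_set (sets (F s)) {(\<lambda>\<omega>. B t \<omega> - B s \<omega>) -` U \<inter> space M | U. U \<in> sets borel}"
    using brownian assms by (simp add: brownian_motion_def)
  have sub: "{U -` A \<inter> space M |A. A \<in> sets N} \<subseteq> sets (F s)"
    using measurable_sets[OF U] space_F[of s] assms by auto
  have sub': "{(\<lambda>\<omega>. g (B t \<omega> - B s \<omega>)) -` A \<inter> space M | A. A \<in> sets N'}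
      \<subseteq> {(\<lambda>\<omega>. B t \<omega> - B s \<omega>) -` U \<inter> space M | U. U \<in> sets borel}"
  proof safe
    fix A assume "A \<in> sets N'"
    then have "g -` A \<in> sets borel" using measurable_sets[OF g] by simp
    then show "\<exists>U. (\<lambda>\<omega>. g (B t \<omega> - B s \<omega>)) -` A \<inter> space M
        = (\<lambda>\<omega>. B t \<omega> - B s \<omega>) -` U \<inter> space M \<and> U \<in> sets borel"
      by (intro exI[of _ "g -` A"]) auto
  qed
  have ind2: "indep_set {U -` A \<inter> space M |A. A \<in> sets N}
      {(\<lambda>\<omega>. g (B t \<omega> - B s \<omega>)) -` U \<inter> space M | U. U \<in> sets N'}"
    using ind sub sub' unfolding indep_set_def
    by (elim indep_sets_mono) (auto split: bool.splits)
  have stable: "Int_stable {W -` A \<inter> space M |A. A \<in> sets K}" for W :: "'a \<Rightarrow> 'z" and K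
  proof (rule Int_stableI)
    fix a b assume "a \<in> {W -` A \<inter> space M |A. A \<in> sets K}" "b \<in> {W -` A \<inter> space M |A. A \<in> sets K}"
    then obtain A A' where "a = W -` A \<inter> space M" "b = W -` A' \<inter> space M" "A \<in> sets K" "A' \<in> sets K"
      by auto
    then show "a \<inter> b \<in> {W -` A \<inter> space M |A. A \<in> sets K}"
      by (intro CollectI exI[of _ "A \<inter> A'"]) auto
  qed
  show ?thesis
    unfolding indep_var_eq
    by (intro conjI indep_set_sigma_sets ind2 stable UM gZ)
qed

lemma increment_distributed:
  assumes "0 \<le> s" "s < t"
  shows "distributed M lborel (\<lambda>\<omega>. B t \<omega> - B s \<omega>) (normal_density 0 (sqrt (t - s)))"
  using brownian assms by (simp add: brownian_motion_def)

lemma increment_moments: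
  assumes "0 \<le> s" "s < t"
  shows "integrable M (\<lambda>\<omega>. B t \<omega> - B s \<omega>)" "expectation (\<lambda>\<omega>. B t \<omega> - B s \<omega>) = 0"
    "integrable M (\<lambda>\<omega>. (B t \<omega> - B s \<omega>)\<^sup>2)" "expectation (\<lambda>\<omega>. (B t \<omega> - B s \<omega>)\<^sup>2) = t - s"
proof -
  have pos: "sqrt (t - s) > 0" using assms by simp
  note D = increment_distributed[OF assms]
  have nn: "\<And>x. 0 \<le> normal_density 0 (sqrt (t - s)) x" by simp
  have 1: "has_bochner_integral lborel (\<lambda>x. normal_density 0 (sqrt (t - s)) x * x) 0"
    using normal_moment_nz_1[OF pos] by simp
  have "has_bochner_integral lborel (\<lambda>x. normal_density 0 (sqrt (t - s)) x * (x - 0) ^ (2 * 1))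
     (fact (2 * 1) / ((2 / (sqrt (t - s))\<^sup>2)^1 * fact 1))"
    by (rule normal_moment_even[OF pos])
  then have 2: "has_bochner_integral lborel (\<lambda>x. normal_density 0 (sqrt (t - s)) x * x\<^sup>2) (t - s)"
    using assms by (simp add: fact_numeral diff_divide_distrib)
  show "integrable M (\<lambda>\<omega>. B t \<omega> - B s \<omega>)"
    using distributed_integrable[OF D _ nn, of "\<lambda>x. x"] 1 by (simp add: has_bochner_integral_iff)
  show "expectation (\<lambda>\<omega>. B t \<omega> - B s \<omega>) = 0"
    using distributed_integral[OF D _ nn, of "\<lambda>x. x"] 1 by (simp add: has_bochner_integral_iff)
  show "integrable M (\<lambda>\<omega>. (B t \<omega> - B s \<omega>)\<^sup>2)"
    using distributed_integrable[OF D _ nn, of "\<lambda>x. x\<^sup>2"] 2 by (simp add: has_bochner_integral_iff)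
  show "expectation (\<lambda>\<omega>. (B t \<omega> - B s \<omega>)\<^sup>2) = t - s"
    using distributed_integral[OF D _ nn, of "\<lambda>x. x\<^sup>2"] 2 by (simp add: has_bochner_integral_iff)
qed

text \<open>Independence factorizes the expectations, so under a weight known at time
  \<open>s\<close> the increment enters only through its mean 0 and its variance
  \<open>t - s\<close>.\<close>

lemma increment_orthogonal:
  assumes st: "0 \<le> s" "s \<le> t" and U: "U \<in> borel_measurable (F s)" and int: "integrable M U"
  shows "integrable M (\<lambda>\<omega>. U \<omega> * (B t \<omega> - B s \<omega>))"
    "expectation (\<lambda>\<omega>. U \<omega> * (B t \<omega> - B s \<omega>)) = 0"
    "integrable M (\<lambda>\<omega>. U \<omega> * (B t \<omega> - B s \<omega>)\<^sup>2)"
    "expectation (\<lambda>\<omega>. U \<omega> * (B t \<omega> - B s \<omega>)\<^sup>2) = (t - s) * expectation U"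
proof -
  have "integrable M (\<lambda>\<omega>. U \<omega> * (B t \<omega> - B s \<omega>)) \<and>
    expectation (\<lambda>\<omega>. U \<omega> * (B t \<omega> - B s \<omega>)) = 0 \<and>
    integrable M (\<lambda>\<omega>. U \<omega> * (B t \<omega> - B s \<omega>)\<^sup>2) \<and>
    expectation (\<lambda>\<omega>. U \<omega> * (B t \<omega> - B s \<omega>)\<^sup>2) = (t - s) * expectation U"
  \<comment> \<open>The law of the increment is available for \<open>s < t\<close> only; for
    \<open>s = t\<close> both sides vanish.\<close>
  proof (cases "s = t")
    case False
    then have lt: "s < t" using st by simp
    note m = increment_moments[OF st(1) lt]
    have i1: "indep_var borel U borel (\<lambda>\<omega>. B t \<omega> - B s \<omega>)"
      by (rule indep_increment[OF st(1) lt U]) simp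
    have i2: "indep_var borel U borel (\<lambda>\<omega>. (B t \<omega> - B s \<omega>)\<^sup>2)"
      by (rule indep_increment[OF st(1) lt U]) simp
    show ?thesis
      using indep_var_integrable[OF i1 int m(1)] indep_var_lebesgue_integral[OF i1 int m(1)]
        indep_var_integrable[OF i2 int m(3)] indep_var_lebesgue_integral[OF i2 int m(3)] m
      by simp
  qed simp
  then show "integrable M (\<lambda>\<omega>. U \<omega> * (B t \<omega> - B s \<omega>))"
    "expectation (\<lambda>\<omega>. U \<omega> * (B t \<omega> - B s \<omega>)) = 0"
    "integrable M (\<lambda>\<omega>. U \<omega> * (B t \<omega> - B s \<omega>)\<^sup>2)"
    "expectation (\<lambda>\<omega>. U \<omega> * (B t \<omega> - B s \<omega>)\<^sup>2) = (t - s) * expectation U" by auto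
qed

text \<open>Given the past, \<open>U\<close> and \<open>\<xi>\<close> are constants and the Gaussian
  integral of the exponential is 1. Fubini for the product law of past and increment expresses this
  without conditional expectations, and nonnegative integrals keep integrability out of the
  statement.\<close>

lemma increment_exp_martingale:
  fixes U \<xi> :: "'a \<Rightarrow> real"
  assumes st: "0 \<le> s" "s \<le> t" and U: "U \<in> borel_measurable (F s)" and xi: "\<xi> \<in> borel_measurable (F s)"
    and nn: "\<And>\<omega>. 0 \<le> U \<omega>"
  shows "(\<integral>\<^sup>+ \<omega>. ennreal (U \<omega> * exp (\<xi> \<omega> * (B t \<omega> - B s \<omega>) - (\<xi> \<omega>)\<^sup>2 * (t - s) / 2)) \<partial>M)
     = (\<integral>\<^sup>+ \<omega>. ennreal (U \<omega>) \<partial>M)"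
proof (cases "s = t")
  case False
  then have lt: "s < t" using st by simp
  define P where "P = (\<lambda>\<omega>. (U \<omega>, \<xi> \<omega>))"
  \<comment> \<open>Both variables of \<open>indep_var\<close> have the same type, so the increment
    is padded to a pair by a dummy coordinate.\<close>
  define Z where "Z = (\<lambda>\<omega>. (B t \<omega> - B s \<omega>, 0::real))"
  have P: "P \<in> measurable (F s) (borel \<Otimes>\<^sub>M borel)" using U xi by (simp add: P_def)
  have PM: "P \<in> measurable M (borel \<Otimes>\<^sub>M borel)" using measurable_F_M[OF P st(1)] .
  have UM [measurable]: "U \<in> borel_measurable M" using measurable_F_M[OF U st(1)] .
  have Z [measurable]: "Z \<in> measurable M (borel \<Otimes>\<^sub>M borel)"
    using B_measurable[of s] B_measurable[of t] st by (simp add: Z_def)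
  have ind: "indep_var (borel \<Otimes>\<^sub>M borel) P (borel \<Otimes>\<^sub>M borel) Z"
    unfolding Z_def by (rule indep_increment[OF st(1) lt P]) simp
  have D: "distr M (borel \<Otimes>\<^sub>M borel) P \<Otimes>\<^sub>M distr M (borel \<Otimes>\<^sub>M borel) Z
      = distr M ((borel \<Otimes>\<^sub>M borel) \<Otimes>\<^sub>M (borel \<Otimes>\<^sub>M borel)) (\<lambda>x. (P x, Z x))"
    using iffD1[OF indep_var_distribution_eq ind] by blast
  interpret DZ: prob_space "distr M (borel \<Otimes>\<^sub>M borel) Z" by (rule prob_space_distr) simp
  define g :: "(real \<times> real) \<times> (real \<times> real) \<Rightarrow> ennreal"
    where "g = (\<lambda>w. ennreal (fst (fst w)) *
      ennreal (exp (snd (fst w) * fst (snd w) - (snd (fst w))\<^sup>2 * (t - s) / 2)))"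
  have g [measurable]: "g \<in> borel_measurable ((borel \<Otimes>\<^sub>M borel) \<Otimes>\<^sub>M (borel \<Otimes>\<^sub>M borel))"
    unfolding g_def fst_conv snd_conv by measurable
  have gp: "(\<lambda>z. g (p, z)) \<in> borel_measurable (borel \<Otimes>\<^sub>M borel)" for p
    unfolding g_def fst_conv snd_conv by measurable
  have gp2: "(\<lambda>z. g (p, (z, 0))) \<in> borel_measurable lborel" for p
    unfolding g_def fst_conv snd_conv by measurable
  have inner: "(\<integral>\<^sup>+ z. g (p, z) \<partial>distr M (borel \<Otimes>\<^sub>M borel) Z) = ennreal (fst p)" for p
  proof -
    have "(\<integral>\<^sup>+ z. g (p, z) \<partial>distr M (borel \<Otimes>\<^sub>M borel) Z) = (\<integral>\<^sup>+ \<omega>. g (p, (B t \<omega> - B s \<omega>, 0)) \<partial>M)"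
      using gp by (subst nn_integral_distr[OF Z]) (simp_all add: Z_def)
    also have "\<dots> = (\<integral>\<^sup>+ z. ennreal (normal_density 0 (sqrt (t - s)) z) * g (p, (z, 0)) \<partial>lborel)"
      by (rule distributed_nn_integral[OF increment_distributed[OF st(1) lt] gp2, symmetric])
    also have "\<dots> = (\<integral>\<^sup>+ z. ennreal (fst p) * (ennreal (normal_density 0 (sqrt (t - s)) z) *
        ennreal (exp (snd p * z - (snd p)\<^sup>2 * (t - s) / 2))) \<partial>lborel)"
      by (simp add: g_def mult_ac)
    also have "\<dots> = ennreal (fst p)"
      using lt by (subst nn_integral_cmult) (auto simp: nn_integral_normal_exp)
    finally show ?thesis .
  qed
  have "(\<integral>\<^sup>+ \<omega>. ennreal (U \<omega> * exp (\<xi> \<omega> * (B t \<omega> - B s \<omega>) - (\<xi> \<omega>)\<^sup>2 * (t - s) / 2)) \<partial>M)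
      = (\<integral>\<^sup>+ \<omega>. g (P \<omega>, Z \<omega>) \<partial>M)"
    using nn by (simp add: g_def P_def Z_def ennreal_mult)
  also have "\<dots> = (\<integral>\<^sup>+ w. g w \<partial>distr M ((borel \<Otimes>\<^sub>M borel) \<Otimes>\<^sub>M (borel \<Otimes>\<^sub>M borel)) (\<lambda>x. (P x, Z x)))"
    using PM by (subst nn_integral_distr) auto
  also have "\<dots> = (\<integral>\<^sup>+ p. \<integral>\<^sup>+ z. g (p, z) \<partial>distr M (borel \<Otimes>\<^sub>M borel) Z \<partial>distr M (borel \<Otimes>\<^sub>M borel) P)"
    unfolding D[symmetric] by (subst DZ.nn_integral_fst[symmetric]) auto
  also have "\<dots> = (\<integral>\<^sup>+ \<omega>. ennreal (U \<omega>) \<partial>M)"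
    unfolding inner using PM by (subst nn_integral_distr) (auto simp: P_def)
  finally show ?thesis .
qed simp

section \<open>Moments of discrete stochastic integrals\<close>

definition block_sum :: "(nat \<Rightarrow> real) \<Rightarrow> (nat \<Rightarrow> 'a \<Rightarrow> real) \<Rightarrow> nat \<Rightarrow> 'a \<Rightarrow> real" where
  "block_sum \<kappa> \<zeta> n \<omega> = (\<Sum>k<n. \<zeta> k \<omega> * (B (\<kappa> (Suc k)) \<omega> - B (\<kappa> k) \<omega>))"

text \<open>The predictable quadratic variation of \<open>block_sum\<close>, which is also the time
  integral of the squared step process.\<close>

definition block_var :: "(nat \<Rightarrow> real) \<Rightarrow> (nat \<Rightarrow> 'a \<Rightarrow> real) \<Rightarrow> nat \<Rightarrow> 'a \<Rightarrow> real" where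
  "block_var \<kappa> \<zeta> n \<omega> = (\<Sum>k<n. (\<zeta> k \<omega>)\<^sup>2 * (\<kappa> (Suc k) - \<kappa> k))"

text \<open>The conditions on a simple process, with grid, values and number of steps as separate
  arguments so that induction on the number of steps applies.\<close>

definition predictable_block :: "(nat \<Rightarrow> real) \<Rightarrow> (nat \<Rightarrow> 'a \<Rightarrow> real) \<Rightarrow> nat \<Rightarrow> bool" where
  "predictable_block \<kappa> \<zeta> n \<longleftrightarrow> 0 \<le> \<kappa> 0 \<and> (\<forall>k<n. \<kappa> k \<le> \<kappa> (Suc k)) \<and>
     (\<forall>k<n. \<zeta> k \<in> borel_measurable (F (\<kappa> k))) \<and>
     (\<exists>c. \<forall>k<n. \<forall>\<omega>\<in>space M. \<bar>\<zeta> k \<omega>\<bar> \<le> c)"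

lemma predictable_block_Suc: "predictable_block \<kappa> \<zeta> (Suc n) \<Longrightarrow> predictable_block \<kappa> \<zeta> n"
  unfolding predictable_block_def by (meson less_SucI)

lemma predictable_block_mono:
  assumes "predictable_block \<kappa> \<zeta> n" "j \<le> k" "k \<le> n"
  shows "\<kappa> j \<le> \<kappa> k"
  using assms(2,3)
proof (induction k rule: dec_induct)
  case (step k)
  then show ?case using assms(1) unfolding predictable_block_def by (meson Suc_le_lessD less_imp_le order_trans)
qed simp

lemma predictable_block_nonneg:
  assumes "predictable_block \<kappa> \<zeta> n" "k \<le> n"
  shows "0 \<le> \<kappa> k"
  using predictable_block_mono[OF assms(1), of 0 k] assms by (simp add: predictable_block_def)

lemma block_measurable:
  assumes "predictable_block \<kappa> \<zeta> n"
  shows "block_sum \<kappa> \<zeta> n \<in> borel_measurable (F (\<kappa> n))" "block_var \<kappa> \<zeta> n \<in> borel_measurable (F (\<kappa> n))"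
proof -
  have z: "\<zeta> k \<in> borel_measurable (F (\<kappa> n))" if "k < n" for k
  proof (rule measurable_F_mono)
    show "\<zeta> k \<in> borel_measurable (F (\<kappa> k))" using assms that unfolding predictable_block_def by blast
    show "0 \<le> \<kappa> k" "\<kappa> k \<le> \<kappa> n"
      using predictable_block_mono[OF assms, of k n] predictable_block_nonneg[OF assms, of k] that by simp_all
  qed
  have b: "B (\<kappa> k) \<in> borel_measurable (F (\<kappa> n))" if "k \<le> n" for k
    using predictable_block_mono[OF assms that] predictable_block_nonneg[OF assms that]
    by (intro measurable_F_mono[OF B_adapted]) simp_all
  show "block_sum \<kappa> \<zeta> n \<in> borel_measurable (F (\<kappa> n))"
    unfolding block_sum_def[abs_def]
    by (intro borel_measurable_sum borel_measurable_times borel_measurable_diff z b) auto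
  show "block_var \<kappa> \<zeta> n \<in> borel_measurable (F (\<kappa> n))"
    unfolding block_var_def[abs_def]
    by (intro borel_measurable_sum borel_measurable_times borel_measurable_power z borel_measurable_const) auto
qed

text \<open>A new step adds to the square a cross term with \<open>\<zeta> n * N * Z\<close>, of
  mean 0, and the term \<open>(\<zeta> n)\<^sup>2 * Z\<^sup>2\<close>, whose mean is that of the new
  summand of \<open>block_var\<close>. The weight \<open>Y\<close> is known before the block starts
  and is carried through. Integrability belongs to the induction because every orthogonality
  relation asks for it.\<close>

lemma block_moments:
  assumes "predictable_block \<kappa> \<zeta> n"
    and Y: "Y \<in> borel_measurable (F (\<kappa> 0))" and Yc: "\<And>\<omega>. \<omega> \<in> space M \<Longrightarrow> \<bar>Y \<omega>\<bar> \<le> (b::real)"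
  shows "integrable M (\<lambda>\<omega>. (block_sum \<kappa> \<zeta> n \<omega>)\<^sup>2) \<and> integrable M (block_sum \<kappa> \<zeta> n) \<and>
    integrable M (block_var \<kappa> \<zeta> n) \<and>
    expectation (\<lambda>\<omega>. Y \<omega> * block_sum \<kappa> \<zeta> n \<omega>) = 0 \<and>
    expectation (\<lambda>\<omega>. Y \<omega> * (block_sum \<kappa> \<zeta> n \<omega>)\<^sup>2) = expectation (\<lambda>\<omega>. Y \<omega> * block_var \<kappa> \<zeta> n \<omega>)"
  using assms(1)
proof (induction n)
  case 0
  then show ?case by (simp add: block_sum_def[abs_def] block_var_def[abs_def])
next
  case (Suc n)
  note pb = predictable_block_Suc[OF Suc.prems]
  note IH = Suc.IH[OF pb]
  define s t where "s = \<kappa> n" and "t = \<kappa> (Suc n)"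
  define N where "N = block_sum \<kappa> \<zeta> n"
  define V where "V = block_var \<kappa> \<zeta> n"
  define Z where "Z = (\<lambda>\<omega>. B t \<omega> - B s \<omega>)"
  have st: "0 \<le> s" "s \<le> t" using Suc.prems predictable_block_nonneg[OF pb, of n]
    by (auto simp: predictable_block_def s_def t_def)
  have k0: "0 \<le> \<kappa> 0" "\<kappa> 0 \<le> s"
    using predictable_block_mono[OF pb, of 0 n] Suc.prems by (auto simp: s_def predictable_block_def)
  obtain c where "\<forall>k<Suc n. \<forall>\<omega>\<in>space M. \<bar>\<zeta> k \<omega>\<bar> \<le> c"
    using Suc.prems unfolding predictable_block_def by blast
  then have c: "\<And>\<omega>. \<omega> \<in> space M \<Longrightarrow> \<bar>\<zeta> n \<omega>\<bar> \<le> c" by blast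
  have z: "\<zeta> n \<in> borel_measurable (F s)" using Suc.prems by (auto simp: predictable_block_def s_def)
  have NF: "N \<in> borel_measurable (F s)" and VF: "V \<in> borel_measurable (F s)"
    using block_measurable[OF pb] by (auto simp: N_def V_def s_def)
  have YF: "Y \<in> borel_measurable (F s)" using measurable_F_mono[OF Y k0] .
  note [measurable] = measurable_F_M[OF z st(1)] measurable_F_M[OF NF st(1)] measurable_F_M[OF VF st(1)]
    measurable_F_M[OF YF st(1)]
  have ZM [measurable]: "Z \<in> borel_measurable M" using st by (auto simp: Z_def)
  have Zf: "B t \<omega> - B s \<omega> = Z \<omega>" for \<omega> by (simp add: Z_def)
  have c2: "\<bar>(\<zeta> n \<omega>)\<^sup>2\<bar> \<le> c\<^sup>2" if "\<omega> \<in> space M" for \<omega>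
    using power_mono[OF c[OF that], of 2] by simp
  have Yz: "\<bar>Y \<omega> * \<zeta> n \<omega>\<bar> \<le> b * c" if "\<omega> \<in> space M" for \<omega>
    using mult_mono[OF Yc[OF that] c[OF that]] Yc[OF that] by (auto simp: abs_mult)
  have Yz2: "\<bar>Y \<omega> * (\<zeta> n \<omega>)\<^sup>2\<bar> \<le> b * c\<^sup>2" if "\<omega> \<in> space M" for \<omega>
    using mult_mono[OF Yc[OF that] c2[OF that]] Yc[OF that] by (auto simp: abs_mult)
  have iN: "integrable M N" and iN2: "integrable M (\<lambda>\<omega>. (N \<omega>)\<^sup>2)" and iV: "integrable M V"
    and EN: "expectation (\<lambda>\<omega>. Y \<omega> * N \<omega>) = 0"
    and EN2: "expectation (\<lambda>\<omega>. Y \<omega> * (N \<omega>)\<^sup>2) = expectation (\<lambda>\<omega>. Y \<omega> * V \<omega>)"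
    using IH by (auto simp: N_def V_def)
  have i1: "integrable M (\<zeta> n)" by (rule integrable_const_bound[of _ c]) (use c in auto)
  have i2: "integrable M (\<lambda>\<omega>. (\<zeta> n \<omega>)\<^sup>2)"
    by (rule integrable_const_bound[of _ "c\<^sup>2"]) (use c2 in auto)
  have i3: "integrable M (\<lambda>\<omega>. \<zeta> n \<omega> * N \<omega>)" by (rule integrable_bounded_mult[OF iN _ c]) auto
  have i4: "integrable M (\<lambda>\<omega>. Y \<omega> * \<zeta> n \<omega>)" by (rule integrable_const_bound[of _ "b * c"]) (use Yz in auto)
  have i5: "integrable M (\<lambda>\<omega>. Y \<omega> * (\<zeta> n \<omega>)\<^sup>2)" by (rule integrable_const_bound[of _ "b * c\<^sup>2"]) (use Yz2 in auto)
  have i6: "integrable M (\<lambda>\<omega>. Y \<omega> * \<zeta> n \<omega> * N \<omega>)" by (rule integrable_bounded_mult[OF iN _ Yz]) auto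
  note o1 = increment_orthogonal[OF st z i1, unfolded Zf]
  have zz: "(\<lambda>\<omega>. (\<zeta> n \<omega>)\<^sup>2) \<in> borel_measurable (F s)" using z by simp
  note o2 = increment_orthogonal[OF st zz i2, unfolded Zf]
  have zN: "(\<lambda>\<omega>. \<zeta> n \<omega> * N \<omega>) \<in> borel_measurable (F s)" using z NF by simp
  note o3 = increment_orthogonal[OF st zN i3, unfolded Zf]
  have Yz': "(\<lambda>\<omega>. Y \<omega> * \<zeta> n \<omega>) \<in> borel_measurable (F s)" using z YF by simp
  note o4 = increment_orthogonal[OF st Yz' i4, unfolded Zf]
  have Yz2': "(\<lambda>\<omega>. Y \<omega> * (\<zeta> n \<omega>)\<^sup>2) \<in> borel_measurable (F s)" using z YF by simp
  note o5 = increment_orthogonal[OF st Yz2' i5, unfolded Zf]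
  have YzN': "(\<lambda>\<omega>. Y \<omega> * \<zeta> n \<omega> * N \<omega>) \<in> borel_measurable (F s)" using z YF NF by simp
  note o6 = increment_orthogonal[OF st YzN' i6, unfolded Zf]
  have eN: "block_sum \<kappa> \<zeta> (Suc n) \<omega> = N \<omega> + \<zeta> n \<omega> * Z \<omega>" for \<omega>
    by (simp add: block_sum_def N_def Z_def s_def t_def)
  have eV: "block_var \<kappa> \<zeta> (Suc n) \<omega> = V \<omega> + (t - s) * (\<zeta> n \<omega>)\<^sup>2" for \<omega>
    by (simp add: block_var_def V_def s_def t_def)
  have eN2: "(block_sum \<kappa> \<zeta> (Suc n) \<omega>)\<^sup>2 = (N \<omega>)\<^sup>2 + 2 * (\<zeta> n \<omega> * N \<omega> * Z \<omega>) + (\<zeta> n \<omega>)\<^sup>2 * (Z \<omega>)\<^sup>2" for \<omega>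
    by (simp add: eN power2_eq_square algebra_simps)
  have iYN: "integrable M (\<lambda>\<omega>. Y \<omega> * N \<omega>)" by (rule integrable_bounded_mult[OF iN _ Yc]) auto
  have iYN2: "integrable M (\<lambda>\<omega>. Y \<omega> * (N \<omega>)\<^sup>2)" by (rule integrable_bounded_mult[OF iN2 _ Yc]) auto
  have iYV: "integrable M (\<lambda>\<omega>. Y \<omega> * V \<omega>)" by (rule integrable_bounded_mult[OF iV _ Yc]) auto
  show ?case
  proof (intro conjI)
    show "integrable M (\<lambda>\<omega>. (block_sum \<kappa> \<zeta> (Suc n) \<omega>)\<^sup>2)"
      unfolding eN2 by (intro Bochner_Integration.integrable_add integrable_mult_right iN2 o3(1) o2(3))
    show "integrable M (block_sum \<kappa> \<zeta> (Suc n))"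
      unfolding eN by (intro Bochner_Integration.integrable_add iN o1(1))
    show "integrable M (block_var \<kappa> \<zeta> (Suc n))"
      unfolding eV by (intro Bochner_Integration.integrable_add iV integrable_mult_right i2)
    have "expectation (\<lambda>\<omega>. Y \<omega> * block_sum \<kappa> \<zeta> (Suc n) \<omega>)
       = expectation (\<lambda>\<omega>. Y \<omega> * N \<omega> + Y \<omega> * \<zeta> n \<omega> * Z \<omega>)"
      by (simp add: eN algebra_simps)
    also have "\<dots> = 0" using iYN o4 EN by simp
    finally show "expectation (\<lambda>\<omega>. Y \<omega> * block_sum \<kappa> \<zeta> (Suc n) \<omega>) = 0" .
    have "expectation (\<lambda>\<omega>. Y \<omega> * (block_sum \<kappa> \<zeta> (Suc n) \<omega>)\<^sup>2)
       = expectation (\<lambda>\<omega>. Y \<omega> * (N \<omega>)\<^sup>2 + 2 * (Y \<omega> * \<zeta> n \<omega> * N \<omega> * Z \<omega>) + Y \<omega> * (\<zeta> n \<omega>)\<^sup>2 * (Z \<omega>)\<^sup>2)"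
      by (simp add: eN2 algebra_simps)
    also have "\<dots> = expectation (\<lambda>\<omega>. Y \<omega> * V \<omega>) + (t - s) * expectation (\<lambda>\<omega>. Y \<omega> * (\<zeta> n \<omega>)\<^sup>2)"
      using iYN2 o6 o5 EN2 by simp
    also have "\<dots> = expectation (\<lambda>\<omega>. Y \<omega> * V \<omega> + (t - s) * (Y \<omega> * (\<zeta> n \<omega>)\<^sup>2))"
      using iYV i5 by simp
    also have "\<dots> = expectation (\<lambda>\<omega>. Y \<omega> * block_var \<kappa> \<zeta> (Suc n) \<omega>)"
      by (simp add: eV algebra_simps)
    finally show "expectation (\<lambda>\<omega>. Y \<omega> * (block_sum \<kappa> \<zeta> (Suc n) \<omega>)\<^sup>2)
       = expectation (\<lambda>\<omega>. Y \<omega> * block_var \<kappa> \<zeta> (Suc n) \<omega>)" .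
  qed
qed

text \<open>This is the stochastic exponential of the block: given the past of the last step, its
  last factor integrates to 1.\<close>

lemma block_exp:
  assumes "predictable_block \<kappa> \<zeta> n"
  shows "(\<integral>\<^sup>+ \<omega>. ennreal (exp (l * block_sum \<kappa> \<zeta> n \<omega> - l\<^sup>2 * block_var \<kappa> \<zeta> n \<omega> / 2)) \<partial>M) = 1"
  using assms
proof (induction n)
  case 0
  then show ?case by (simp add: block_sum_def block_var_def emeasure_space_1)
next
  case (Suc n)
  note pb = predictable_block_Suc[OF Suc.prems]
  define s t where "s = \<kappa> n" and "t = \<kappa> (Suc n)"
  have st: "0 \<le> s" "s \<le> t" using Suc.prems predictable_block_nonneg[OF pb, of n]
    by (auto simp: predictable_block_def s_def t_def)
  have z: "\<zeta> n \<in> borel_measurable (F s)" using Suc.prems by (auto simp: predictable_block_def s_def)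
  have z': "(\<lambda>\<omega>. l * \<zeta> n \<omega>) \<in> borel_measurable (F s)" using z by simp
  have U: "(\<lambda>\<omega>. exp (l * block_sum \<kappa> \<zeta> n \<omega> - l\<^sup>2 * block_var \<kappa> \<zeta> n \<omega> / 2)) \<in> borel_measurable (F s)"
    using block_measurable[OF pb] by (simp add: s_def)
  have "(\<integral>\<^sup>+ \<omega>. ennreal (exp (l * block_sum \<kappa> \<zeta> (Suc n) \<omega> - l\<^sup>2 * block_var \<kappa> \<zeta> (Suc n) \<omega> / 2)) \<partial>M)
     = (\<integral>\<^sup>+ \<omega>. ennreal (exp (l * block_sum \<kappa> \<zeta> n \<omega> - l\<^sup>2 * block_var \<kappa> \<zeta> n \<omega> / 2) *
         exp ((l * \<zeta> n \<omega>) * (B t \<omega> - B s \<omega>) - (l * \<zeta> n \<omega>)\<^sup>2 * (t - s) / 2)) \<partial>M)"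
    by (simp add: block_sum_def block_var_def s_def t_def exp_add[symmetric] power_mult_distrib
        algebra_simps add_divide_distrib diff_divide_distrib)
  also have "\<dots> = (\<integral>\<^sup>+ \<omega>. ennreal (exp (l * block_sum \<kappa> \<zeta> n \<omega> - l\<^sup>2 * block_var \<kappa> \<zeta> n \<omega> / 2)) \<partial>M)"
    by (rule increment_exp_martingale[OF st U z']) simp
  finally show ?case using Suc.IH[OF pb] by simp
qed

text \<open>For \<open>l = 1 / r\<close> and \<open>l = - 1 / r\<close> the variation term in the
  stochastic exponential costs a factor of at most \<open>exp (1/2) \<le> 2\<close>, so
  \<open>exp (N / r)\<close> and \<open>exp (- N / r)\<close> have expectation at most 2. A cube is
  at most \<open>27 * r ^ 3\<close> times the sum of these exponentials, and
  \<open>27 * (2 + 2) = 108\<close>.\<close>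

lemma block_third_moment:
  assumes pb: "predictable_block \<kappa> \<zeta> n" and r: "0 < r"
    and V: "\<And>\<omega>. \<omega> \<in> space M \<Longrightarrow> block_var \<kappa> \<zeta> n \<omega> \<le> r\<^sup>2"
  shows "integrable M (\<lambda>\<omega>. \<bar>block_sum \<kappa> \<zeta> n \<omega>\<bar> ^ 3)"
    "expectation (\<lambda>\<omega>. \<bar>block_sum \<kappa> \<zeta> n \<omega>\<bar> ^ 3) \<le> 108 * r ^ 3"
proof -
  define N where "N = block_sum \<kappa> \<zeta> n"
  have NM [measurable]: "N \<in> borel_measurable M" and [measurable]: "block_var \<kappa> \<zeta> n \<in> borel_measurable M"
    using block_measurable[OF pb] measurable_F_M predictable_block_nonneg[OF pb, of n]
    by (auto simp: N_def)
  have e: "(\<integral>\<^sup>+ \<omega>. ennreal (exp (l * N \<omega>)) \<partial>M) \<le> 2" if l: "l\<^sup>2 * r\<^sup>2 = 1" for l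
  proof -
    have "(\<integral>\<^sup>+ \<omega>. ennreal (exp (l * N \<omega>)) \<partial>M)
      \<le> (\<integral>\<^sup>+ \<omega>. 2 * ennreal (exp (l * N \<omega> - l\<^sup>2 * block_var \<kappa> \<zeta> n \<omega> / 2)) \<partial>M)"
    proof (rule nn_integral_mono)
      fix \<omega> assume w: "\<omega> \<in> space M"
      have "l\<^sup>2 * block_var \<kappa> \<zeta> n \<omega> \<le> 1" using mult_left_mono[OF V[OF w], of "l\<^sup>2"] l by simp
      then have "exp (l * N \<omega>) \<le> exp (1 / 2 + (l * N \<omega> - l\<^sup>2 * block_var \<kappa> \<zeta> n \<omega> / 2))" by simp
      also have "\<dots> = exp (1/2) * exp (l * N \<omega> - l\<^sup>2 * block_var \<kappa> \<zeta> n \<omega> / 2)" by (simp add: exp_add)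
      also have "\<dots> \<le> 2 * exp (l * N \<omega> - l\<^sup>2 * block_var \<kappa> \<zeta> n \<omega> / 2)"
        using exp_bound_half[of "1/2::real"] by simp
      finally show "ennreal (exp (l * N \<omega>)) \<le> 2 * ennreal (exp (l * N \<omega> - l\<^sup>2 * block_var \<kappa> \<zeta> n \<omega> / 2))"
        by (metis (no_types, lifting) ennreal_leI ennreal_mult' ennreal_numeral zero_le_numeral)
    qed
    also have "\<dots> = 2" using block_exp[OF pb, of l, folded N_def] by (subst nn_integral_cmult) auto
    finally show ?thesis .
  qed
  have pt: "\<bar>x\<bar> ^ 3 \<le> 27 * r ^ 3 * (exp ((1/r) * x) + exp ((-1/r) * x))" for x
  proof -
    define y where "y = \<bar>x\<bar> / r"
    have y0: "0 \<le> y" using r by (simp add: y_def)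
    \<comment> \<open>Cubing this inequality is the origin of the factor 27.\<close>
    have "y / 3 \<le> exp (y / 3)" using exp_ge_add_one_self[of "y/3"] by linarith
    then have "(y / 3) ^ 3 \<le> exp (y / 3) ^ 3" using y0 by (intro power_mono) auto
    also have "exp (y / 3) ^ 3 = exp y" by (simp add: exp_of_nat_mult[symmetric])
    finally have "y ^ 3 \<le> 27 * exp y" by (simp add: power_divide)
    also have "exp y \<le> exp ((1/r) * x) + exp ((-1/r) * x)"
      by (cases "0 \<le> x") (auto simp: y_def)
    finally have "r ^ 3 * y ^ 3 \<le> r ^ 3 * (27 * (exp ((1/r) * x) + exp ((-1/r) * x)))"
      using r by (intro mult_left_mono) auto
    then show ?thesis using r by (simp add: y_def power_divide algebra_simps)
  qed
  have bnd: "(\<integral>\<^sup>+ \<omega>. ennreal (\<bar>N \<omega>\<bar> ^ 3) \<partial>M) \<le> ennreal (108 * r ^ 3)"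
  proof -
    have "(\<integral>\<^sup>+ \<omega>. ennreal (\<bar>N \<omega>\<bar> ^ 3) \<partial>M)
       \<le> (\<integral>\<^sup>+ \<omega>. ennreal (27 * r ^ 3) * (ennreal (exp ((1/r) * N \<omega>)) + ennreal (exp ((-1/r) * N \<omega>))) \<partial>M)"
    proof (rule nn_integral_mono)
      fix \<omega>
      show "ennreal (\<bar>N \<omega>\<bar> ^ 3) \<le> ennreal (27 * r ^ 3) * (ennreal (exp ((1/r) * N \<omega>)) + ennreal (exp ((-1/r) * N \<omega>)))"
        using pt[of "N \<omega>"] r by (subst ennreal_plus[symmetric], simp, simp, subst ennreal_mult[symmetric]) (auto intro!: ennreal_leI)
    qed
    also have "\<dots> = ennreal (27 * r ^ 3) * ((\<integral>\<^sup>+ \<omega>. ennreal (exp ((1/r) * N \<omega>)) \<partial>M) + (\<integral>\<^sup>+ \<omega>. ennreal (exp ((-1/r) * N \<omega>)) \<partial>M))"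
      by (subst nn_integral_cmult) (auto simp: nn_integral_add)
    also have "\<dots> \<le> ennreal (27 * r ^ 3) * (2 + 2)"
      using r by (intro mult_left_mono add_mono e) (auto simp: power_divide)
    also have "\<dots> = ennreal (108 * r ^ 3)"
    proof -
      have "ennreal (27 * r ^ 3) * (2 + 2) = ennreal (27 * r ^ 3) * ennreal 4" by simp
      also have "\<dots> = ennreal (27 * r ^ 3 * 4)" using r by (subst ennreal_mult) auto
      finally show ?thesis by (simp add: mult_ac)
    qed
    finally show ?thesis .
  qed
  show i: "integrable M (\<lambda>\<omega>. \<bar>block_sum \<kappa> \<zeta> n \<omega>\<bar> ^ 3)"
    unfolding N_def[symmetric]
    using bnd by (intro integrableI_bounded) (auto simp: less_top[symmetric] top_unique)
  show "expectation (\<lambda>\<omega>. \<bar>block_sum \<kappa> \<zeta> n \<omega>\<bar> ^ 3) \<le> 108 * r ^ 3"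
    using bnd r unfolding N_def[symmetric]
    by (intro integral_real_bounded) auto
qed

end

section \<open>Approximation of Ito integrals on a time interval\<close>

lemma simple_value_clamp:
  fixes a b s :: real and \<tau> :: "nat \<Rightarrow> real"
  assumes "a < s" "s \<le> b"
  shows "indicator {\<tau> k<..\<tau> (Suc k)} s = (indicator {max a (min b (\<tau> k))<..max a (min b (\<tau> (Suc k)))} s :: real)"
  using assms by (auto simp: indicator_def)

text \<open>At most one step contains \<open>s\<close>, so no mixed products survive. The second
  conjunct closes the induction: a new step begins where the old sum has already become
  zero.\<close>

lemma square_sum_disjoint_steps:
  fixes \<kappa> :: "nat \<Rightarrow> real" and z :: "nat \<Rightarrow> real"
  assumes "\<And>k. k < n \<Longrightarrow> \<kappa> k \<le> \<kappa> (Suc k)"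
  shows "(\<Sum>k<n. z k * indicator {\<kappa> k<..\<kappa> (Suc k)} s)\<^sup>2 = (\<Sum>k<n. (z k)\<^sup>2 * indicator {\<kappa> k<..\<kappa> (Suc k)} s)
    \<and> (\<kappa> n < s \<longrightarrow> (\<Sum>k<n. z k * indicator {\<kappa> k<..\<kappa> (Suc k)} s) = 0)"
  using assms
proof (induction n)
  case (Suc n)
  then have IH: "(\<Sum>k<n. z k * indicator {\<kappa> k<..\<kappa> (Suc k)} s)\<^sup>2 = (\<Sum>k<n. (z k)\<^sup>2 * indicator {\<kappa> k<..\<kappa> (Suc k)} s)"
    "\<kappa> n < s \<Longrightarrow> (\<Sum>k<n. z k * indicator {\<kappa> k<..\<kappa> (Suc k)} s) = 0" "\<kappa> n \<le> \<kappa> (Suc n)"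
    by auto
  show ?case
  proof (cases "\<kappa> n < s")
    case True
    then have "(\<Sum>k<n. (z k)\<^sup>2 * indicator {\<kappa> k<..\<kappa> (Suc k)} s) = 0"
      using IH(1) IH(2)[OF True] by simp
    then show ?thesis using True IH by (auto simp: indicator_def power_mult_distrib)
  next
    case False
    then show ?thesis using IH by (auto simp: indicator_def)
  qed
qed simp

text \<open>This integrates \<open>h\<^sup>2 \<le> 2 * g\<^sup>2 + 2 * (g - h)\<^sup>2\<close>.
  Measurability is asked for on \<open>A\<close> only, because the path of the integrand is under
  control only on the time interval considered.\<close>

lemma nn_integral_square_triangle:
  fixes g h :: "real \<Rightarrow> real"
  assumes g: "(\<lambda>s. indicator A s * g s) \<in> borel_measurable borel" and h: "(\<lambda>s. indicator A s * h s) \<in> borel_measurable borel"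
  shows "(\<integral>\<^sup>+ s\<in>A. ennreal ((h s)\<^sup>2) \<partial>lborel)
    \<le> 2 * (\<integral>\<^sup>+ s\<in>A. ennreal ((g s)\<^sup>2) \<partial>lborel) + 2 * (\<integral>\<^sup>+ s\<in>A. ennreal ((g s - h s)\<^sup>2) \<partial>lborel)"
proof -
  define g' h' where "g' = (\<lambda>s. indicator A s * g s)" and "h' = (\<lambda>s. indicator A s * h s)"
  have [measurable]: "g' \<in> borel_measurable borel" "h' \<in> borel_measurable borel" using g h by (auto simp: g'_def h'_def)
  have "(\<integral>\<^sup>+ s\<in>A. ennreal ((h s)\<^sup>2) \<partial>lborel) = (\<integral>\<^sup>+ s. ennreal ((h' s)\<^sup>2) \<partial>lborel)"
    by (intro nn_integral_cong) (auto simp: h'_def indicator_def)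
  also have "\<dots> \<le> (\<integral>\<^sup>+ s. 2 * ennreal ((g' s)\<^sup>2) + 2 * ennreal ((g' s - h' s)\<^sup>2) \<partial>lborel)"
  proof (rule nn_integral_mono)
    fix s
    have "(h' s)\<^sup>2 \<le> 2 * (g' s)\<^sup>2 + 2 * (g' s - h' s)\<^sup>2"
      using zero_le_power2[of "2 * g' s - h' s"] by (simp add: power2_eq_square algebra_simps)
    then have "ennreal ((h' s)\<^sup>2) \<le> ennreal (2 * (g' s)\<^sup>2 + 2 * (g' s - h' s)\<^sup>2)" by (rule ennreal_leI)
    then show "ennreal ((h' s)\<^sup>2) \<le> 2 * ennreal ((g' s)\<^sup>2) + 2 * ennreal ((g' s - h' s)\<^sup>2)"
      by (simp add: ennreal_mult)
  qed
  also have "\<dots> = 2 * (\<integral>\<^sup>+ s. ennreal ((g' s)\<^sup>2) \<partial>lborel) + 2 * (\<integral>\<^sup>+ s. ennreal ((g' s - h' s)\<^sup>2) \<partial>lborel)"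
    by (subst nn_integral_add) (auto simp: nn_integral_cmult)
  also have "(\<integral>\<^sup>+ s. ennreal ((g' s)\<^sup>2) \<partial>lborel) = (\<integral>\<^sup>+ s\<in>A. ennreal ((g s)\<^sup>2) \<partial>lborel)"
    by (intro nn_integral_cong) (auto simp: g'_def indicator_def)
  also have "(\<integral>\<^sup>+ s. ennreal ((g' s - h' s)\<^sup>2) \<partial>lborel) = (\<integral>\<^sup>+ s\<in>A. ennreal ((g s - h s)\<^sup>2) \<partial>lborel)"
    by (intro nn_integral_cong) (auto simp: g'_def h'_def indicator_def)
  finally show ?thesis .
qed

lemma tendsto_zero_in_probD:
  assumes "tendsto_zero_in_prob M Z" "0 < \<epsilon>" "0 < \<delta>"
  shows "\<forall>\<^sub>F n in sequentially. \<exists>A\<in>sets M. measure M A < \<delta> \<and> (\<forall>\<omega>\<in>space M - A. Z n \<omega> \<le> ennreal \<epsilon>)"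
  using assms by (simp add: tendsto_zero_in_prob_def)

section \<open>Blocks with capped quadratic variation\<close>

context filtered_brownian
begin

lemma block_var_mono:
  assumes "predictable_block \<kappa> \<zeta> n" "j \<le> n"
  shows "block_var \<kappa> \<zeta> j \<omega> \<le> block_var \<kappa> \<zeta> n \<omega>"
  unfolding block_var_def
  by (rule sum_mono2) (use assms in \<open>auto simp: predictable_block_def\<close>)

text \<open>A block is stopped before its quadratic variation exceeds \<open>K\<close>; the quadratic variation up to
  the end of a step is already known at its beginning, so the stopped block is still predictable.\<close>

definition stopped :: "real \<Rightarrow> (nat \<Rightarrow> real) \<Rightarrow> (nat \<Rightarrow> 'a \<Rightarrow> real) \<Rightarrow> nat \<Rightarrow> 'a \<Rightarrow> real" where
  "stopped K \<kappa> \<zeta> k \<omega> = (if block_var \<kappa> \<zeta> (Suc k) \<omega> \<le> K then \<zeta> k \<omega> else 0)"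

lemma predictable_block_le: "predictable_block \<kappa> \<zeta> n \<Longrightarrow> k \<le> n \<Longrightarrow> predictable_block \<kappa> \<zeta> k"
  unfolding predictable_block_def by (meson less_le_trans)

lemma predictable_block_stopped:
  assumes pb: "predictable_block \<kappa> \<zeta> n"
  shows "predictable_block \<kappa> (stopped K \<kappa> \<zeta>) n"
proof -
  obtain c where c: "\<forall>k<n. \<forall>\<omega>\<in>space M. \<bar>\<zeta> k \<omega>\<bar> \<le> c"
    using pb unfolding predictable_block_def by blast
  have "stopped K \<kappa> \<zeta> k \<in> borel_measurable (F (\<kappa> k))" if "k < n" for k
  proof -
    have z: "\<zeta> k \<in> borel_measurable (F (\<kappa> k))" using pb that unfolding predictable_block_def by blast
    have v: "block_var \<kappa> \<zeta> k \<in> borel_measurable (F (\<kappa> k))"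
      by (rule block_measurable[OF predictable_block_le[OF pb]]) (use that in simp)
    have "stopped K \<kappa> \<zeta> k = (\<lambda>\<omega>. if block_var \<kappa> \<zeta> k \<omega> + (\<zeta> k \<omega>)\<^sup>2 * (\<kappa> (Suc k) - \<kappa> k) \<le> K then \<zeta> k \<omega> else 0)"
      by (auto simp: stopped_def block_var_def fun_eq_iff)
    then show ?thesis using z v by simp
  qed
  moreover have "\<forall>k<n. \<forall>\<omega>\<in>space M. \<bar>stopped K \<kappa> \<zeta> k \<omega>\<bar> \<le> \<bar>c\<bar>"
    using c by (fastforce simp: stopped_def)
  ultimately show ?thesis using pb unfolding predictable_block_def by blast
qed

lemma block_var_stopped_le:
  assumes "predictable_block \<kappa> \<zeta> n" and K: "0 \<le> K"
  shows "block_var \<kappa> (stopped K \<kappa> \<zeta>) n \<omega> \<le> K"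
proof -
  \<comment> \<open>The comparison with the unstopped variation is added for the induction: as long
    as steps are kept, the bound \<open>K\<close> is inherited from it.\<close>
  have "block_var \<kappa> (stopped K \<kappa> \<zeta>) n \<omega> \<le> K \<and> block_var \<kappa> (stopped K \<kappa> \<zeta>) n \<omega> \<le> block_var \<kappa> \<zeta> n \<omega>"
    using assms(1)
  proof (induction n)
    case 0
    then show ?case using K by (simp add: block_var_def)
  next
    case (Suc n)
    note IH = Suc.IH[OF predictable_block_Suc[OF Suc.prems]]
    have k: "\<kappa> n \<le> \<kappa> (Suc n)" using Suc.prems unfolding predictable_block_def by blast
    have s: "block_var \<kappa> \<xi> (Suc n) \<omega> = block_var \<kappa> \<xi> n \<omega> + (\<xi> n \<omega>)\<^sup>2 * (\<kappa> (Suc n) - \<kappa> n)" for \<xi>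
      by (simp add: block_var_def)
    show ?case
    proof (cases "block_var \<kappa> \<zeta> (Suc n) \<omega> \<le> K")
      case True
      then have "stopped K \<kappa> \<zeta> n \<omega> = \<zeta> n \<omega>" by (simp add: stopped_def)
      then show ?thesis using IH True s[of "stopped K \<kappa> \<zeta>"] s[of \<zeta>] by simp
    next
      case False
      then have "stopped K \<kappa> \<zeta> n \<omega> = 0" by (simp add: stopped_def)
      moreover have "block_var \<kappa> \<zeta> n \<omega> \<le> block_var \<kappa> \<zeta> (Suc n) \<omega>"
        by (rule block_var_mono[OF Suc.prems]) simp
      ultimately show ?thesis using IH s[of "stopped K \<kappa> \<zeta>"] by simp
    qed
  qed
  then show ?thesis by simp
qed

text \<open>The variation grows along the block, so a total of at most \<open>K\<close> means that
  no step was cut.\<close>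

lemma stopped_eq:
  assumes "predictable_block \<kappa> \<zeta> n" "block_var \<kappa> \<zeta> n \<omega> \<le> K"
  shows "block_sum \<kappa> (stopped K \<kappa> \<zeta>) n \<omega> = block_sum \<kappa> \<zeta> n \<omega>"
    "block_var \<kappa> (stopped K \<kappa> \<zeta>) n \<omega> = block_var \<kappa> \<zeta> n \<omega>"
proof -
  have "stopped K \<kappa> \<zeta> k \<omega> = \<zeta> k \<omega>" if "k < n" for k
    using block_var_mono[OF assms(1), of "Suc k" \<omega>] that assms(2) by (simp add: stopped_def)
  then show "block_sum \<kappa> (stopped K \<kappa> \<zeta>) n \<omega> = block_sum \<kappa> \<zeta> n \<omega>"
    "block_var \<kappa> (stopped K \<kappa> \<zeta>) n \<omega> = block_var \<kappa> \<zeta> n \<omega>"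
    by (simp_all add: block_sum_def block_var_def)
qed

text \<open>Clamping the grid points to \<open>[a, b]\<close> turns the increment of the simple
  integral into a block. Steps that collapse under clamping get the value 0, since for those to the
  right of \<open>b\<close> the original value need not be known at the clamped time. A step of
  positive length satisfies \<open>\<tau> k \<le> \<kappa> k\<close>, so its value is known when it
  starts.\<close>

lemma simple_process_block:
  assumes S: "is_simple_process M F (n, \<tau>, \<xi>)" and ab: "0 \<le> a" "a < b"
  defines "\<kappa> \<equiv> \<lambda>k. max a (min b (\<tau> k))"
  defines "\<zeta> \<equiv> \<lambda>k \<omega>. if \<kappa> k < \<kappa> (Suc k) then \<xi> k \<omega> else 0"
  shows "predictable_block \<kappa> \<zeta> n"
    "simple_integral (n, \<tau>, \<xi>) B b \<omega> - simple_integral (n, \<tau>, \<xi>) B a \<omega> = block_sum \<kappa> \<zeta> n \<omega>"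
    "(\<integral>\<^sup>+ s\<in>{a..b}. ennreal ((simple_value (n, \<tau>, \<xi>) s \<omega>)\<^sup>2) \<partial>lborel) = ennreal (block_var \<kappa> \<zeta> n \<omega>)"
proof -
  have mono: "\<kappa> k \<le> \<kappa> (Suc k)" if "k < n" for k
  proof -
    have "\<tau> k \<le> \<tau> (Suc k)" using S that unfolding is_simple_process_def prod.case by blast
    then show ?thesis unfolding \<kappa>_def by (intro max.mono min.mono) auto
  qed
  obtain c where c: "\<forall>k<n. \<forall>\<omega>\<in>space M. \<bar>\<xi> k \<omega>\<bar> \<le> c"
    using S unfolding is_simple_process_def prod.case by blast
  have tau: "0 \<le> \<tau> k" if "k \<le> n" for k
    using that
  proof (induction k)
    case 0
    then show ?case using S by (simp add: is_simple_process_def)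
  next
    case (Suc k)
    have "\<tau> k \<le> \<tau> (Suc k)" using S Suc.prems unfolding is_simple_process_def prod.case by simp
    then show ?case using Suc by simp
  qed
  have "\<zeta> k \<in> borel_measurable (F (\<kappa> k))" if "k < n" for k
  proof (cases "\<kappa> k < \<kappa> (Suc k)")
    case True
    then have "\<tau> k \<le> \<kappa> k" by (auto simp: \<kappa>_def)
    moreover have "\<xi> k \<in> borel_measurable (F (\<tau> k))"
      using S that unfolding is_simple_process_def prod.case by blast
    ultimately have "\<xi> k \<in> borel_measurable (F (\<kappa> k))"
      using tau[of k] that by (rule_tac measurable_F_mono[of "\<xi> k" "\<tau> k"]) simp_all
    moreover have "\<zeta> k = \<xi> k" using True by (simp add: \<zeta>_def)
    ultimately show ?thesis by simp
  qed (simp add: \<zeta>_def)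
  moreover have "\<forall>k<n. \<forall>\<omega>\<in>space M. \<bar>\<zeta> k \<omega>\<bar> \<le> \<bar>c\<bar>"
    using c by (fastforce simp: \<zeta>_def)
  moreover have "0 \<le> \<kappa> 0" using ab by (simp add: \<kappa>_def)
  ultimately show "predictable_block \<kappa> \<zeta> n"
    unfolding predictable_block_def using mono by blast
  have clamp: "B (min b t) \<omega> - B (min a t) \<omega> = B (max a (min b t)) \<omega> - B a \<omega>" for t
    using ab by (cases "t \<le> a"; cases "t \<le> b") (auto simp: min_def max_def)
  have "simple_integral (n, \<tau>, \<xi>) B b \<omega> - simple_integral (n, \<tau>, \<xi>) B a \<omega>
      = (\<Sum>k<n. \<xi> k \<omega> * ((B (min b (\<tau> (Suc k))) \<omega> - B (min a (\<tau> (Suc k))) \<omega>) - (B (min b (\<tau> k)) \<omega> - B (min a (\<tau> k)) \<omega>)))"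
    by (simp add: simple_integral_def sum_subtractf[symmetric] algebra_simps)
  also have "\<dots> = block_sum \<kappa> \<zeta> n \<omega>"
    unfolding clamp block_sum_def
  proof (rule sum.cong)
    fix k assume "k \<in> {..<n}"
    then have "\<kappa> k = \<kappa> (Suc k)" if "\<not> \<kappa> k < \<kappa> (Suc k)" using mono[of k] that by auto
    then show "\<xi> k \<omega> * (B (max a (min b (\<tau> (Suc k)))) \<omega> - B a \<omega> - (B (max a (min b (\<tau> k))) \<omega> - B a \<omega>)) =
         \<zeta> k \<omega> * (B (\<kappa> (Suc k)) \<omega> - B (\<kappa> k) \<omega>)"
      unfolding \<zeta>_def by (cases "\<kappa> k < \<kappa> (Suc k)") (auto simp: \<kappa>_def)
  qed simp
  finally show "simple_integral (n, \<tau>, \<xi>) B b \<omega> - simple_integral (n, \<tau>, \<xi>) B a \<omega> = block_sum \<kappa> \<zeta> n \<omega>" .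
  have step: "(simple_value (n, \<tau>, \<xi>) s \<omega>)\<^sup>2 = (\<Sum>k<n. (\<zeta> k \<omega>)\<^sup>2 * indicator {\<kappa> k<..\<kappa> (Suc k)} s)"
    if "a < s" "s \<le> b" for s
  proof -
    have ind: "indicator {\<tau> k<..\<tau> (Suc k)} s = (indicator {\<kappa> k<..\<kappa> (Suc k)} s :: real)" for k
      using simple_value_clamp[OF that, of \<tau> k] by (simp add: \<kappa>_def)
    have "simple_value (n, \<tau>, \<xi>) s \<omega> = (\<Sum>k<n. \<zeta> k \<omega> * indicator {\<kappa> k<..\<kappa> (Suc k)} s)"
      unfolding simple_value_def prod.case
      by (rule sum.cong) (auto simp: \<zeta>_def ind)
    then show ?thesis using square_sum_disjoint_steps[of n \<kappa> "\<lambda>k. \<zeta> k \<omega>" s] mono by simp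
  qed
  have sub: "{\<kappa> k<..\<kappa> (Suc k)} \<subseteq> {a<..b}" for k using ab by (auto simp: \<kappa>_def)
  have "(\<integral>\<^sup>+ s\<in>{a..b}. ennreal ((simple_value (n, \<tau>, \<xi>) s \<omega>)\<^sup>2) \<partial>lborel)
     = (\<integral>\<^sup>+ s. (\<Sum>k<n. ennreal ((\<zeta> k \<omega>)\<^sup>2) * indicator {\<kappa> k<..\<kappa> (Suc k)} s) \<partial>lborel)"
  proof (rule nn_integral_cong_AE)
    show "AE s in lborel. ennreal ((simple_value (n, \<tau>, \<xi>) s \<omega>)\<^sup>2) * indicator {a..b} s
       = (\<Sum>k<n. ennreal ((\<zeta> k \<omega>)\<^sup>2) * indicator {\<kappa> k<..\<kappa> (Suc k)} s)"
      \<comment> \<open>The half-open clamped steps miss the endpoint \<open>a\<close> of the closed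
        interval, hence an identity almost everywhere only.\<close>
      using AE_lborel_singleton[of a]
    proof eventually_elim
      case (elim s)
      show ?case
      proof (cases "a < s \<and> s \<le> b")
        case True
        have "ennreal ((simple_value (n, \<tau>, \<xi>) s \<omega>)\<^sup>2) = (\<Sum>k<n. ennreal ((\<zeta> k \<omega>)\<^sup>2 * indicator {\<kappa> k<..\<kappa> (Suc k)} s))"
          using step[of s] True by (simp add: sum_ennreal)
        then show ?thesis using True by (simp add: ennreal_mult ennreal_indicator)
      next
        case False
        then have "s \<notin> {a..b}" using elim by auto
        moreover have "s \<notin> {\<kappa> k<..\<kappa> (Suc k)}" for k using subsetD[OF sub[of k], of s] False by auto
        ultimately show ?thesis by simp
      qed
    qed
  qed
  also have "\<dots> = (\<Sum>k<n. ennreal ((\<zeta> k \<omega>)\<^sup>2) * ennreal (\<kappa> (Suc k) - \<kappa> k))"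
    using mono by (subst nn_integral_sum) (auto intro!: sum.cong simp: nn_integral_cmult_indicator)
  also have "\<dots> = ennreal (block_var \<kappa> \<zeta> n \<omega>)"
    unfolding block_var_def
    by (subst sum_ennreal[symmetric]) (auto intro!: sum.cong simp: ennreal_mult mono)
  finally show "(\<integral>\<^sup>+ s\<in>{a..b}. ennreal ((simple_value (n, \<tau>, \<xi>) s \<omega>)\<^sup>2) \<partial>lborel) = ennreal (block_var \<kappa> \<zeta> n \<omega>)" .
qed

text \<open>This is the interface between the Ito integral and blocks: off a small event an
  increment is replaced by a block whose variation is capped everywhere. The cap is harmless where
  the integral of \<open>H\<^sup>2\<close> is at most \<open>K / 4\<close>, because there the simple
  process has variation at most \<open>K / 2 + 2 * \<rho> \<le> K\<close> and nothing is
  stopped.\<close>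

lemma ito_block_approx:
  assumes I: "is_ito_integral M F B H I" and ab: "0 \<le> a" "a < b" and K: "0 < K" and eta: "0 < \<eta>"
  obtains A n \<kappa> \<zeta> where "A \<in> sets M" "measure M A < \<eta>" "predictable_block \<kappa> \<zeta> n" "a \<le> \<kappa> 0"
    "\<And>\<omega>. block_var \<kappa> \<zeta> n \<omega> \<le> K"
    "\<And>\<omega>. \<omega> \<in> space M - A \<Longrightarrow> (\<lambda>s. indicator {a..b} s * H s \<omega>) \<in> borel_measurable borel \<Longrightarrow>
       (\<integral>\<^sup>+ s\<in>{a..b}. ennreal ((H s \<omega>)\<^sup>2) \<partial>lborel) \<le> ennreal (K / 4) \<Longrightarrow>
       \<bar>block_sum \<kappa> \<zeta> n \<omega> - (I b \<omega> - I a \<omega>)\<bar> \<le> \<eta> \<and>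
       (\<integral>\<^sup>+ s\<in>{a..b}. ennreal ((H s \<omega>)\<^sup>2) \<partial>lborel) \<le> ennreal (2 * block_var \<kappa> \<zeta> n \<omega> + \<eta>)"
proof -
  obtain S where S: "\<And>n. is_simple_process M F (S n)"
    and L2: "\<And>t. 0 \<le> t \<Longrightarrow> tendsto_zero_in_prob M
            (\<lambda>n \<omega>. \<integral>\<^sup>+ s\<in>{0..t}. ennreal ((simple_value (S n) s \<omega> - H s \<omega>)\<^sup>2) \<partial>lborel)"
    and P: "\<And>t. 0 \<le> t \<Longrightarrow> tendsto_zero_in_prob M (\<lambda>n \<omega>. ennreal \<bar>simple_integral (S n) B t \<omega> - I t \<omega>\<bar>)"
    using I unfolding is_ito_integral_def by blast
  \<comment> \<open>The bound \<open>\<rho> \<le> K / 4\<close> keeps the variation below the cap,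
    and \<open>2 * \<rho> \<le> \<eta>\<close> yields the error in the final comparison of
    variations.\<close>
  define \<rho> where "\<rho> = min (K / 4) (\<eta> / 2)"
  have rho: "0 < \<rho>" using K eta by (simp add: \<rho>_def)
  have e3: "0 < \<eta> / 3" "0 < \<eta> / 2" using eta by auto
  have b0: "0 \<le> b" using ab by simp
  note ev = eventually_conj[OF tendsto_zero_in_probD[OF L2[OF b0] rho e3(1)]
      eventually_conj[OF tendsto_zero_in_probD[OF P[OF ab(1)] e3(2,1)] tendsto_zero_in_probD[OF P[OF b0] e3(2,1)]]]
  obtain m where m: "(\<exists>A\<in>sets M. measure M A < \<eta> / 3 \<and> (\<forall>\<omega>\<in>space M - A.
        (\<integral>\<^sup>+ s\<in>{0..b}. ennreal ((simple_value (S m) s \<omega> - H s \<omega>)\<^sup>2) \<partial>lborel) \<le> ennreal \<rho>)) \<and>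
      (\<exists>A\<in>sets M. measure M A < \<eta> / 3 \<and> (\<forall>\<omega>\<in>space M - A. ennreal \<bar>simple_integral (S m) B a \<omega> - I a \<omega>\<bar> \<le> ennreal (\<eta> / 2))) \<and>
      (\<exists>A\<in>sets M. measure M A < \<eta> / 3 \<and> (\<forall>\<omega>\<in>space M - A. ennreal \<bar>simple_integral (S m) B b \<omega> - I b \<omega>\<bar> \<le> ennreal (\<eta> / 2)))"
    by (rule exE[OF eventually_happens'[OF sequentially_bot ev]])
  obtain A1 where A1m: "A1 \<in> sets M" "measure M A1 < \<eta> / 3" and A1: "\<forall>\<omega>\<in>space M - A1.
        (\<integral>\<^sup>+ s\<in>{0..b}. ennreal ((simple_value (S m) s \<omega> - H s \<omega>)\<^sup>2) \<partial>lborel) \<le> ennreal \<rho>"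
    using m[THEN conjunct1] by (elim bexE conjE)
  obtain A2 where A2m: "A2 \<in> sets M" "measure M A2 < \<eta> / 3"
    and A2: "\<forall>\<omega>\<in>space M - A2. ennreal \<bar>simple_integral (S m) B a \<omega> - I a \<omega>\<bar> \<le> ennreal (\<eta> / 2)"
    using m[THEN conjunct2, THEN conjunct1] by (elim bexE conjE)
  obtain A3 where A3m: "A3 \<in> sets M" "measure M A3 < \<eta> / 3"
    and A3: "\<forall>\<omega>\<in>space M - A3. ennreal \<bar>simple_integral (S m) B b \<omega> - I b \<omega>\<bar> \<le> ennreal (\<eta> / 2)"
    using m[THEN conjunct2, THEN conjunct2] by (elim bexE conjE)
  note A = A1m A2m A3m
  obtain n \<tau> \<xi> where Sm: "S m = (n, \<tau>, \<xi>)" by (cases "S m") auto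
  define \<kappa> where "\<kappa> = (\<lambda>k. max a (min b (\<tau> k)))"
  define \<zeta> where "\<zeta> = (\<lambda>k \<omega>. if \<kappa> k < \<kappa> (Suc k) then \<xi> k \<omega> else 0)"
  have blk: "predictable_block \<kappa> \<zeta> n"
    "simple_integral (n, \<tau>, \<xi>) B b \<omega> - simple_integral (n, \<tau>, \<xi>) B a \<omega> = block_sum \<kappa> \<zeta> n \<omega>"
    "(\<integral>\<^sup>+ s\<in>{a..b}. ennreal ((simple_value (n, \<tau>, \<xi>) s \<omega>)\<^sup>2) \<partial>lborel) = ennreal (block_var \<kappa> \<zeta> n \<omega>)" for \<omega>
    unfolding \<zeta>_def \<kappa>_def by (rule simple_process_block[OF S[of m, unfolded Sm] ab])+
  define A where "A = A1 \<union> A2 \<union> A3"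
  have "measure M A \<le> measure M A1 + measure M A2 + measure M A3"
    unfolding A_def using A measure_Un_le[of "A1 \<union> A2" M A3] measure_Un_le[of A1 M A2] by auto
  then have mA: "measure M A < \<eta>" using A by linarith
  show ?thesis
  proof (rule that[of A \<kappa> "stopped K \<kappa> \<zeta>" n])
    show "A \<in> sets M" using A by (simp add: A_def)
    show "measure M A < \<eta>" by (rule mA)
    show "predictable_block \<kappa> (stopped K \<kappa> \<zeta>) n" by (rule predictable_block_stopped[OF blk(1)])
    show "a \<le> \<kappa> 0" by (simp add: \<kappa>_def)
    show "block_var \<kappa> (stopped K \<kappa> \<zeta>) n \<omega> \<le> K" for \<omega>
      by (rule block_var_stopped_le[OF blk(1)]) (use K in simp)
    fix \<omega> assume w: "\<omega> \<in> space M - A" and Hm: "(\<lambda>s. indicator {a..b} s * H s \<omega>) \<in> borel_measurable borel"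
      and H2: "(\<integral>\<^sup>+ s\<in>{a..b}. ennreal ((H s \<omega>)\<^sup>2) \<partial>lborel) \<le> ennreal (K / 4)"
    define g where "g = (\<lambda>s. simple_value (n, \<tau>, \<xi>) s \<omega>)"
    have gm: "(\<lambda>s. indicator {a..b} s * g s) \<in> borel_measurable borel"
      unfolding g_def simple_value_def prod.case by measurable
    have d: "(\<integral>\<^sup>+ s\<in>{a..b}. ennreal ((g s - H s \<omega>)\<^sup>2) \<partial>lborel) \<le> ennreal \<rho>"
    proof -
      have "(\<integral>\<^sup>+ s\<in>{a..b}. ennreal ((g s - H s \<omega>)\<^sup>2) \<partial>lborel) \<le> (\<integral>\<^sup>+ s\<in>{0..b}. ennreal ((g s - H s \<omega>)\<^sup>2) \<partial>lborel)"
        using ab by (intro nn_integral_mono) (auto simp: indicator_def)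
      also have "\<dots> \<le> ennreal \<rho>" using bspec[OF A1, of \<omega>] w by (simp add: A_def g_def Sm)
      finally show ?thesis .
    qed
    have d': "(\<integral>\<^sup>+ s\<in>{a..b}. ennreal ((H s \<omega> - g s)\<^sup>2) \<partial>lborel) \<le> ennreal \<rho>"
      using d by (simp add: power2_commute)
    have v0: "0 \<le> block_var \<kappa> \<zeta> n \<omega>"
      using block_var_mono[OF blk(1), of 0 \<omega>] by (simp add: block_var_def)
    have gv: "(\<integral>\<^sup>+ s\<in>{a..b}. ennreal ((g s)\<^sup>2) \<partial>lborel) = ennreal (block_var \<kappa> \<zeta> n \<omega>)"
      using blk(3)[of \<omega>] by (simp add: g_def)
    have "ennreal (block_var \<kappa> \<zeta> n \<omega>) \<le> 2 * ennreal (K / 4) + 2 * ennreal \<rho>"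
      using nn_integral_square_triangle[OF Hm gm] mult_left_mono[OF H2, of 2] mult_left_mono[OF d', of 2]
      unfolding gv by (meson add_mono order_trans zero_le)
    also have "\<dots> = ennreal (K / 2 + 2 * \<rho>)" 
      using K rho by (simp add: ennreal_mult[symmetric] ennreal_plus[symmetric] flip: ennreal_numeral del: ennreal_plus)
    finally have "block_var \<kappa> \<zeta> n \<omega> \<le> K / 2 + 2 * \<rho>" using K rho by (subst (asm) ennreal_le_iff) auto
    then have vK: "block_var \<kappa> \<zeta> n \<omega> \<le> K" unfolding \<rho>_def by linarith
    note eq = stopped_eq[OF blk(1) vK]
    have "(\<integral>\<^sup>+ s\<in>{a..b}. ennreal ((H s \<omega>)\<^sup>2) \<partial>lborel) \<le> 2 * ennreal (block_var \<kappa> \<zeta> n \<omega>) + 2 * ennreal \<rho>"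
      using nn_integral_square_triangle[OF gm Hm] mult_left_mono[OF d, of 2]
      unfolding gv by (meson add_left_mono order_trans zero_le)
    also have "\<dots> = ennreal (2 * block_var \<kappa> \<zeta> n \<omega> + 2 * \<rho>)"
      using v0 rho by (simp add: ennreal_mult)
    also have "\<dots> \<le> ennreal (2 * block_var \<kappa> \<zeta> n \<omega> + \<eta>)"
      by (intro ennreal_leI) (simp add: \<rho>_def)
    finally have 1: "(\<integral>\<^sup>+ s\<in>{a..b}. ennreal ((H s \<omega>)\<^sup>2) \<partial>lborel) \<le> ennreal (2 * block_var \<kappa> (stopped K \<kappa> \<zeta>) n \<omega> + \<eta>)"
      by (simp add: eq)
    have "\<bar>simple_integral (S m) B a \<omega> - I a \<omega>\<bar> \<le> \<eta> / 2" "\<bar>simple_integral (S m) B b \<omega> - I b \<omega>\<bar> \<le> \<eta> / 2"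
      using bspec[OF A2, of \<omega>] bspec[OF A3, of \<omega>] w eta by (simp_all add: A_def)
    then have "\<bar>block_sum \<kappa> (stopped K \<kappa> \<zeta>) n \<omega> - (I b \<omega> - I a \<omega>)\<bar> \<le> \<eta>"
      using blk(2)[of \<omega>] unfolding eq Sm by linarith
    with 1 show "\<bar>block_sum \<kappa> (stopped K \<kappa> \<zeta>) n \<omega> - (I b \<omega> - I a \<omega>)\<bar> \<le> \<eta> \<and>
       (\<integral>\<^sup>+ s\<in>{a..b}. ennreal ((H s \<omega>)\<^sup>2) \<partial>lborel) \<le> ennreal (2 * block_var \<kappa> (stopped K \<kappa> \<zeta>) n \<omega> + \<eta>)"
      by blast
  qed
qed

end

section \<open>Taylor expansion over one time step\<close>

text \<open>Value and slope vanish at 0, and the curvature has total mass 1 on the half-line,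
  concentrated at scale \<open>1 / l\<close>.\<close>

definition test_fun :: "real \<Rightarrow> real \<Rightarrow> real" where
  "test_fun l x = x + (exp (- l * x) - 1) / l"

text \<open>The fourth-order remainder is nonnegative for either sign of \<open>u\<close>, so
  cutting the series after the cubic term leaves a lower bound.\<close>

lemma exp_minus_ge_cubic:
  fixes u :: real
  shows "1 - u + u\<^sup>2 / 2 - \<bar>u\<bar> ^ 3 / 6 \<le> exp (- u)"
proof -
  obtain t where "exp (- u) = (\<Sum>m<4. (- u) ^ m / fact m) + exp t / fact 4 * (- u) ^ 4"
    using Maclaurin_exp_le[of "- u" 4] by blast
  moreover have "(\<Sum>m<4. (- u) ^ m / fact m) = 1 - u + u\<^sup>2 / 2 - u ^ 3 / 6"
    by (simp add: eval_nat_numeral)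
  moreover have "0 \<le> exp t / fact 4 * (- u) ^ 4" by simp
  moreover have "u ^ 3 \<le> \<bar>u\<bar> ^ 3" by (metis abs_ge_self power_abs)
  ultimately show ?thesis by linarith
qed

text \<open>Writing \<open>exp (- l * y)\<close> as \<open>exp (- l * x) * exp (- u)\<close> with
  \<open>u = l * (y - x)\<close> reduces the expansion to the cubic bound for
  \<open>exp (- u)\<close>. A lower bound suffices, because the quadratic term is to be estimated
  from above by the growth of the test function.\<close>

lemma test_fun_taylor:
  assumes l: "1 \<le> l" and x: "0 \<le> x"
  shows "(1 - exp (- l * x)) * (y - x) + l * exp (- l * x) * (y - x)\<^sup>2 / 2 - l\<^sup>2 * \<bar>y - x\<bar> ^ 3
    \<le> test_fun l y - test_fun l x"
proof -
  define e where "e = exp (- l * x)"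
  define u where "u = l * (y - x)"
  have e: "0 < e" "e \<le> 1" using l x by (auto simp: e_def)
  have "e / l * (1 - u + u\<^sup>2 / 2 - \<bar>u\<bar> ^ 3 / 6) \<le> e / l * exp (- u)"
    by (rule mult_left_mono[OF exp_minus_ge_cubic]) (use e l in auto)
  also have "e / l * exp (- u) = exp (- l * y) / l"
    by (simp add: e_def u_def mult_exp_exp algebra_simps)
  finally have 1: "e / l * (1 - u + u\<^sup>2 / 2 - \<bar>u\<bar> ^ 3 / 6) \<le> exp (- l * y) / l" .
  have 2: "e / l * (1 - u + u\<^sup>2 / 2 - \<bar>u\<bar> ^ 3 / 6) = e / l - e * (y - x) + l * e * (y - x)\<^sup>2 / 2 - e * l\<^sup>2 * \<bar>y - x\<bar> ^ 3 / 6"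
  proof -
    have "\<bar>u\<bar> ^ 3 = l ^ 3 * \<bar>y - x\<bar> ^ 3" using l by (simp add: u_def abs_mult power_mult_distrib)
    then have "e / l * (1 - u + u\<^sup>2 / 2 - \<bar>u\<bar> ^ 3 / 6)
       = e / l * (1 - l * (y - x) + (l * (y - x))\<^sup>2 / 2 - l ^ 3 * \<bar>y - x\<bar> ^ 3 / 6)" by (simp add: u_def)
    then show ?thesis using l by (simp add: field_simps power2_eq_square power3_eq_cube)
  qed
  have "e * (l\<^sup>2 * \<bar>y - x\<bar> ^ 3) \<le> 1 * (l\<^sup>2 * \<bar>y - x\<bar> ^ 3)" using e by (intro mult_right_mono) auto
  moreover have "0 \<le> l\<^sup>2 * \<bar>y - x\<bar> ^ 3" by simp
  moreover have "e * l\<^sup>2 * \<bar>y - x\<bar> ^ 3 = e * (l\<^sup>2 * \<bar>y - x\<bar> ^ 3)" by simp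
  ultimately have 3: "e * l\<^sup>2 * \<bar>y - x\<bar> ^ 3 / 6 \<le> l\<^sup>2 * \<bar>y - x\<bar> ^ 3" by linarith
  have "test_fun l y - test_fun l x = (y - x) + exp (- l * y) / l - e / l"
    using l by (simp add: test_fun_def e_def field_simps)
  then show ?thesis using 1 2 3 unfolding e_def[symmetric] by (simp add: algebra_simps)
qed

lemma test_fun_nonneg: "1 \<le> l \<Longrightarrow> 0 \<le> test_fun l x"
proof -
  assume l: "1 \<le> l"
  have "1 + (- l * x) \<le> exp (- l * x)" by (rule exp_ge_add_one_self)
  then have "(- l * x) / l \<le> (exp (- l * x) - 1) / l" using l by (intro divide_right_mono) auto
  then show ?thesis using l by (simp add: test_fun_def)
qed

lemma test_fun_le: "1 \<le> l \<Longrightarrow> 0 \<le> x \<Longrightarrow> test_fun l x \<le> x"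
  by (simp add: test_fun_def divide_nonpos_pos)

section \<open>Pathwise error bounds for one time step\<close>

text \<open>Either \<open>\<bar>x\<bar> \<le> d\<close> or the cubic term dominates. This trades
  first and second powers of the noise for the third power, whose expectation is small.\<close>

lemma young_cubic:
  fixes x d :: real
  assumes "0 < d"
  shows "\<bar>x\<bar> \<le> d + \<bar>x\<bar> ^ 3 / d\<^sup>2" "x\<^sup>2 \<le> d\<^sup>2 + \<bar>x\<bar> ^ 3 / d"
proof -
  define t where "t = \<bar>x\<bar>"
  have t: "0 \<le> t" by (simp add: t_def)
  have "t \<le> d + t ^ 3 / d\<^sup>2 \<and> t\<^sup>2 \<le> d\<^sup>2 + t ^ 3 / d"
  proof (cases "t \<le> d")
    case True
    then show ?thesis using t assms power_mono[OF True t, of 2] by (simp add: add_increasing2)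
  next
    case False
    then have dt: "d \<le> t" by simp
    have "t * d\<^sup>2 \<le> t * t\<^sup>2" by (intro mult_left_mono power_mono) (use dt t assms in auto)
    then have "t \<le> t ^ 3 / d\<^sup>2" using assms by (simp add: field_simps power3_eq_cube power2_eq_square)
    moreover have "t\<^sup>2 * d \<le> t\<^sup>2 * t" by (intro mult_left_mono) (use dt in auto)
    then have "t\<^sup>2 \<le> t ^ 3 / d" using assms by (simp add: field_simps power3_eq_cube power2_eq_square)
    ultimately show ?thesis using assms by (simp add: add_increasing)
  qed
  then show "\<bar>x\<bar> \<le> d + \<bar>x\<bar> ^ 3 / d\<^sup>2" "x\<^sup>2 \<le> d\<^sup>2 + \<bar>x\<bar> ^ 3 / d" by (simp_all add: t_def)
qed

lemma abs_add_cube_le: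
  fixes x y :: real
  shows "\<bar>x + y\<bar> ^ 3 \<le> 4 * (\<bar>x\<bar> ^ 3 + \<bar>y\<bar> ^ 3)"
proof -
  define p q where "p = \<bar>x\<bar>" and "q = \<bar>y\<bar>"
  have pq: "0 \<le> p" "0 \<le> q" by (auto simp: p_def q_def)
  have "\<bar>x + y\<bar> ^ 3 \<le> (p + q) ^ 3" by (intro power_mono) (auto simp: p_def q_def)
  also have "\<dots> \<le> 4 * (p ^ 3 + q ^ 3)"
  proof -
    have "4 * (p ^ 3 + q ^ 3) - (p + q) ^ 3 = 3 * ((p + q) * (p - q)\<^sup>2)"
      by (simp add: power3_eq_cube power2_eq_square algebra_simps)
    moreover have "0 \<le> 3 * ((p + q) * (p - q)\<^sup>2)" using pq by simp
    ultimately show ?thesis by linarith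
  qed
  finally show ?thesis by (simp add: p_def q_def)
qed

text \<open>The time step has length \<open>s\<^sup>2\<close>; \<open>J\<close> is the true
  stochastic increment, \<open>N\<close> and \<open>V\<close> are the sum and variation of its
  block, and \<open>v\<close> is the true integral of the squared integrand. The left side is
  arranged so that its first two terms have mean 0 under weights of the past. The factor 1/4 before
  \<open>v\<close>, in place of the 1/2 of Taylor's formula, comes from
  \<open>v \<le> 2 * V + s ^ 3\<close>.\<close>

lemma step_lower_bound:
  fixes c l s x y N V J v :: real
  assumes c: "1 \<le> c" and l: "1 \<le> l" and s: "0 < s" "s \<le> 1" and x: "0 \<le> x"
    and A: "\<bar>y - x - J\<bar> \<le> c * s\<^sup>2" and JN: "\<bar>N - J\<bar> \<le> s ^ 3" and v: "v \<le> 2 * V + s ^ 3"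
  shows "(1 - exp (- l * x)) * N + l * exp (- l * x) / 2 * (N\<^sup>2 - V) - l\<^sup>2 * c ^ 3 * (45 * s ^ 3 + 6 * \<bar>N\<bar> ^ 3)
    \<le> test_fun l y - test_fun l x - ((1 - exp (- l * x)) * (y - x - J) + l * exp (- l * x) / 4 * v)"
proof -
  define p where "p = 1 - exp (- l * x)"
  define q where "q = l * exp (- l * x)"
  define e where "e = y - x - N"
  define n3 where "n3 = \<bar>N\<bar> ^ 3"
  have p: "0 \<le> p" "p \<le> 1" and q: "0 \<le> q" "q \<le> l" using l x by (auto simp: p_def q_def)
  have s32: "s ^ 3 \<le> s\<^sup>2" using s by (intro power_decreasing) auto
  have s0: "0 \<le> s\<^sup>2" "0 \<le> s ^ 3" using s by auto
  have n30: "0 \<le> n3" by (simp add: n3_def)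
  have cs: "s\<^sup>2 \<le> c * s\<^sup>2" using mult_right_mono[OF c s0(1)] by simp
  have e: "\<bar>e\<bar> \<le> 2 * c * s\<^sup>2" using A JN s32 cs unfolding e_def by linarith
  have ll: "l \<le> l\<^sup>2" using l by (simp add: power2_eq_square)
  have l2: "1 \<le> l\<^sup>2" using l by simp
  have cc: "1 \<le> c ^ 3" "c \<le> c ^ 3" using c one_le_power[OF c, of 3] power_increasing[of 1 3 c] by auto
  \<comment> \<open>One factor absorbs every combination of \<open>l\<close> and \<open>c\<close>
    that occurs in the errors below.\<close>
  define K where "K = l\<^sup>2 * c ^ 3"
  have K1: "1 \<le> K" unfolding K_def using mult_mono[OF l2 cc(1)] l2 by simp
  have Kl: "l \<le> K" unfolding K_def using mult_mono[OF ll cc(1)] l by simp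
  have Klc: "l * c \<le> K" unfolding K_def using mult_mono[OF ll cc(2)] l c by simp
  have Kl2: "l\<^sup>2 \<le> K" unfolding K_def using mult_left_mono[OF cc(1), of "l\<^sup>2"] by simp
  \<comment> \<open>With \<open>d = s\<close> in \<open>young_cubic\<close>, the factor
    \<open>s\<^sup>2\<close> in the bound for \<open>e\<close> cancels the denominator.\<close>
  have Ne: "\<bar>N\<bar> * \<bar>e\<bar> \<le> 2 * c * (s ^ 3 + n3)"
  proof -
    have "\<bar>N\<bar> * \<bar>e\<bar> \<le> (s + n3 / s\<^sup>2) * (2 * c * s\<^sup>2)"
      unfolding n3_def by (intro mult_mono young_cubic e) (use s in auto)
    also have "\<dots> = 2 * c * (s ^ 3 + n3)" using s by (simp add: field_simps power2_eq_square power3_eq_cube)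
    finally show ?thesis .
  qed
  have e3: "\<bar>e\<bar> ^ 3 \<le> 8 * c ^ 3 * s ^ 3"
  proof -
    have "\<bar>e\<bar> ^ 3 \<le> (2 * c * s\<^sup>2) ^ 3" by (intro power_mono e) simp
    also have "\<dots> = 8 * c ^ 3 * s ^ 6" by (simp add: power_mult_distrib power_mult[symmetric])
    also have "\<dots> \<le> 8 * c ^ 3 * s ^ 3" using s c by (intro mult_left_mono power_decreasing) auto
    finally show ?thesis .
  qed
  have sq: "N\<^sup>2 - 2 * (2 * c * (s ^ 3 + n3)) \<le> (y - x)\<^sup>2"
  proof -
    have "(y - x)\<^sup>2 = N\<^sup>2 + 2 * (N * e) + e\<^sup>2" by (simp add: e_def power2_eq_square algebra_simps)
    moreover have "- (\<bar>N\<bar> * \<bar>e\<bar>) \<le> N * e" by (metis abs_mult abs_ge_minus_self minus_le_iff)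
    ultimately show ?thesis using Ne zero_le_power2[of e] by linarith
  qed
  have "q * (N\<^sup>2 - 2 * (2 * c * (s ^ 3 + n3))) \<le> q * (y - x)\<^sup>2" by (rule mult_left_mono[OF sq q(1)])
  then have t2: "q * N\<^sup>2 / 2 - q * (2 * c * (s ^ 3 + n3)) \<le> q * (y - x)\<^sup>2 / 2" by (simp add: algebra_simps)
  have "q * (2 * c * (s ^ 3 + n3)) \<le> l * (2 * c * (s ^ 3 + n3))"
    using q c s0 n30 by (intro mult_right_mono) auto
  also have "\<dots> = l * c * (2 * (s ^ 3 + n3))" by simp
  also have "\<dots> \<le> K * (2 * (s ^ 3 + n3))" using Klc s0 n30 by (intro mult_right_mono) auto
  finally have t2': "q * (2 * c * (s ^ 3 + n3)) \<le> K * (2 * (s ^ 3 + n3))" .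
  have "\<bar>y - x\<bar> ^ 3 \<le> 4 * (n3 + \<bar>e\<bar> ^ 3)" using abs_add_cube_le[of N e] by (simp add: e_def n3_def)
  also have "\<dots> \<le> 4 * (n3 + 8 * c ^ 3 * s ^ 3)" using e3 by simp
  finally have "l\<^sup>2 * \<bar>y - x\<bar> ^ 3 \<le> l\<^sup>2 * (4 * (n3 + 8 * c ^ 3 * s ^ 3))" by (intro mult_left_mono) auto
  also have "\<dots> = l\<^sup>2 * (4 * n3) + K * (32 * s ^ 3)" by (simp add: K_def algebra_simps)
  also have "\<dots> \<le> K * (4 * n3) + K * (32 * s ^ 3)" using Kl2 n30 by (intro add_right_mono mult_right_mono) auto
  finally have t3: "l\<^sup>2 * \<bar>y - x\<bar> ^ 3 \<le> K * (4 * n3) + K * (32 * s ^ 3)" .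
  have "p * (N - J) \<le> p * \<bar>N - J\<bar>" using p by (intro mult_left_mono) auto
  also have "\<dots> \<le> 1 * s ^ 3" using JN p by (intro mult_mono) auto
  also have "\<dots> \<le> K * s ^ 3" using K1 s0 by (intro mult_right_mono) auto
  finally have t1: "p * N - K * s ^ 3 \<le> p * J" by (simp add: algebra_simps)
  have "q * v \<le> q * (2 * V + s ^ 3)" by (rule mult_left_mono[OF v q(1)])
  moreover have "q * s ^ 3 \<le> K * s ^ 3" using q Kl s0 by (intro mult_right_mono) auto
  ultimately have t4: "q * v \<le> 2 * (q * V) + K * s ^ 3" by (simp add: algebra_simps)
  have T: "p * (y - x) + q * (y - x)\<^sup>2 / 2 - l\<^sup>2 * \<bar>y - x\<bar> ^ 3 \<le> test_fun l y - test_fun l x"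
    using test_fun_taylor[OF l x, of y] by (simp add: p_def q_def)
  \<comment> \<open>In units of \<open>K\<close> the errors are 2 + 32 + 1 + 1/4 for
    \<open>s ^ 3\<close>, rounded up to 45, and 2 + 4 for the cube of \<open>N\<close>.\<close>
  have "p * N + q / 2 * (N\<^sup>2 - V) - K * (45 * s ^ 3 + 6 * n3)
      \<le> test_fun l y - test_fun l x - (p * (y - x - J) + q / 4 * v)"
  proof -
    have "q / 2 * (N\<^sup>2 - V) = q * N\<^sup>2 / 2 - q * V / 2" "K * (45 * s ^ 3 + 6 * n3) = 45 * (K * s ^ 3) + 6 * (K * n3)"
      "p * (y - x - J) = p * (y - x) - p * J" "K * (4 * n3) = 4 * (K * n3)" "K * (32 * s ^ 3) = 32 * (K * s ^ 3)"
      "K * (2 * (s ^ 3 + n3)) = 2 * (K * s ^ 3) + 2 * (K * n3)" "q / 4 * v = q * v / 4"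
      by (simp_all add: algebra_simps diff_divide_distrib)
    moreover have "0 \<le> K * s ^ 3" using K1 s0 by simp
    ultimately show ?thesis using T t1 t2 t2' t3 t4 by linarith
  qed
  then show ?thesis by (simp add: p_def q_def K_def n3_def)
qed

section \<open>The one-step inequality in expectation\<close>

context filtered_brownian
begin

text \<open>The martingale part \<open>W\<close> has mean 0 because its weights live on
  \<open>D\<close>, which is known at time \<open>a\<close>. The bounds at the end of the step hold
  on \<open>G\<close>, which need not be known then, so the pathwise inequality is proved with an
  error \<open>E\<close> in four cases. On \<open>G\<close> off \<open>A\<close> it is
  \<open>step_lower_bound\<close>. On \<open>G\<close> within \<open>A\<close> all other terms are
  bounded, and \<open>A\<close> has probability below \<open>s ^ 3\<close>. On \<open>D - G\<close>
  only \<open>W\<close> is left, bounded by multiples of \<open>\<delta>\<close> and of the cube of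
  \<open>N\<close> over \<open>\<delta>\<^sup>2\<close>. Outside \<open>D\<close> nothing is
  left.\<close>

lemma block_inequality:
  fixes c l s \<delta> :: real
  assumes I: "is_ito_integral M F B H I" and ab: "0 \<le> a" "b = a + s\<^sup>2"
    and c: "1 \<le> c" and l: "1 \<le> l" and s: "0 < s" "s \<le> 1" and d: "0 < \<delta>" "\<delta> \<le> 1" "s\<^sup>2 \<le> \<delta>"
    and D: "D \<in> sets (F a)" and G: "G \<in> sets M" "G \<subseteq> D"
    and x: "x \<in> borel_measurable (F a)" and y: "y \<in> borel_measurable M" and v: "v \<in> borel_measurable M"
    and Dx: "\<And>\<omega>. \<omega> \<in> D \<Longrightarrow> 0 \<le> x \<omega> \<and> x \<omega> \<le> c"
    and ae: "AE \<omega> in M. \<omega> \<in> G \<longrightarrow> 0 \<le> y \<omega> \<and> y \<omega> \<le> c \<and>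
        \<bar>y \<omega> - x \<omega> - (I b \<omega> - I a \<omega>)\<bar> \<le> c * s\<^sup>2 \<and>
        (\<lambda>s. indicator {a..b} s * H s \<omega>) \<in> borel_measurable borel \<and>
        (\<integral>\<^sup>+ s\<in>{a..b}. ennreal ((H s \<omega>)\<^sup>2) \<partial>lborel) = ennreal (v \<omega>) \<and> 0 \<le> v \<omega> \<and> v \<omega> \<le> c * s\<^sup>2"
  shows "expectation (\<lambda>\<omega>. indicator G \<omega> * ((1 - exp (- l * x \<omega>)) * (y \<omega> - x \<omega> - (I b \<omega> - I a \<omega>))
        + l * exp (- l * x \<omega>) / 4 * v \<omega>)) - 11000 * l\<^sup>2 * c ^ 6 * (s ^ 3 / \<delta>\<^sup>2 + \<delta> * measure M (D - G))
    \<le> expectation (\<lambda>\<omega>. indicator G \<omega> * (test_fun l (y \<omega>) - test_fun l (x \<omega>)))"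
    (is "expectation ?f2 - _ \<le> expectation ?f1")
proof -
  \<comment> \<open>The cap must be at least four times the integral \<open>v\<close>, and
    \<open>v \<le> c * s\<^sup>2 \<le> c\<^sup>2 * s\<^sup>2\<close>. Being a perfect square, it
    equals \<open>r\<^sup>2\<close> for \<open>r = 2 * c * s\<close>.\<close>
  have sp: "0 < 4 * c\<^sup>2 * s\<^sup>2" "0 < s ^ 3" and alb: "a < b" using c s ab by auto
  obtain A \<kappa> \<zeta> n where A: "A \<in> sets M" "measure M A < s ^ 3" and pb: "predictable_block \<kappa> \<zeta> n" and k0: "a \<le> \<kappa> 0"
    and VK: "\<And>\<omega>. block_var \<kappa> \<zeta> n \<omega> \<le> 4 * c\<^sup>2 * s\<^sup>2"
    and app: "\<And>\<omega>. \<omega> \<in> space M - A \<Longrightarrow> (\<lambda>s. indicator {a..b} s * H s \<omega>) \<in> borel_measurable borel \<Longrightarrow>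
       (\<integral>\<^sup>+ s\<in>{a..b}. ennreal ((H s \<omega>)\<^sup>2) \<partial>lborel) \<le> ennreal (4 * c\<^sup>2 * s\<^sup>2 / 4) \<Longrightarrow>
       \<bar>block_sum \<kappa> \<zeta> n \<omega> - (I b \<omega> - I a \<omega>)\<bar> \<le> s ^ 3 \<and>
       (\<integral>\<^sup>+ s\<in>{a..b}. ennreal ((H s \<omega>)\<^sup>2) \<partial>lborel) \<le> ennreal (2 * block_var \<kappa> \<zeta> n \<omega> + s ^ 3)"
    apply (rule ito_block_approx[OF I ab(1) alb sp])
    subgoal premises p for A n \<kappa> \<zeta>
      by (rule p(1)[OF p(2-)])
    done
  define N where "N = block_sum \<kappa> \<zeta> n"
  define V where "V = block_var \<kappa> \<zeta> n"
  have V0: "0 \<le> V \<omega>" for \<omega> using block_var_mono[OF pb, of 0 \<omega>] by (simp add: V_def block_var_def)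
  define r where "r = 2 * c * s"
  have r: "0 < r" "r\<^sup>2 = 4 * c\<^sup>2 * s\<^sup>2" using c s by (auto simp: r_def power_mult_distrib)
  have i3: "integrable M (\<lambda>\<omega>. \<bar>N \<omega>\<bar> ^ 3)" and e3: "expectation (\<lambda>\<omega>. \<bar>N \<omega>\<bar> ^ 3) \<le> 108 * r ^ 3"
    using block_third_moment[OF pb r(1)] VK by (auto simp: N_def r(2))
  have kn: "0 \<le> \<kappa> n" by (rule predictable_block_nonneg[OF pb]) simp
  have NM [measurable]: "N \<in> borel_measurable M" and VM [measurable]: "V \<in> borel_measurable M"
    using block_measurable[OF pb] measurable_F_M[OF _ kn] by (auto simp: N_def V_def)
  have xM [measurable]: "x \<in> borel_measurable M" using measurable_F_M[OF x ab(1)] .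
  have DM [measurable]: "D \<in> sets M" using D subalg[OF ab(1)] by (auto simp: subalgebra_def)
  note [measurable] = G(1) y v A(1)
  have IM [measurable]: "I a \<in> borel_measurable M" "I b \<in> borel_measurable M"
    using I ab alb by (auto simp: is_ito_integral_def)
  have tf [measurable]: "test_fun l \<in> borel_measurable borel" unfolding test_fun_def[abs_def] by measurable
  define Y1 where "Y1 = (\<lambda>\<omega>. indicator D \<omega> * (1 - exp (- l * x \<omega>)))"
  define Y2 where "Y2 = (\<lambda>\<omega>. indicator D \<omega> * (l * exp (- l * x \<omega>) / 2))"
  have Y1b: "\<bar>Y1 \<omega>\<bar> \<le> 1" for \<omega> using Dx[of \<omega>] l by (auto simp: Y1_def indicator_def)
  have ex: "l * exp (- l * x \<omega>) \<le> l" if "\<omega> \<in> D" for \<omega>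
    using Dx[OF that] l by (simp add: mult_left_le)
  have exq: "l * exp (- l * x \<omega>) / 4 \<le> l" "\<bar>l * exp (- l * x \<omega>) / 4\<bar> \<le> l" if "\<omega> \<in> D" for \<omega>
  proof -
    show 1: "l * exp (- l * x \<omega>) / 4 \<le> l" using ex[OF that] l by linarith
    then show "\<bar>l * exp (- l * x \<omega>) / 4\<bar> \<le> l" using l by (subst abs_of_nonneg) auto
  qed
  have Y2h: "\<bar>Y2 \<omega>\<bar> \<le> l / 2" for \<omega>
    using ex[of \<omega>] l by (cases "\<omega> \<in> D") (simp_all add: Y2_def abs_mult)
  have Y2b: "\<bar>Y2 \<omega>\<bar> \<le> l" for \<omega> using Y2h[of \<omega>] l by linarith
  have YF: "Y1 \<in> borel_measurable (F a)" "Y2 \<in> borel_measurable (F a)"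
    unfolding Y1_def Y2_def using x D by measurable
  have YF0: "Y1 \<in> borel_measurable (F (\<kappa> 0))" "Y2 \<in> borel_measurable (F (\<kappa> 0))"
    using measurable_F_mono[OF YF(1) ab(1) k0] measurable_F_mono[OF YF(2) ab(1) k0] by auto
  note m1 = block_moments[OF pb YF0(1) Y1b, folded N_def V_def]
  note m2 = block_moments[OF pb YF0(2) Y2b, folded N_def V_def]
  have YM [measurable]: "Y1 \<in> borel_measurable M" "Y2 \<in> borel_measurable M"
    using measurable_F_M[OF YF(1) ab(1)] measurable_F_M[OF YF(2) ab(1)] by auto
  define W where "W = (\<lambda>\<omega>. Y1 \<omega> * N \<omega> + (Y2 \<omega> * (N \<omega>)\<^sup>2 - Y2 \<omega> * V \<omega>))"
  have iW: "integrable M (\<lambda>\<omega>. Y1 \<omega> * N \<omega>)" "integrable M (\<lambda>\<omega>. Y2 \<omega> * (N \<omega>)\<^sup>2)" "integrable M (\<lambda>\<omega>. Y2 \<omega> * V \<omega>)"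
    using m1 integrable_bounded_mult[OF _ YM(1) Y1b, of N] integrable_bounded_mult[OF _ YM(2) Y2b, of "\<lambda>\<omega>. (N \<omega>)\<^sup>2"]
      integrable_bounded_mult[OF _ YM(2) Y2b, of V] by auto
  have WI: "integrable M W" unfolding W_def using iW by simp
  have EW: "expectation W = 0"
    unfolding W_def using iW m1 m2 by simp
  \<comment> \<open>The 9 consists of 6 from the bound of \<open>W\<close> with \<open>g = 1\<close>
    and of 3 for the starting value of the test function, the drift term and the variation term,
    each at most \<open>K\<close>. The 12 exceeds the multiples 6 and 2 of the cube of
    \<open>N\<close> that occur in the cases.\<close>
  define E where "E = (\<lambda>\<omega>. l\<^sup>2 * c ^ 3 * (45 * s ^ 3 + 12 * (\<bar>N \<omega>\<bar> ^ 3 / \<delta>\<^sup>2) + 9 * indicator A \<omega> + 6 * \<delta> * indicator (D - G) \<omega>))"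
  have ind: "integrable M (indicator S :: 'a \<Rightarrow> real)" if "S \<in> sets M" for S
    using that by (simp add: integrable_indicator_iff less_top[symmetric])
  have DG [measurable]: "D - G \<in> sets M" using G by simp
  note i3' = i3 ind[OF A(1)] ind[OF DG]
  have iE: "integrable M E" unfolding E_def
    by (intro integrable_mult_right Bochner_Integration.integrable_add integrable_divide_zero integrable_const) (use i3' in auto)
  have L1: "1 \<le> l\<^sup>2" "l \<le> l\<^sup>2"
    using l one_le_power[OF l, of 2] power_increasing[of 1 2 l] by auto
  have C1: "1 \<le> c ^ 3" "c \<le> c ^ 3" "c\<^sup>2 \<le> c ^ 3"
    using c one_le_power[OF c, of 3] power_increasing[of 1 3 c] power_increasing[of 2 3 c] by auto
  define K where "K = l\<^sup>2 * c ^ 3"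
  have K1: "1 \<le> K" unfolding K_def using mult_mono[OF L1(1) C1(1)] by simp
  have Kl: "l \<le> K" unfolding K_def using mult_mono[OF L1(2) C1(1)] l by simp
  have Klc: "l * c \<le> K" unfolding K_def using mult_mono[OF L1(2) C1(2)] l c by simp
  have Kc: "c \<le> K" unfolding K_def using mult_mono[OF L1(1) C1(2)] l c by simp
  have Klc2: "l * c\<^sup>2 \<le> K" unfolding K_def using mult_mono[OF L1(2) C1(3)] l c by simp
  \<comment> \<open>Applied with \<open>g = 1\<close> on \<open>A\<close> and with
    \<open>g = \<delta>\<close> on \<open>D - G\<close>; the condition
    \<open>s\<^sup>2 \<le> g\<close> allows the cap on \<open>V\<close> to be expressed through
    \<open>g\<close>.\<close>
  have Wabs: "\<bar>W \<omega>\<bar> \<le> K * (6 * g + 2 * (\<bar>N \<omega>\<bar> ^ 3 / g\<^sup>2))" if g: "0 < g" "g \<le> 1" "s\<^sup>2 \<le> g" for g \<omega>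
  proof -
    define n3 where "n3 = \<bar>N \<omega>\<bar> ^ 3"
    have n3: "0 \<le> n3" by (simp add: n3_def)
    have "g\<^sup>2 \<le> g" using g by (simp add: power2_eq_square mult_le_one)
    have "n3 / g \<le> n3 / g\<^sup>2" using n3 g \<open>g\<^sup>2 \<le> g\<close> by (intro divide_left_mono) auto
    have a1: "\<bar>N \<omega>\<bar> \<le> g + n3 / g\<^sup>2" using young_cubic(1)[OF g(1), of "N \<omega>"] by (simp add: n3_def)
    have a2: "(N \<omega>)\<^sup>2 \<le> g + n3 / g\<^sup>2"
      using young_cubic(2)[OF g(1), of "N \<omega>"] \<open>g\<^sup>2 \<le> g\<close> \<open>n3 / g \<le> n3 / g\<^sup>2\<close> by (simp add: n3_def)
    have "4 * c\<^sup>2 * s\<^sup>2 \<le> 4 * c\<^sup>2 * g" using g by (intro mult_left_mono) auto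
    then have a3: "\<bar>V \<omega>\<bar> \<le> 4 * c\<^sup>2 * g" using V0[of \<omega>] VK[of \<omega>] by (simp add: V_def)
    define u where "u = g + n3 / g\<^sup>2"
    have u: "0 \<le> u" using g n3 by (simp add: u_def)
    note d2 = Y2h[of \<omega>]
    have b1: "\<bar>Y1 \<omega> * N \<omega>\<bar> \<le> 1 * u" unfolding abs_mult u_def by (intro mult_mono Y1b a1) auto
    have b2: "\<bar>Y2 \<omega> * (N \<omega>)\<^sup>2\<bar> \<le> l / 2 * u" unfolding abs_mult u_def by (intro mult_mono d2) (use a2 l in auto)
    have b3: "\<bar>Y2 \<omega> * V \<omega>\<bar> \<le> l / 2 * (4 * c\<^sup>2 * g)" unfolding abs_mult by (intro mult_mono d2 a3) (use l in auto)
    have "l / 2 * u \<le> K * u" using Kl u K1 by (intro mult_right_mono) auto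
    moreover have "1 * u \<le> K * u" using K1 u by (intro mult_right_mono) auto
    moreover have "l / 2 * (4 * c\<^sup>2 * g) = l * c\<^sup>2 * (2 * g)" by simp
    moreover have "l * c\<^sup>2 * (2 * g) \<le> K * (2 * g)" using Klc2 g by (intro mult_right_mono) auto
    ultimately have "\<bar>W \<omega>\<bar> \<le> K * u + K * u + K * (2 * g)" using b1 b2 b3 unfolding W_def by linarith
    also have "\<dots> = K * (4 * g + 2 * (n3 / g\<^sup>2))" by (simp add: u_def algebra_simps)
    also have "\<dots> \<le> K * (6 * g + 2 * (n3 / g\<^sup>2))" using K1 g by (intro mult_left_mono) auto
    finally show ?thesis by (simp add: n3_def)
  qed
  have d2: "\<delta>\<^sup>2 \<le> 1" "0 < \<delta>\<^sup>2" using d by (auto simp: power_le_one)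
  have n3d: "\<bar>N \<omega>\<bar> ^ 3 \<le> \<bar>N \<omega>\<bar> ^ 3 / \<delta>\<^sup>2" for \<omega>
    using d2 by (simp add: pos_le_divide_eq mult_left_le)
  have s2: "s\<^sup>2 \<le> 1" using s by (simp add: power_le_one)
  have main: "AE \<omega> in M. W \<omega> - E \<omega> \<le> ?f1 \<omega> - ?f2 \<omega>"
    using ae AE_space
  proof eventually_elim
    case (elim \<omega>)
    define n3 where "n3 = \<bar>N \<omega>\<bar> ^ 3"
    define m3 where "m3 = \<bar>N \<omega>\<bar> ^ 3 / \<delta>\<^sup>2"
    have nm: "0 \<le> n3" "n3 \<le> m3" using n3d[of \<omega>] by (simp_all add: n3_def m3_def)
    have Eeq: "E \<omega> = K * (45 * s ^ 3 + 12 * m3 + 9 * indicator A \<omega> + 6 * \<delta> * indicator (D - G) \<omega>)"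
      by (simp add: E_def K_def m3_def)
    have K0: "0 \<le> K" using K1 by simp
    have i0: "0 \<le> 9 * (indicator A \<omega> :: real)" "0 \<le> 6 * \<delta> * indicator (D - G) \<omega>" using d by auto
    show ?case
    proof (cases "\<omega> \<in> G")
      case True
      then have xD: "\<omega> \<in> D" "0 \<le> x \<omega>" "x \<omega> \<le> c" using G Dx by auto
      from elim True have y: "0 \<le> y \<omega>" "y \<omega> \<le> c" and A1: "\<bar>y \<omega> - x \<omega> - (I b \<omega> - I a \<omega>)\<bar> \<le> c * s\<^sup>2"
        and Hm: "(\<lambda>s. indicator {a..b} s * H s \<omega>) \<in> borel_measurable borel"
        and Hv: "(\<integral>\<^sup>+ s\<in>{a..b}. ennreal ((H s \<omega>)\<^sup>2) \<partial>lborel) = ennreal (v \<omega>)" and v0: "0 \<le> v \<omega>" "v \<omega> \<le> c * s\<^sup>2"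
        by blast+
      show ?thesis
      proof (cases "\<omega> \<in> A")
        case False
        have "c * s\<^sup>2 \<le> c\<^sup>2 * s\<^sup>2" using c by (intro mult_right_mono) (auto simp: power2_eq_square)
        then have "ennreal (v \<omega>) \<le> ennreal (4 * c\<^sup>2 * s\<^sup>2 / 4)" using v0 by (intro ennreal_leI) simp
        then have JN: "\<bar>N \<omega> - (I b \<omega> - I a \<omega>)\<bar> \<le> s ^ 3" and "ennreal (v \<omega>) \<le> ennreal (2 * V \<omega> + s ^ 3)"
          using app[OF _ Hm] False elim Hv by (auto simp: N_def V_def)
        then have vV: "v \<omega> \<le> 2 * V \<omega> + s ^ 3" using V0[of \<omega>] sp by (subst (asm) ennreal_le_iff) auto
        have "W \<omega> = (1 - exp (- l * x \<omega>)) * N \<omega> + l * exp (- l * x \<omega>) / 2 * ((N \<omega>)\<^sup>2 - V \<omega>)"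
          using xD by (simp add: W_def Y1_def Y2_def right_diff_distrib)
        moreover have "K * (45 * s ^ 3 + 6 * n3) \<le> E \<omega>"
          unfolding Eeq using nm sp(2) i0 by (intro mult_left_mono K0) linarith
        ultimately show ?thesis
          using step_lower_bound[OF c l s xD(2) A1 JN vV, folded n3_def K_def] True by simp
      next
        case inA: True
        have "\<bar>W \<omega>\<bar> \<le> K * (6 * 1 + 2 * (\<bar>N \<omega>\<bar> ^ 3 / 1\<^sup>2))" by (rule Wabs) (use s2 in auto)
        then have w: "W \<omega> \<le> K * (6 + 2 * n3)" by (simp add: n3_def)
        have "K * 3 + K * (6 + 2 * n3) \<le> E \<omega>"
        proof -
          have "9 * (indicator A \<omega> :: real) = 9" using inA by simp
          then show ?thesis
            unfolding Eeq distrib_left[symmetric] using nm sp(2) i0 by (intro mult_left_mono K0) linarith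
        qed
        moreover have "test_fun l (x \<omega>) \<le> K" using test_fun_le[OF l xD(2)] xD Kc by simp
        moreover have "0 \<le> test_fun l (y \<omega>)" by (rule test_fun_nonneg[OF l])
        moreover have "(1 - exp (- l * x \<omega>)) * (y \<omega> - x \<omega> - (I b \<omega> - I a \<omega>)) \<le> K"
        proof -
          have "c * s\<^sup>2 \<le> c * 1" using c s2 by (intro mult_left_mono) auto
          then have "\<bar>y \<omega> - x \<omega> - (I b \<omega> - I a \<omega>)\<bar> \<le> c" using A1 by simp
          then have "\<bar>1 - exp (- l * x \<omega>)\<bar> * \<bar>y \<omega> - x \<omega> - (I b \<omega> - I a \<omega>)\<bar> \<le> 1 * c"
            using l xD by (intro mult_mono) auto
          then show ?thesis using Kc unfolding abs_mult[symmetric] by linarith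
        qed
        moreover have "l * exp (- l * x \<omega>) / 4 * v \<omega> \<le> K"
        proof -
          have "c * s\<^sup>2 \<le> c * 1" using c s2 by (intro mult_left_mono) auto
          then have "v \<omega> \<le> c" using v0 by simp
          then have "l * exp (- l * x \<omega>) / 4 * v \<omega> \<le> l * c"
            using l v0 exq(1)[OF xD(1)] by (intro mult_mono) linarith+
          then show ?thesis using Klc by simp
        qed
        ultimately show ?thesis using w True by simp
      qed
    next
      case False
      show ?thesis
      proof (cases "\<omega> \<in> D")
        case True
        have "W \<omega> \<le> K * (6 * \<delta> + 2 * m3)" using Wabs[OF d, of \<omega>] by (simp add: m3_def)
        also have "\<dots> \<le> E \<omega>"
        proof -
          have "6 * \<delta> * indicator (D - G) \<omega> = 6 * \<delta>" using True False by simp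
          then show ?thesis unfolding Eeq using nm sp(2) i0 by (intro mult_left_mono K0) linarith
        qed
        finally show ?thesis using False by simp
      next
        case notD: False
        then have "W \<omega> = 0" by (simp add: W_def Y1_def Y2_def)
        moreover have "0 \<le> E \<omega>" unfolding Eeq using nm sp(2) i0 by (intro mult_nonneg_nonneg K0) linarith
        ultimately show ?thesis using False by simp
      qed
    qed
  qed
  have b1: "AE \<omega> in M. norm (?f1 \<omega>) \<le> c"
    using ae
  proof eventually_elim
    case (elim \<omega>)
    show ?case
    proof (cases "\<omega> \<in> G")
      case True
      then have "0 \<le> x \<omega>" "x \<omega> \<le> c" "0 \<le> y \<omega>" "y \<omega> \<le> c" using elim G Dx by auto
      then have "0 \<le> test_fun l (x \<omega>)" "test_fun l (x \<omega>) \<le> c" "0 \<le> test_fun l (y \<omega>)" "test_fun l (y \<omega>) \<le> c"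
        using test_fun_nonneg[OF l] test_fun_le[OF l, of "x \<omega>"] test_fun_le[OF l, of "y \<omega>"] by auto
      then show ?thesis using True by (simp add: abs_if)
    qed (use c in simp)
  qed
  have f1: "integrable M ?f1" by (rule integrable_const_bound[OF b1]) measurable
  have b2: "AE \<omega> in M. norm (?f2 \<omega>) \<le> c + l * c"
    using ae
  proof eventually_elim
    case (elim \<omega>)
    show ?case
    proof (cases "\<omega> \<in> G")
      case True
      then have xx: "0 \<le> x \<omega>" "x \<omega> \<le> c" and A1: "\<bar>y \<omega> - x \<omega> - (I b \<omega> - I a \<omega>)\<bar> \<le> c * s\<^sup>2"
        and v0: "0 \<le> v \<omega>" "v \<omega> \<le> c * s\<^sup>2" using elim G Dx by auto
      have cs: "c * s\<^sup>2 \<le> c" using c s2 by (simp add: mult_left_le)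
      have "\<bar>(1 - exp (- l * x \<omega>)) * (y \<omega> - x \<omega> - (I b \<omega> - I a \<omega>))\<bar> \<le> 1 * c"
        unfolding abs_mult using l xx A1 cs by (intro mult_mono) auto
      moreover have "\<bar>l * exp (- l * x \<omega>) / 4 * v \<omega>\<bar> \<le> l * c"
      proof -
        have "\<bar>v \<omega>\<bar> \<le> c" "\<omega> \<in> D" using v0 cs True G(2) by auto
        then have "\<bar>l * exp (- l * x \<omega>) / 4\<bar> * \<bar>v \<omega>\<bar> \<le> l * c" using exq(2)[of \<omega>] l by (intro mult_mono) auto
        then show ?thesis by (simp only: abs_mult[symmetric])
      qed
      ultimately show ?thesis using True by (simp add: abs_le_iff)
    qed (use c l in simp)
  qed
  have f2: "integrable M ?f2" by (rule integrable_const_bound[OF b2]) measurable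
  have "expectation (\<lambda>\<omega>. W \<omega> - E \<omega>) \<le> expectation (\<lambda>\<omega>. ?f1 \<omega> - ?f2 \<omega>)"
    by (rule integral_mono_AE[OF _ _ main]) (use WI iE f1 f2 in auto)
  then have "- expectation E \<le> expectation ?f1 - expectation ?f2"
    using WI iE f1 f2 EW by simp
  \<comment> \<open>The third moment contributes \<open>108 * 2 ^ 3 = 864\<close>, and
    \<open>45 + 12 * 864 + 9 = 10422\<close> is rounded up to 11000.\<close>
  moreover have "expectation E \<le> 11000 * l\<^sup>2 * c ^ 6 * (s ^ 3 / \<delta>\<^sup>2 + \<delta> * measure M (D - G))"
  proof -
    define p where "p = measure M (D - G)"
    define t where "t = s ^ 3 / \<delta>\<^sup>2"
    have p0: "0 \<le> p" by (simp add: p_def)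
    have t0: "s ^ 3 \<le> t" "0 < s ^ 3" using d2 sp by (auto simp: t_def pos_le_divide_eq mult_left_le)
    have eE: "expectation E = K * (45 * s ^ 3 + 12 * (expectation (\<lambda>\<omega>. \<bar>N \<omega>\<bar> ^ 3) / \<delta>\<^sup>2) + 9 * measure M A + 6 * \<delta> * p)"
      unfolding E_def K_def p_def using i3' by (simp add: prob_space)
    have "expectation (\<lambda>\<omega>. \<bar>N \<omega>\<bar> ^ 3) / \<delta>\<^sup>2 \<le> 864 * c ^ 3 * s ^ 3 / \<delta>\<^sup>2"
      using e3 d2 by (intro divide_right_mono) (auto simp: r_def power_mult_distrib)
    then have q: "expectation (\<lambda>\<omega>. \<bar>N \<omega>\<bar> ^ 3) / \<delta>\<^sup>2 \<le> 864 * (c ^ 3 * t)" by (simp add: t_def)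
    have tp: "0 \<le> t" "0 \<le> \<delta> * p" using t0 d p0 by (linarith, simp)
    have ct: "t \<le> c ^ 3 * t" using mult_right_mono[OF C1(1) tp(1)] by simp
    have cp: "\<delta> * p \<le> c ^ 3 * (\<delta> * p)" using mult_right_mono[OF C1(1) tp(2)] by simp
    have dp: "0 \<le> c ^ 3 * (\<delta> * p)" using c d p0 by simp
    have "45 * s ^ 3 + 12 * (expectation (\<lambda>\<omega>. \<bar>N \<omega>\<bar> ^ 3) / \<delta>\<^sup>2) + 9 * measure M A + 6 * \<delta> * p
       \<le> 45 * (c ^ 3 * t) + 12 * (864 * (c ^ 3 * t)) + 9 * (c ^ 3 * t) + 6 * (c ^ 3 * (\<delta> * p))"
      using q ct cp t0 A(2) by linarith
    also have "\<dots> \<le> 11000 * (c ^ 3 * (t + \<delta> * p))"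
    proof -
      have "c ^ 3 * (t + \<delta> * p) = c ^ 3 * t + c ^ 3 * (\<delta> * p)" by (rule distrib_left)
      then show ?thesis using ct t0 dp by linarith
    qed
    finally have "expectation E \<le> K * (11000 * (c ^ 3 * (t + \<delta> * p)))"
      unfolding eE using K1 by (intro mult_left_mono) auto
    also have "\<dots> = 11000 * l\<^sup>2 * c ^ 6 * (t + \<delta> * p)"
      by (simp add: K_def power_add[of c 3 3, simplified])
    finally show ?thesis by (simp add: t_def p_def)
  qed
  ultimately show ?thesis by linarith
qed

end

section \<open>Paths of the system\<close>

text \<open>Finite sets increasing to the whole lattice: countably many of them suffice to express
  statements about all finite sums of coordinates.\<close>

definition sites :: "nat \<Rightarrow> ('i :: countable) set" where
  "sites n = {i. to_nat i < n}"

lemma finite_sites [simp]: "finite (sites n :: 'i :: countable set)"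
proof -
  have "(sites n :: 'i set) = to_nat -` {..<n}" by (auto simp: sites_def)
  then show ?thesis by (simp add: finite_vimageI)
qed

lemma finite_subset_sites:
  assumes "finite A"
  obtains n where "A \<subseteq> sites n"
proof -
  have "i \<in> sites (Suc (Max (to_nat ` A)))" if "i \<in> A" for i
    using that assms by (simp add: sites_def less_Suc_eq_le)
  then show ?thesis using that by blast
qed

text \<open>Two values in \<open>[0, R]\<close> differ by at most \<open>R\<close>, which gives the
  first bound. For the second, the nonnegative inflow from other sites is dropped and only the
  outflow remains; the result is proportional to \<open>x i\<close> and hence summable over
  sites.\<close>

lemma drift_bounds:
  fixes q x :: "(int ^ 'd) \<Rightarrow> real"
  assumes q: "q \<in> ell1_nonneg" and x: "\<And>j. 0 \<le> x j" "\<And>j. x j \<le> R"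
  shows "\<bar>drift q x i\<bar> \<le> ell1_norm q * R" "- (ell1_norm q * x i) \<le> drift q x i"
proof -
  have q0: "0 \<le> q j" for j using q by (simp add: ell1_nonneg_def)
  have "(\<lambda>i. \<bar>q i\<bar>) = q" using q0 by auto
  then have qs: "q summable_on UNIV" using q by (simp add: ell1_nonneg_def)
  have bij: "bij_betw (\<lambda>j. i - j) UNIV (UNIV :: (int ^ 'd) set)"
    by (rule bij_betwI[of _ _ _ "\<lambda>j. i - j"]) auto
  have qi: "(\<lambda>j. q (i - j)) summable_on UNIV" using summable_on_reindex_bij_betw[OF bij, of q] qs by simp
  have Qi: "(\<Sum>\<^sub>\<infinity>j. q (i - j)) = ell1_norm q"
    using infsum_reindex_bij_betw[OF bij, of q] q0 by (simp add: ell1_norm_def)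
  have bd: "norm (q (i - j) * (x j - x i)) \<le> q (i - j) * R" for j
    unfolding real_norm_def abs_mult using q0[of "i - j"] x(1)[of i] x(1)[of j] x(2)[of i] x(2)[of j]
    by (intro mult_mono) auto
  have qR: "(\<lambda>j. q (i - j) * R) summable_on UNIV" using qi by (rule summable_on_cmult_left)
  have as: "(\<lambda>j. norm (q (i - j) * (x j - x i))) summable_on UNIV"
    by (rule Infinite_Sum.abs_summable_on_comparison_test'[OF qR]) (use bd in simp)
  have "\<bar>drift q x i\<bar> \<le> (\<Sum>\<^sub>\<infinity>j. norm (q (i - j) * (x j - x i)))"
    using norm_infsum_bound[OF as] by (simp add: drift_def)
  also have "\<dots> \<le> (\<Sum>\<^sub>\<infinity>j. q (i - j) * R)" by (rule infsum_mono[OF as qR bd])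
  also have "\<dots> = ell1_norm q * R" using Qi by (simp add: infsum_cmult_left')
  finally show "\<bar>drift q x i\<bar> \<le> ell1_norm q * R" .
  have "(\<Sum>\<^sub>\<infinity>j. q (i - j) * (- x i)) = ell1_norm q * (- x i)"
    unfolding Qi[symmetric] by (rule infsum_cmult_left')
  then have "- (ell1_norm q * x i) = (\<Sum>\<^sub>\<infinity>j. q (i - j) * (- x i))" by linarith
  also have "\<dots> \<le> drift q x i"
    unfolding drift_def
  proof (rule infsum_mono)
    show "(\<lambda>j. q (i - j) * - x i) summable_on UNIV" using qi by (rule summable_on_cmult_left)
    show "(\<lambda>j. q (i - j) * (x j - x i)) summable_on UNIV" using abs_summable_summable[OF as] .
    show "q (i - j) * - x i \<le> q (i - j) * (x j - x i)" for j
      using q0[of "i - j"] x(1)[of j] by (intro mult_left_mono) auto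
  qed
  finally show "- (ell1_norm q * x i) \<le> drift q x i" .
qed

lemma borel_measurable_swap_lborel:
  assumes "g \<in> borel_measurable (borel \<Otimes>\<^sub>M M)"
  shows "(\<lambda>(\<omega>, s). g (s, \<omega>)) \<in> borel_measurable (M \<Otimes>\<^sub>M lborel)"
proof -
  have "g \<in> borel_measurable (lborel \<Otimes>\<^sub>M M)"
    using assms by (simp cong: measurable_cong_sets add: sets_pair_measure_cong[OF sets_lborel refl])
  then show ?thesis by measurable
qed

text \<open>All almost sure path properties of the solution hold everywhere on the event \<open>\<Omega>\<close> of full measure.\<close>

locale lattice_system =
  fixes M :: "'a measure" and F :: "real \<Rightarrow> 'a measure"
    and B :: "(int ^ 'd) \<Rightarrow> real \<Rightarrow> 'a \<Rightarrow> real" and q :: "(int ^ 'd) \<Rightarrow> real"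
    and f \<sigma> :: "real \<Rightarrow> real" and X :: "real \<Rightarrow> 'a \<Rightarrow> (int ^ 'd) \<Rightarrow> real"
    and I :: "(int ^ 'd) \<Rightarrow> real \<Rightarrow> 'a \<Rightarrow> real" and L :: real and \<Omega> :: "'a set"
  assumes brownians: "\<And>i. filtered_brownian M F (B i)"
    and q: "q \<in> ell1_nonneg"
    and lipschitz: "L-lipschitz_on {0..} f" and f0: "f 0 = 0"
    and sigma_cont: "continuous_on {0..} \<sigma>"
    and nonneg: "\<And>t \<omega> i. 0 \<le> t \<Longrightarrow> \<omega> \<in> space M \<Longrightarrow> 0 \<le> X t \<omega> i"
    and X_adapted: "\<And>t i. 0 \<le> t \<Longrightarrow> (\<lambda>\<omega>. X t \<omega> i) \<in> borel_measurable (F t)"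
    and ito: "\<And>i. is_ito_integral M F (B i) (\<lambda>t \<omega>. \<sigma> (X t \<omega> i)) (I i)"
    and Om: "\<Omega> \<in> sets M" and AE_Om: "AE \<omega> in M. \<omega> \<in> \<Omega>"
    and path_cont: "\<And>\<omega> i. \<omega> \<in> \<Omega> \<Longrightarrow> continuous_on {0..} (\<lambda>t. X t \<omega> i)"
    and path_int: "\<And>\<omega> i t. \<omega> \<in> \<Omega> \<Longrightarrow> 0 \<le> t \<Longrightarrow>
      set_integrable lborel {0..t} (\<lambda>s. drift q (X s \<omega>) i) \<and> set_integrable lborel {0..t} (\<lambda>s. f (X s \<omega> i))"
    and path_eq: "\<And>\<omega> i t. \<omega> \<in> \<Omega> \<Longrightarrow> 0 \<le> t \<Longrightarrow> X t \<omega> i = X 0 \<omega> i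
                  + (LINT s:{0..t}|lborel. drift q (X s \<omega>) i)
                  + (LINT s:{0..t}|lborel. f (X s \<omega> i)) + I i t \<omega>"
begin

lemma Om_space: "\<omega> \<in> \<Omega> \<Longrightarrow> \<omega> \<in> space M"
  using Om sets.sets_into_space by blast

lemma X_measurable [measurable]: "0 \<le> t \<Longrightarrow> (\<lambda>\<omega>. X t \<omega> i) \<in> borel_measurable M"
  using filtered_brownian.measurable_F_M[OF brownians X_adapted] by simp

lemma L_nonneg: "0 \<le> L"
  using lipschitz by (rule lipschitz_on_nonneg)

lemma f_bound: "0 \<le> x \<Longrightarrow> \<bar>f x\<bar> \<le> L * x"
  using lipschitz_onD[OF lipschitz, of x 0] f0 by (simp add: dist_real_def)

definition Q :: real where "Q = ell1_norm q"

lemma Q_nonneg: "0 \<le> Q"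
  unfolding Q_def ell1_norm_def by (rule infsum_nonneg) simp

text \<open>Only rational times are used because the filtration need not be complete; by path continuity
  on \<open>\<Omega>\<close> this bounds the mass at all times up to \<open>t\<close>.\<close>

definition mass_event :: "real \<Rightarrow> real \<Rightarrow> 'a set" where
  "mass_event R t = {\<omega> \<in> space M. \<forall>(r::rat) n. 0 \<le> real_of_rat r \<and> real_of_rat r \<le> t \<longrightarrow>
     (\<Sum>i\<in>sites n. X (real_of_rat r) \<omega> i) \<le> R}"

lemma mass_event_sets:
  assumes "0 \<le> t"
  shows "mass_event R t \<in> sets (F t)"
proof -
  interpret fb: filtered_brownian M F "B 0" by (rule brownians)
  have sp: "space (F t) = space M" using fb.space_F[OF assms] .
  have "{\<omega> \<in> space (F t). \<forall>(r::rat) n. 0 \<le> real_of_rat r \<and> real_of_rat r \<le> t \<longrightarrow>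
     (\<Sum>i\<in>sites n. X (real_of_rat r) \<omega> i) \<le> R} \<in> sets (F t)"
  proof (intro sets.sets_Collect_countable_All)
    fix r :: rat and n :: nat
    show "{\<omega> \<in> space (F t). 0 \<le> real_of_rat r \<and> real_of_rat r \<le> t \<longrightarrow>
     (\<Sum>i\<in>sites n. X (real_of_rat r) \<omega> i) \<le> R} \<in> sets (F t)"
    proof (cases "0 \<le> real_of_rat r \<and> real_of_rat r \<le> t")
      case True
      then have "(\<lambda>\<omega>. X (real_of_rat r) \<omega> i) \<in> borel_measurable (F t)" for i
        by (intro fb.measurable_F_mono[OF X_adapted]) simp_all
      then have [measurable]: "(\<lambda>\<omega>. \<Sum>i\<in>sites n. X (real_of_rat r) \<omega> i) \<in> borel_measurable (F t)"
        by (intro borel_measurable_sum)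
      show ?thesis using True by simp
    next
      case False
      then have "{\<omega> \<in> space (F t). 0 \<le> real_of_rat r \<and> real_of_rat r \<le> t \<longrightarrow>
        (\<Sum>i\<in>sites n. X (real_of_rat r) \<omega> i) \<le> R} = space (F t)" by blast
      then show ?thesis by (simp only: sets.top)
    qed
  qed
  then show ?thesis by (simp only: mass_event_def sp)
qed

lemma mass_event_M: "0 \<le> t \<Longrightarrow> mass_event R t \<in> sets M"
  using mass_event_sets[of t R] filtered_brownian.subalg[OF brownians, of t] by (auto simp: subalgebra_def)

lemma mass_event_antimono: "s \<le> t \<Longrightarrow> mass_event R t \<subseteq> mass_event R s"
  by (auto simp: mass_event_def)

lemma mass_le:
  assumes w: "\<omega> \<in> \<Omega>" "\<omega> \<in> mass_event R t" and s: "0 \<le> s" "s \<le> t" and A: "finite A"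
  shows "(\<Sum>i\<in>A. X s \<omega> i) \<le> R"
proof -
  obtain n where n: "A \<subseteq> sites n" using finite_subset_sites[OF A] .
  define g where "g = (\<lambda>s. \<Sum>i\<in>sites n. X s \<omega> i)"
  have rat: "g (real_of_rat r) \<le> R" if "0 \<le> real_of_rat r" "real_of_rat r \<le> t" for r
    using w(2) that by (simp add: mass_event_def g_def)
  have cont: "continuous_on {0..} g" unfolding g_def by (intro continuous_on_sum path_cont w)
  have "g s \<le> R"
  proof (rule ccontr)
    assume "\<not> g s \<le> R"
    then have e: "0 < g s - R" by simp
    show False
    \<comment> \<open>For \<open>t = 0\<close> the only time is 0, which is itself rational. For
      \<open>t > 0\<close> a rational time of \<open>[0, t]\<close> lies arbitrarily close to
      \<open>s\<close>, and an excess at \<open>s\<close> would persist there.\<close>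
    proof (cases "t = 0")
      case True
      then have "s = 0" using s by simp
      moreover have "g 0 \<le> R" using rat[of 0] True by simp
      ultimately show ?thesis using e by simp
    next
      case False
      obtain d where d: "d > 0" "\<forall>u\<in>{0..}. dist u s < d \<longrightarrow> dist (g u) (g s) < g s - R"
        using cont[unfolded continuous_on_iff, rule_format, of s "g s - R"] s e by auto
      have "max 0 (s - d) < min t (s + d)" using s d False by auto
      then obtain r where r: "r \<in> \<rat>" "max 0 (s - d) < r" "r < min t (s + d)"
        using Rats_dense_in_real by blast
      obtain r' where r': "r = real_of_rat r'" using r(1) by (auto elim: Rats_cases)
      have "dist (g r) (g s) < g s - R" using d(2) r by (auto simp: dist_real_def)
      then have "R < g r" by (simp add: dist_real_def abs_less_iff)
      moreover have "g r \<le> R" unfolding r' by (rule rat) (use r r' in auto)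
      ultimately show ?thesis by simp
    qed
  qed
  moreover have "(\<Sum>i\<in>A. X s \<omega> i) \<le> g s"
    unfolding g_def by (rule sum_mono2[OF _ n]) (use nonneg[OF s(1) Om_space[OF w(1)]] in auto)
  ultimately show ?thesis by simp
qed

lemma X_le:
  assumes "\<omega> \<in> \<Omega>" "\<omega> \<in> mass_event R t" "0 \<le> s" "s \<le> t"
  shows "X s \<omega> i \<le> R"
  using mass_le[OF assms, of "{i}"] by simp

section \<open>A jointly measurable version and its time integrals\<close>

text \<open>With the paths off \<open>\<Omega>\<close> replaced by 0, every path is continuous on
  the half-line. This makes the process jointly measurable and its time integrals random variables
  although \<open>M\<close> need not be complete.\<close>

definition W :: "(int ^ 'd) \<Rightarrow> real \<Rightarrow> 'a \<Rightarrow> real" where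
  "W i s \<omega> = (if \<omega> \<in> \<Omega> \<and> 0 \<le> s then X s \<omega> i else 0)"

lemma W_nonneg: "0 \<le> W i s \<omega>"
  using nonneg Om_space by (simp add: W_def)

lemma W_cont: "\<omega> \<in> \<Omega> \<Longrightarrow> 0 \<le> a \<Longrightarrow> continuous_on {a..b} (\<lambda>s. W i s \<omega>)"
  using continuous_on_subset[OF path_cont[of \<omega> i], of "{a..b}"]
  by (subst continuous_on_cong[OF refl, of _ _ "\<lambda>s. X s \<omega> i"]) (auto simp: W_def)

text \<open>The process is a pointwise limit of processes frozen at the grid point
  \<open>k / (n + 1)\<close> just before the current time. Each of those is glued from countably
  many random variables, and path continuity on \<open>\<Omega>\<close> gives the limit.\<close>

lemma W_joint_measurable: "(\<lambda>p. W i (fst p) (snd p)) \<in> borel_measurable (borel \<Otimes>\<^sub>M M)"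
proof (rule borel_measurable_LIMSEQ_real)
  define g where "g = (\<lambda>n (p :: real \<times> 'a). if snd p \<in> \<Omega> \<and> 0 \<le> fst p
    then X (real (nat \<lfloor>real (Suc n) * fst p\<rfloor>) / real (Suc n)) (snd p) i else 0)"
  note [measurable] = Om
  show "g n \<in> borel_measurable (borel \<Otimes>\<^sub>M M)" for n
  proof -
    have "(\<lambda>p. X (real (nat \<lfloor>real (Suc n) * fst p\<rfloor>) / real (Suc n)) (snd p) i) \<in> borel_measurable (borel \<Otimes>\<^sub>M M)"
    proof (rule measurable_compose_countable[where f = "\<lambda>k p. X (real k / real (Suc n)) (snd p) i"
          and g = "\<lambda>p. nat \<lfloor>real (Suc n) * fst p\<rfloor>"])
      fix k
      show "(\<lambda>p. X (real k / real (Suc n)) (snd p) i) \<in> borel_measurable (borel \<Otimes>\<^sub>M M)"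
        by (rule measurable_compose[OF measurable_snd X_measurable]) simp
    qed measurable
    then show ?thesis unfolding g_def by measurable
  qed
  fix p :: "real \<times> 'a"
  obtain s \<omega> where p: "p = (s, \<omega>)" by (cases p)
  show "(\<lambda>n. g n p) \<longlonglongrightarrow> W i (fst p) (snd p)"
  proof (cases "\<omega> \<in> \<Omega> \<and> 0 \<le> s")
    case True
    have lim: "(\<lambda>n. real (nat \<lfloor>real (Suc n) * s\<rfloor>) / real (Suc n)) \<longlonglongrightarrow> s"
    proof (rule real_tendsto_sandwich)
      have e: "s - 1 / real (Suc n) \<le> real (nat \<lfloor>real (Suc n) * s\<rfloor>) / real (Suc n) \<and>
          real (nat \<lfloor>real (Suc n) * s\<rfloor>) / real (Suc n) \<le> s" for n
      proof -
        define y where "y = real (Suc n) * s"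
        have "0 \<le> y" using True by (simp add: y_def)
        then have "real (nat \<lfloor>y\<rfloor>) = of_int \<lfloor>y\<rfloor>" by simp
        then have "y - 1 \<le> real (nat \<lfloor>y\<rfloor>)" "real (nat \<lfloor>y\<rfloor>) \<le> y" by linarith+
        then have "(y - 1) / real (Suc n) \<le> real (nat \<lfloor>y\<rfloor>) / real (Suc n)"
          "real (nat \<lfloor>y\<rfloor>) / real (Suc n) \<le> y / real (Suc n)" by (intro divide_right_mono; simp)+
        moreover have "y / real (Suc n) = s" by (simp add: y_def)
        ultimately show ?thesis by (simp add: y_def diff_divide_distrib)
      qed
      show "\<forall>\<^sub>F n in sequentially. s - 1 / real (Suc n) \<le> real (nat \<lfloor>real (Suc n) * s\<rfloor>) / real (Suc n)"
        using e by simp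
      show "\<forall>\<^sub>F n in sequentially. real (nat \<lfloor>real (Suc n) * s\<rfloor>) / real (Suc n) \<le> s"
        using e by simp
      show "(\<lambda>n. s - 1 / real (Suc n)) \<longlonglongrightarrow> s"
        using tendsto_diff[OF tendsto_const LIMSEQ_inverse_real_of_nat, of s] by (simp add: inverse_eq_divide)
    qed simp
    have "(\<lambda>n. X (real (nat \<lfloor>real (Suc n) * s\<rfloor>) / real (Suc n)) \<omega> i) \<longlonglongrightarrow> X s \<omega> i"
      by (rule continuous_on_tendsto_compose[OF path_cont[of \<omega> i] lim]) (use True in auto)
    then show ?thesis using True by (simp add: g_def p W_def)
  qed (auto simp: g_def p W_def)
qed

lemma sigma_W_joint_measurable: "(\<lambda>p. \<sigma> (W i (fst p) (snd p))) \<in> borel_measurable (borel \<Otimes>\<^sub>M M)"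
proof -
  \<comment> \<open>Continuity of \<open>\<sigma>\<close> is given on the half-line only; composing
    with \<open>max 0\<close> extends it without changing its values at \<open>W\<close>.\<close>
  have "continuous_on UNIV (\<lambda>x. \<sigma> (max 0 x))"
    by (rule continuous_on_compose2[OF sigma_cont]) (auto intro!: continuous_intros)
  then have "(\<lambda>x. \<sigma> (max 0 x)) \<in> borel_measurable borel" by (rule borel_measurable_continuous_onI)
  from measurable_compose[OF W_joint_measurable this]
  show ?thesis using W_nonneg by (simp add: max_absorb2)
qed

definition wint :: "(int ^ 'd) \<Rightarrow> real \<Rightarrow> real \<Rightarrow> 'a \<Rightarrow> real" where
  "wint i a b \<omega> = (LINT s:{a..b}|lborel. W i s \<omega>)"

text \<open>On \<open>\<Omega>\<close> this is the quadratic variation over \<open>[a, b]\<close> of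
  the stochastic integral at site \<open>i\<close>.\<close>

definition vint :: "(int ^ 'd) \<Rightarrow> real \<Rightarrow> real \<Rightarrow> 'a \<Rightarrow> real" where
  "vint i a b \<omega> = (LINT s:{a..b}|lborel. (\<sigma> (W i s \<omega>))\<^sup>2)"

lemma int_measurable:
  "wint i a b \<in> borel_measurable M" "vint i a b \<in> borel_measurable M"
proof -
  have [measurable]: "(\<lambda>p. W i (fst p) (snd p)) \<in> borel_measurable (borel \<Otimes>\<^sub>M M)"
    "(\<lambda>p. \<sigma> (W i (fst p) (snd p))) \<in> borel_measurable (borel \<Otimes>\<^sub>M M)"
    by (rule W_joint_measurable sigma_W_joint_measurable)+
  have "(\<lambda>p. indicator {a..b} (fst p) * W i (fst p) (snd p)) \<in> borel_measurable (borel \<Otimes>\<^sub>M M)" by measurable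
  from lborel.borel_measurable_lebesgue_integral[OF borel_measurable_swap_lborel[OF this]]
  show "wint i a b \<in> borel_measurable M" by (simp add: wint_def[abs_def] set_lebesgue_integral_def)
  have "(\<lambda>p. indicator {a..b} (fst p) * (\<sigma> (W i (fst p) (snd p)))\<^sup>2) \<in> borel_measurable (borel \<Otimes>\<^sub>M M)" by measurable
  from lborel.borel_measurable_lebesgue_integral[OF borel_measurable_swap_lborel[OF this]]
  show "vint i a b \<in> borel_measurable M" by (simp add: vint_def[abs_def] set_lebesgue_integral_def)
qed

lemma sigma_W_cont: "\<omega> \<in> \<Omega> \<Longrightarrow> 0 \<le> a \<Longrightarrow> continuous_on {a..b} (\<lambda>s. \<sigma> (W i s \<omega>))"
  by (rule continuous_on_compose2[OF sigma_cont W_cont]) (use W_nonneg in auto)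

lemma path_integrable:
  assumes "\<omega> \<in> \<Omega>" "0 \<le> a"
  shows "set_integrable lborel {a..b} (\<lambda>s. W i s \<omega>)"
    "set_integrable lborel {a..b} (\<lambda>s. (\<sigma> (W i s \<omega>))\<^sup>2)"
  using borel_integrable_atLeastAtMost'[OF W_cont[OF assms]]
    borel_integrable_atLeastAtMost'[OF continuous_on_power[OF sigma_W_cont[OF assms]]] by auto

text \<open>\<open>A\<close> is the increment of the finite variation part. Its size, of order
  \<open>b - a\<close>, enters the Taylor remainder, where a uniform bound is enough. The lower
  bound enters a sum over all sites and must therefore be proportional to the mass at site
  \<open>i\<close>.\<close>

lemma drift_increment:
  fixes i :: "int ^ 'd"
  assumes w: "\<omega> \<in> \<Omega>" "\<omega> \<in> mass_event R b" and ab: "0 \<le> a" "a \<le> b"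
  defines "A \<equiv> X b \<omega> i - X a \<omega> i - (I i b \<omega> - I i a \<omega>)"
  shows "\<bar>A\<bar> \<le> (Q + L) * R * (b - a)" "- ((Q + L) * wint i a b \<omega>) \<le> A"
proof -
  define g where "g = (\<lambda>s. drift q (X s \<omega>) i + f (X s \<omega> i))"
  have b0: "0 \<le> b" using ab by simp
  have i0: "set_integrable lborel {0..t} g" if "0 \<le> t" for t
    unfolding g_def using path_int[OF w(1) that] by (intro set_integral_add) auto
  have e0: "X t \<omega> i = X 0 \<omega> i + (LINT s:{0..t}|lborel. g s) + I i t \<omega>" if "0 \<le> t" for t
    unfolding g_def using path_int[OF w(1) that, of i] path_eq[OF w(1) that, of i] by (simp add: set_integral_add)
  have ia: "set_integrable lborel {a..b} g"
    by (rule set_integrable_subset[OF i0[OF b0]]) (use ab in auto)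
  have "(LINT s:{0..a} \<union> {a..b}|lborel. g s) = (LINT s:{0..a}|lborel. g s) + (LINT s:{a..b}|lborel. g s)"
  proof (rule set_integral_Un_AE[OF _ _ _ i0[OF ab(1)] ia])
    show "AE s in lborel. \<not> (s \<in> {0..a} \<and> s \<in> {a..b})"
      using AE_lborel_singleton[of a] by eventually_elim auto
  qed auto
  moreover have "{0..a} \<union> {a..b} = {0..b}" using ab by auto
  ultimately have "(LINT s:{0..b}|lborel. g s) = (LINT s:{0..a}|lborel. g s) + (LINT s:{a..b}|lborel. g s)" by simp
  then have A: "A = (LINT s:{a..b}|lborel. g s)"
    using e0[OF ab(1)] e0[OF b0] by (simp add: A_def)
  have X0: "0 \<le> X s \<omega> j" if "0 \<le> s" for s j using nonneg[OF that Om_space[OF w(1)]] .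
  have XR: "X s \<omega> j \<le> R" if "0 \<le> s" "s \<le> b" for s j using X_le[OF w that] .
  have gb: "\<bar>g s\<bar> \<le> (Q + L) * R" "- (Q + L) * W i s \<omega> \<le> g s" if s: "a \<le> s" "s \<le> b" for s
  proof -
    have s0: "0 \<le> s" using s ab by simp
    note d = drift_bounds[OF q, of "X s \<omega>" R i, OF X0[OF s0] XR[OF s0 s(2)], folded Q_def]
    have f1: "\<bar>f (X s \<omega> i)\<bar> \<le> L * X s \<omega> i" by (rule f_bound[OF X0[OF s0]])
    have "L * X s \<omega> i \<le> L * R" using XR[OF s0 s(2)] L_nonneg by (intro mult_left_mono)
    then show "\<bar>g s\<bar> \<le> (Q + L) * R" unfolding g_def distrib_right using d(1) f1 by linarith
    have "- (Q + L) * W i s \<omega> = - (Q * X s \<omega> i) - L * X s \<omega> i" using w s0 by (simp add: W_def algebra_simps)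
    then show "- (Q + L) * W i s \<omega> \<le> g s" unfolding g_def using d(2) f1 by linarith
  qed
  note iW0 = path_integrable(1)[OF w(1) ab(1), of b i]
  have iW: "set_integrable lborel {a..b} (\<lambda>s. - (Q + L) * W i s \<omega>)"
    by (rule set_integrable_mult_right) (rule iW0)
  have "(LINT s:{a..b}|lborel. - (Q + L) * W i s \<omega>) \<le> A"
    unfolding A by (rule set_integral_mono[OF iW ia]) (use gb(2) in auto)
  moreover have "(LINT s:{a..b}|lborel. - (Q + L) * W i s \<omega>) = - ((Q + L) * wint i a b \<omega>)"
    unfolding wint_def by (subst set_integral_mult_right) (simp add: algebra_simps)
  ultimately show "- ((Q + L) * wint i a b \<omega>) \<le> A" by simp
  have "\<bar>A\<bar> \<le> (LINT s:{a..b}|lborel. \<bar>g s\<bar>)"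
    unfolding A using set_integral_norm_bound[OF ia] by simp
  also have "\<dots> \<le> (LINT s:{a..b}|lborel. (Q + L) * R)"
    by (rule set_integral_mono[OF set_integrable_abs[OF ia]]) (use gb(1) ab in \<open>auto simp: set_integrable_def\<close>)
  also have "\<dots> = (Q + L) * R * (b - a)" using ab by (simp add: set_lebesgue_integral_def)
  finally show "\<bar>A\<bar> \<le> (Q + L) * R * (b - a)" .
qed

end

section \<open>The occupation estimate\<close>

text \<open>The indices satisfying \<open>d\<close> form an initial stretch, so the terms that are
  kept telescope up to its end.\<close>

lemma telescope_until_exit:
  fixes u :: "nat \<Rightarrow> real" and d :: "nat \<Rightarrow> bool"
  assumes "\<And>k. d (Suc k) \<Longrightarrow> d k"
  obtains K where "K \<le> m" "d K \<or> K = 0" "(\<Sum>k<m. if d (Suc k) then u (Suc k) - u k else 0) = u K - u 0"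
proof -
  \<comment> \<open>The last conjunct, that \<open>K = m\<close> as long as there is no exit, allows
    the telescoped sum to be extended by one term.\<close>
  have "\<exists>K\<le>m. (d K \<or> K = 0) \<and> (\<Sum>k<m. if d (Suc k) then u (Suc k) - u k else 0) = u K - u 0 \<and> (d m \<longrightarrow> K = m)"
  proof (induction m)
    case (Suc m)
    then obtain K where K: "K \<le> m" "d K \<or> K = 0"
      "(\<Sum>k<m. if d (Suc k) then u (Suc k) - u k else 0) = u K - u 0" "d m \<longrightarrow> K = m" by blast
    show ?case
    proof (cases "d (Suc m)")
      case True
      then have "K = m" using assms K by blast
      then show ?thesis using K True by (intro exI[of _ "Suc m"]) simp
    next
      case False
      then show ?thesis using K by (intro exI[of _ K]) simp
    qed
  qed simp
  then show ?thesis using that by blast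
qed

lemma sum_block_integrals:
  fixes g :: "real \<Rightarrow> real"
  assumes h: "0 \<le> h" and g: "set_integrable lborel {0..h * real n} g"
  shows "(\<Sum>k<n. LINT s:{h * real k..h * real (Suc k)}|lborel. g s) = (LINT s:{0..h * real n}|lborel. g s)"
  using g
proof (induction n)
  case 0
  have "(LINT s:{0..0::real}|lborel. g s) = 0"
    unfolding set_lebesgue_integral_def by (rule integral_eq_zero_AE, use AE_lborel_singleton[of 0] in eventually_elim) auto
  then show ?case by simp
next
  case (Suc n)
  have le: "0 \<le> h * real n" "h * real n \<le> h * real (Suc n)" using h by (auto intro!: mult_left_mono)
  have i1: "set_integrable lborel {0..h * real n} g"
    by (rule set_integrable_subset[OF Suc.prems]) (use le in auto)
  have i2: "set_integrable lborel {h * real n..h * real (Suc n)} g"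
    by (rule set_integrable_subset[OF Suc.prems]) (use le in auto)
  have "(LINT s:{0..h * real n} \<union> {h * real n..h * real (Suc n)}|lborel. g s)
      = (LINT s:{0..h * real n}|lborel. g s) + (LINT s:{h * real n..h * real (Suc n)}|lborel. g s)"
  proof (rule set_integral_Un_AE[OF _ _ _ i1 i2])
    show "AE s in lborel. \<not> (s \<in> {0..h * real n} \<and> s \<in> {h * real n..h * real (Suc n)})"
      using AE_lborel_singleton[of "h * real n"] by eventually_elim auto
  qed auto
  moreover have "{0..h * real n} \<union> {h * real n..h * real (Suc n)} = {0..h * real (Suc n)}"
    by (rule ivl_disj_un_two_touch(4)) (use le in auto)
  ultimately show ?case using Suc.IH[OF i1] by simp
qed

lemma set_integral_le_const:
  fixes g :: "real \<Rightarrow> real"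
  assumes "set_integrable lborel {a..b} g" "a \<le> b" "\<And>s. a \<le> s \<Longrightarrow> s \<le> b \<Longrightarrow> g s \<le> K"
  shows "(LINT s:{a..b}|lborel. g s) \<le> K * (b - a)"
proof -
  have "(LINT s:{a..b}|lborel. g s) \<le> (LINT s:{a..b}|lborel. K)"
    by (rule set_integral_mono[OF assms(1)]) (use assms in \<open>auto simp: set_integrable_def\<close>)
  then show ?thesis using assms(2) by (simp add: set_lebesgue_integral_def mult.commute)
qed

lemma set_integral_nonneg':
  fixes g :: "real \<Rightarrow> real"
  assumes "\<And>s. 0 \<le> g s"
  shows "0 \<le> (LINT s:A|lborel. g s)"
  unfolding set_lebesgue_integral_def using assms by (intro integral_nonneg_AE) auto

section \<open>Summing the one-step inequality over sites and time steps\<close>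

context lattice_system
begin

lemma space_prob: "prob_space M"
  using brownians unfolding filtered_brownian_def by blast

text \<open>This set carries the pathwise bounds, while \<open>mass_event\<close> carries the
  measurability: \<open>\<Omega>\<close> belongs to \<open>M\<close> only, so \<open>ev R t\<close>
  need not be known at time \<open>t\<close>.\<close>

definition ev :: "real \<Rightarrow> real \<Rightarrow> 'a set" where
  "ev R t = mass_event R t \<inter> \<Omega>"

lemma ev_sets: "0 \<le> t \<Longrightarrow> ev R t \<in> sets M"
  using mass_event_M Om by (simp add: ev_def)

lemma ev_antimono: "s \<le> t \<Longrightarrow> ev R t \<subseteq> ev R s"
  using mass_event_antimono by (auto simp: ev_def)

lemma ev_X: "\<omega> \<in> ev R t \<Longrightarrow> 0 \<le> s \<Longrightarrow> s \<le> t \<Longrightarrow> 0 \<le> X s \<omega> i \<and> X s \<omega> i \<le> R"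
  using X_le nonneg Om_space by (auto simp: ev_def)

text \<open>A single constant for everything bounded in terms of the mass level \<open>R\<close>:
  coordinates, drift and squared noise coefficient.\<close>

definition admissible :: "real \<Rightarrow> real \<Rightarrow> bool" where
  "admissible R c \<longleftrightarrow> 0 \<le> R \<and> 1 \<le> c \<and> R \<le> c \<and> (Q + L) * R \<le> c \<and> (\<forall>x\<in>{0..R}. (\<sigma> x)\<^sup>2 \<le> c)"

lemma admissible_exists:
  assumes "0 \<le> R"
  obtains c where "admissible R c"
proof -
  have "compact ((\<lambda>x. (\<sigma> x)\<^sup>2) ` {0..R})"
    by (intro compact_continuous_image continuous_on_power continuous_on_subset[OF sigma_cont]) auto
  then obtain S where S: "\<forall>x\<in>{0..R}. \<bar>(\<sigma> x)\<^sup>2\<bar> \<le> S"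
    using compact_imp_bounded bounded_iff by (metis (no_types, lifting) imageI real_norm_def)
  define c where "c = max (max 1 R) (max ((Q + L) * R) S)"
  have "1 \<le> c" "R \<le> c" "(Q + L) * R \<le> c" "S \<le> c" unfolding c_def by linarith+
  then have "admissible R c" using S assms unfolding admissible_def by fastforce
  then show ?thesis by (rule that)
qed

lemma wint_bounds:
  assumes "\<omega> \<in> ev R b" "0 \<le> a" "a \<le> b"
  shows "0 \<le> wint i a b \<omega>" "wint i a b \<omega> \<le> R * (b - a)"
proof -
  have w: "\<omega> \<in> \<Omega>" using assms by (simp add: ev_def)
  show "0 \<le> wint i a b \<omega>" unfolding wint_def by (rule set_integral_nonneg'[OF W_nonneg])
  show "wint i a b \<omega> \<le> R * (b - a)" unfolding wint_def
    by (rule set_integral_le_const[OF path_integrable(1)[OF w assms(2)] assms(3)])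
      (use ev_X[OF assms(1)] assms w in \<open>auto simp: W_def\<close>)
qed

lemma vint_bounds:
  assumes "\<omega> \<in> ev R b" "0 \<le> a" "a \<le> b" "admissible R c"
  shows "0 \<le> vint i a b \<omega>" "vint i a b \<omega> \<le> c * (b - a)"
    "(\<integral>\<^sup>+ s\<in>{a..b}. ennreal ((\<sigma> (X s \<omega> i))\<^sup>2) \<partial>lborel) = ennreal (vint i a b \<omega>)"
    "(\<lambda>s. indicator {a..b} s * \<sigma> (X s \<omega> i)) \<in> borel_measurable borel"
proof -
  have w: "\<omega> \<in> \<Omega>" using assms by (simp add: ev_def)
  note int = path_integrable(2)[OF w assms(2), of b i]
  show "0 \<le> vint i a b \<omega>" unfolding vint_def by (rule set_integral_nonneg') simp
  show "vint i a b \<omega> \<le> c * (b - a)" unfolding vint_def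
    by (rule set_integral_le_const[OF int assms(3)])
      (use ev_X[OF assms(1), of _ i] assms w in \<open>auto simp: W_def admissible_def\<close>)
  have WX: "W i s \<omega> = X s \<omega> i" if "s \<in> {a..b}" for s using that assms w by (simp add: W_def)
  have "(\<integral>\<^sup>+ s\<in>{a..b}. ennreal ((\<sigma> (X s \<omega> i))\<^sup>2) \<partial>lborel) = (\<integral>\<^sup>+ s. ennreal (indicator {a..b} s *\<^sub>R (\<sigma> (W i s \<omega>))\<^sup>2) \<partial>lborel)"
    using WX by (intro nn_integral_cong) (auto simp: indicator_def)
  also have "\<dots> = ennreal (vint i a b \<omega>)"
    unfolding vint_def set_lebesgue_integral_def
    by (rule nn_integral_eq_integral) (use int in \<open>auto simp: set_integrable_def\<close>)
  finally show "(\<integral>\<^sup>+ s\<in>{a..b}. ennreal ((\<sigma> (X s \<omega> i))\<^sup>2) \<partial>lborel) = ennreal (vint i a b \<omega>)" .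
  have "(\<lambda>s. indicator {a..b} s *\<^sub>R \<sigma> (W i s \<omega>)) \<in> borel_measurable borel"
    by (rule borel_measurable_continuous_on_indicator[OF _ sigma_W_cont[OF w assms(2)]]) simp
  moreover have "(\<lambda>s. indicator {a..b} s *\<^sub>R \<sigma> (W i s \<omega>)) = (\<lambda>s. indicator {a..b} s * \<sigma> (X s \<omega> i))"
    using WX by (auto simp: indicator_def)
  ultimately show "(\<lambda>s. indicator {a..b} s * \<sigma> (X s \<omega> i)) \<in> borel_measurable borel" by simp
qed

text \<open>This is \<open>block_inequality\<close> at one site with the drift replaced by its lower
  bound. The slope \<open>1 - exp (- l * X a \<omega> i)\<close> lies in \<open>[0, 1]\<close>, so
  multiplying by it only weakens a nonpositive contribution, and no \<open>l\<close> enters the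
  coefficient of \<open>Wk\<close>.\<close>

lemma site_block:
  fixes i :: "int ^ 'd"
  assumes adm: "admissible R c" and ab: "0 \<le> a" "b = a + s\<^sup>2" and s: "0 < s" "s \<le> 1"
    and l: "1 \<le> l" and d: "0 < \<delta>" "\<delta> \<le> 1" "s\<^sup>2 \<le> \<delta>"
  defines "Vk \<equiv> \<lambda>\<omega>. indicator (ev R b) \<omega> * (l * exp (- l * X a \<omega> i) * vint i a b \<omega>)"
    and "Wk \<equiv> \<lambda>\<omega>. indicator (ev R b) \<omega> * wint i a b \<omega>"
    and "Fk \<equiv> \<lambda>\<omega>. indicator (ev R b) \<omega> * (test_fun l (X b \<omega> i) - test_fun l (X a \<omega> i))"
  shows "integrable M Vk" "integrable M Wk" "integrable M Fk"
    "integral\<^sup>L M Vk / 4 \<le> integral\<^sup>L M Fk + (Q + L) * integral\<^sup>L M Wk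
      + 11000 * l\<^sup>2 * c ^ 6 * (s ^ 3 / \<delta>\<^sup>2 + \<delta> * measure M (ev R a - ev R b))"
proof -
  interpret fb: filtered_brownian M F "B i" by (rule brownians)
  have alb: "a \<le> b" and b0: "0 \<le> b" and bas: "b - a = s\<^sup>2" using ab by auto
  have c: "1 \<le> c" "0 \<le> R" "R \<le> c" "(Q + L) * R \<le> c" using adm by (auto simp: admissible_def)
  have s2: "s\<^sup>2 \<le> 1" using s by (simp add: power_le_one)
  have QL: "0 \<le> Q + L" using Q_nonneg L_nonneg by simp
  note [measurable] = int_measurable X_measurable[OF ab(1)] X_measurable[OF b0] ev_sets[OF b0] ev_sets[OF ab(1)] Om
  have [measurable]: "I i a \<in> borel_measurable M" "I i b \<in> borel_measurable M"
    using ito[of i] ab b0 by (auto simp: is_ito_integral_def)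
  have tf [measurable]: "test_fun l \<in> borel_measurable borel" unfolding test_fun_def[abs_def] by measurable
  have Xa: "0 \<le> X a \<omega> i" "X a \<omega> i \<le> R" and Xb: "0 \<le> X b \<omega> i" "X b \<omega> i \<le> R" if "\<omega> \<in> ev R b" for \<omega>
    using ev_X[OF that, of a i] ev_X[OF that, of b i] ab alb b0 by auto
  have el: "l * exp (- l * X a \<omega> i) \<le> l" if "\<omega> \<in> ev R b" for \<omega>
    using Xa[OF that] l by (simp add: mult_left_le)
  have vb: "0 \<le> vint i a b \<omega>" "vint i a b \<omega> \<le> c * s\<^sup>2" "vint i a b \<omega> \<le> c" if "\<omega> \<in> ev R b" for \<omega>
  proof -
    show 1: "0 \<le> vint i a b \<omega>" "vint i a b \<omega> \<le> c * s\<^sup>2" using vint_bounds[OF that ab(1) alb adm] bas by auto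
    have "c * s\<^sup>2 \<le> c * 1" using c s2 by (intro mult_left_mono) auto
    then show "vint i a b \<omega> \<le> c" using 1 by simp
  qed
  have wb: "0 \<le> wint i a b \<omega>" "wint i a b \<omega> \<le> R" if "\<omega> \<in> ev R b" for \<omega>
  proof -
    show 1: "0 \<le> wint i a b \<omega>" using wint_bounds[OF that ab(1) alb] by simp
    have "R * s\<^sup>2 \<le> R * 1" using c s2 by (intro mult_left_mono) auto
    then show "wint i a b \<omega> \<le> R" using wint_bounds(2)[OF that ab(1) alb, of i] bas by simp
  qed
  show iV: "integrable M Vk"
  proof (rule fb.integrable_const_bound[of _ "l * c"])
    show "AE \<omega> in M. norm (Vk \<omega>) \<le> l * c"
    proof (rule AE_I2)
      fix \<omega>
      show "norm (Vk \<omega>) \<le> l * c"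
      proof (cases "\<omega> \<in> ev R b")
        case True
        have "l * exp (- l * X a \<omega> i) * vint i a b \<omega> \<le> l * c"
          using el[OF True] vb[OF True] l by (intro mult_mono) auto
        then show ?thesis using True vb[OF True] l by (simp add: Vk_def)
      qed (use l c in \<open>simp add: Vk_def\<close>)
    qed
    show "Vk \<in> borel_measurable M" unfolding Vk_def by measurable
  qed
  show iW: "integrable M Wk"
  proof (rule fb.integrable_const_bound[of _ R])
    show "AE \<omega> in M. norm (Wk \<omega>) \<le> R"
      using wb c by (intro AE_I2) (auto simp: Wk_def indicator_def)
    show "Wk \<in> borel_measurable M" unfolding Wk_def by measurable
  qed
  show iF: "integrable M Fk"
  proof (rule fb.integrable_const_bound[of _ R])
    have "\<bar>Fk \<omega>\<bar> \<le> R" for \<omega>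
    proof (cases "\<omega> \<in> ev R b")
      case True
      have "0 \<le> test_fun l (X a \<omega> i)" "test_fun l (X a \<omega> i) \<le> R" "0 \<le> test_fun l (X b \<omega> i)" "test_fun l (X b \<omega> i) \<le> R"
        using test_fun_nonneg[OF l] test_fun_le[OF l] Xa[OF True] Xb[OF True] by (auto intro: order_trans)
      then show ?thesis using True by (simp add: Fk_def)
    qed (use c in \<open>simp add: Fk_def\<close>)
    then show "AE \<omega> in M. norm (Fk \<omega>) \<le> R" by simp
    show "Fk \<in> borel_measurable M" unfolding Fk_def by measurable
  qed
  \<comment> \<open>\<open>ev R a\<close> need not be in \<open>F a\<close> because of
    \<open>\<Omega>\<close>. The set \<open>D\<close> is, and it agrees with \<open>ev R a\<close>
    almost surely; the bounds on the coordinate are built in because they are required at every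
    point of \<open>D\<close>.\<close>
  define D where "D = {\<omega> \<in> mass_event R a. 0 \<le> X a \<omega> i \<and> X a \<omega> i \<le> R}"
  have D: "D \<in> sets (F a)"
  proof -
    have [measurable]: "(\<lambda>\<omega>. X a \<omega> i) \<in> borel_measurable (F a)" by (rule X_adapted[OF ab(1)])
    have "D = mass_event R a \<inter> {\<omega> \<in> space (F a). 0 \<le> X a \<omega> i \<and> X a \<omega> i \<le> R}"
      using fb.space_F[OF ab(1)] by (auto simp: D_def mass_event_def)
    moreover have "{\<omega> \<in> space (F a). 0 \<le> X a \<omega> i \<and> X a \<omega> i \<le> R} \<in> sets (F a)" by measurable
    ultimately show ?thesis using mass_event_sets[OF ab(1)] by simp
  qed
  have DM [measurable]: "D \<in> sets M" using D fb.subalg[OF ab(1)] by (auto simp: subalgebra_def)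
  have GD: "ev R b \<subseteq> D"
    using Xa mass_event_antimono[OF alb, of R] by (auto simp: D_def ev_def)
  define A where "A = (\<lambda>\<omega>. X b \<omega> i - X a \<omega> i - (I i b \<omega> - I i a \<omega>))"
  have Ab: "\<bar>A \<omega>\<bar> \<le> c * s\<^sup>2" "- ((Q + L) * wint i a b \<omega>) \<le> A \<omega>" if "\<omega> \<in> ev R b" for \<omega>
  proof -
    have w: "\<omega> \<in> \<Omega>" "\<omega> \<in> mass_event R b" using that by (auto simp: ev_def)
    have "(Q + L) * R * s\<^sup>2 \<le> c * s\<^sup>2" using c by (intro mult_right_mono) auto
    then show "\<bar>A \<omega>\<bar> \<le> c * s\<^sup>2" "- ((Q + L) * wint i a b \<omega>) \<le> A \<omega>"
      using drift_increment[OF w ab(1) alb, of i] bas by (auto simp: A_def)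
  qed
  let ?err = "11000 * l\<^sup>2 * c ^ 6 * (s ^ 3 / \<delta>\<^sup>2 + \<delta> * measure M (D - ev R b))"
  let ?G = "\<lambda>\<omega>. indicator (ev R b) \<omega> * ((1 - exp (- l * X a \<omega> i)) * (X b \<omega> i - X a \<omega> i - (I i b \<omega> - I i a \<omega>))
        + l * exp (- l * X a \<omega> i) / 4 * vint i a b \<omega>)"
  have main: "integral\<^sup>L M ?G - ?err \<le> integral\<^sup>L M Fk"
    unfolding Fk_def
  proof (rule fb.block_inequality[OF ito ab c(1) l s d D ev_sets[OF b0] GD X_adapted[OF ab(1)]])
    show "(\<lambda>\<omega>. X b \<omega> i) \<in> borel_measurable M" "vint i a b \<in> borel_measurable M" by measurable
    show "0 \<le> X a \<omega> i \<and> X a \<omega> i \<le> c" if "\<omega> \<in> D" for \<omega> using that c by (auto simp: D_def)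
    show "AE \<omega> in M. \<omega> \<in> ev R b \<longrightarrow> 0 \<le> X b \<omega> i \<and> X b \<omega> i \<le> c \<and>
        \<bar>X b \<omega> i - X a \<omega> i - (I i b \<omega> - I i a \<omega>)\<bar> \<le> c * s\<^sup>2 \<and>
        (\<lambda>s. indicator {a..b} s * \<sigma> (X s \<omega> i)) \<in> borel_measurable borel \<and>
        (\<integral>\<^sup>+ s\<in>{a..b}. ennreal ((\<sigma> (X s \<omega> i))\<^sup>2) \<partial>lborel) = ennreal (vint i a b \<omega>) \<and>
        0 \<le> vint i a b \<omega> \<and> vint i a b \<omega> \<le> c * s\<^sup>2" (is "AE \<omega> in M. _ \<longrightarrow> ?P \<omega>")
    proof (rule AE_I2, rule impI)
      fix \<omega> assume w: "\<omega> \<in> ev R b"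
      show "?P \<omega>"
        using Xb[OF w] c(3) Ab(1)[OF w] vint_bounds(3,4)[OF w ab(1) alb adm, of i] vb[OF w]
        unfolding A_def by (intro conjI) linarith+
    qed
  qed
  have "integral\<^sup>L M (\<lambda>\<omega>. Vk \<omega> / 4 - (Q + L) * Wk \<omega>) \<le> integral\<^sup>L M ?G"
  proof (rule integral_mono)
    show "integrable M (\<lambda>\<omega>. Vk \<omega> / 4 - (Q + L) * Wk \<omega>)" using iV iW by simp
    fix \<omega>
    show "Vk \<omega> / 4 - (Q + L) * Wk \<omega> \<le> ?G \<omega>"
    proof (cases "\<omega> \<in> ev R b")
      case True
      have p: "0 \<le> 1 - exp (- l * X a \<omega> i)" "1 - exp (- l * X a \<omega> i) \<le> 1" using l Xa[OF True] by auto
      have qw: "0 \<le> (Q + L) * wint i a b \<omega>" using QL wb[OF True] by simp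
      have "- ((Q + L) * wint i a b \<omega>) \<le> (1 - exp (- l * X a \<omega> i)) * - ((Q + L) * wint i a b \<omega>)"
        using mult_right_mono[OF p(2) qw] by simp
      also have "\<dots> \<le> (1 - exp (- l * X a \<omega> i)) * A \<omega>" by (rule mult_left_mono[OF Ab(2)[OF True] p(1)])
      finally show ?thesis using True by (simp add: Vk_def Wk_def A_def)
    qed (simp add: Vk_def Wk_def)
  next
    show "integrable M ?G"
    proof (rule fb.integrable_const_bound[of _ "c + l * c"])
      show "AE \<omega> in M. norm (?G \<omega>) \<le> c + l * c"
      proof (rule AE_I2)
        fix \<omega>
        show "norm (?G \<omega>) \<le> c + l * c"
        proof (cases "\<omega> \<in> ev R b")
          case True
          have cs: "c * s\<^sup>2 \<le> c" using c s2 by (simp add: mult_left_le)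
          have "\<bar>(1 - exp (- l * X a \<omega> i))\<bar> * \<bar>A \<omega>\<bar> \<le> 1 * c"
            using l Xa[OF True] Ab(1)[OF True] cs by (intro mult_mono) auto
          then have 1: "\<bar>(1 - exp (- l * X a \<omega> i)) * A \<omega>\<bar> \<le> c" by (simp add: abs_mult)
          have "l * exp (- l * X a \<omega> i) * vint i a b \<omega> \<le> l * c"
            using el[OF True] vb[OF True] l by (intro mult_mono) auto
          moreover have "0 \<le> l * exp (- l * X a \<omega> i) * vint i a b \<omega>" using vb[OF True] l by simp
          ultimately show ?thesis using 1 True by (simp add: A_def)
        qed (use l c in simp)
      qed
    qed measurable
  qed
  then have "integral\<^sup>L M Vk / 4 - (Q + L) * integral\<^sup>L M Wk \<le> integral\<^sup>L M ?G"
    using iV iW by simp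
  moreover have "measure M (D - ev R b) \<le> measure M (ev R a - ev R b)"
  proof (rule fb.finite_measure_mono_AE)
    show "AE \<omega> in M. \<omega> \<in> D - ev R b \<longrightarrow> \<omega> \<in> ev R a - ev R b"
      using AE_Om by eventually_elim (auto simp: D_def ev_def)
  qed simp
  then have "?err \<le> 11000 * l\<^sup>2 * c ^ 6 * (s ^ 3 / \<delta>\<^sup>2 + \<delta> * measure M (ev R a - ev R b))"
    using d c by (intro mult_left_mono add_left_mono) auto
  ultimately show "integral\<^sup>L M Vk / 4 \<le> integral\<^sup>L M Fk + (Q + L) * integral\<^sup>L M Wk
      + 11000 * l\<^sup>2 * c ^ 6 * (s ^ 3 / \<delta>\<^sup>2 + \<delta> * measure M (ev R a - ev R b))"
    using main by linarith
qed

text \<open>The exponential is frozen at the left end of the step, as in the Taylor expansion,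
  whereas the event is read at the right end.\<close>

definition grid_term :: "real \<Rightarrow> real \<Rightarrow> real \<Rightarrow> (int ^ 'd) \<Rightarrow> nat \<Rightarrow> 'a \<Rightarrow> real" where
  "grid_term R l h i k \<omega> = indicator (ev R (h * real (Suc k))) \<omega> *
     (l * exp (- l * X (h * real k) \<omega> i) * vint i (h * real k) (h * real (Suc k)) \<omega>)"

lemma grid_term_measurable [measurable]:
  "0 \<le> h \<Longrightarrow> grid_term R l h i k \<in> borel_measurable M"
proof -
  assume h: "0 \<le> h"
  have [measurable]: "(\<lambda>\<omega>. X (h * real k) \<omega> i) \<in> borel_measurable M" "ev R (h * real (Suc k)) \<in> sets M"
    using X_measurable ev_sets h by auto
  note [measurable] = int_measurable
  show ?thesis unfolding grid_term_def[abs_def] by measurable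
qed

text \<open>The sum over sites is taken inside the time integral, where the total mass is at most
  \<open>R\<close> irrespective of the number of sites.\<close>

lemma sum_wint_le:
  assumes w: "\<omega> \<in> ev R b" and ab: "0 \<le> a" "a \<le> b" and A: "finite A"
  shows "(\<Sum>i\<in>A. wint i a b \<omega>) \<le> R * (b - a)"
proof -
  have wO: "\<omega> \<in> \<Omega>" "\<omega> \<in> mass_event R b" using w by (auto simp: ev_def)
  have int: "integrable lborel (\<lambda>s. indicator {a..b} s *\<^sub>R W i s \<omega>)" for i
    using path_integrable(1)[OF wO(1) ab(1), of b i] by (simp add: set_integrable_def)
  have "(\<Sum>i\<in>A. wint i a b \<omega>) = (LINT s:{a..b}|lborel. \<Sum>i\<in>A. W i s \<omega>)"
    unfolding wint_def set_lebesgue_integral_def scaleR_sum_right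
    by (rule Bochner_Integration.integral_sum[symmetric]) (rule int)
  also have "\<dots> \<le> R * (b - a)"
  proof (rule set_integral_le_const[OF _ ab(2)])
    show "set_integrable lborel {a..b} (\<lambda>s. \<Sum>i\<in>A. W i s \<omega>)"
      unfolding set_integrable_def scaleR_sum_right by (rule Bochner_Integration.integrable_sum) (rule int)
    fix s assume s: "a \<le> s" "s \<le> b"
    then have "(\<Sum>i\<in>A. W i s \<omega>) = (\<Sum>i\<in>A. X s \<omega> i)" using ab wO by (simp add: W_def)
    also have "\<dots> \<le> R" by (rule mass_le[OF wO _ s(2) A]) (use s ab in simp)
    finally show "(\<Sum>i\<in>A. W i s \<omega>) \<le> R" .
  qed
  finally show ?thesis .
qed

text \<open>The time step is \<open>\<rho>\<^sup>8\<close> so that \<open>site_block\<close> applies with \<open>s = \<rho>\<^sup>4\<close> and \<open>\<delta> = \<rho>\<close>, and the accumulated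
  error still vanishes with \<open>\<rho>\<close>.\<close>

lemma grid_occupation:
  fixes A :: "(int ^ 'd) set" and m :: nat
  assumes adm: "admissible R c" and rho: "0 < \<rho>" "\<rho> \<le> 1" and l: "1 \<le> l" and A: "finite A"
  defines "h \<equiv> \<rho> ^ 8"
  defines "T \<equiv> h * real m"
  shows "integrable M (\<lambda>\<omega>. \<Sum>i\<in>A. \<Sum>k<m. grid_term R l h i k \<omega>)"
    "integral\<^sup>L M (\<lambda>\<omega>. \<Sum>i\<in>A. \<Sum>k<m. grid_term R l h i k \<omega>)
     \<le> 4 * (R + (Q + L) * R * T) + real (card A) * (44000 * l\<^sup>2 * c ^ 6 * (T * \<rho>\<^sup>2 + \<rho>))"
proof -
  interpret prob_space M by (rule space_prob)
  have R0: "0 \<le> R" and c: "1 \<le> c" using adm by (auto simp: admissible_def)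
  have h: "0 < h" using rho by (simp add: h_def)
  define t where "t = (\<lambda>k. h * real k)"
  have t0: "0 \<le> t k" for k using h by (simp add: t_def)
  have tS: "t (Suc k) = t k + (\<rho> ^ 4)\<^sup>2" for k by (simp add: t_def h_def algebra_simps power_mult[symmetric])
  have tmono: "t k \<le> t (Suc k)" for k using h by (simp add: t_def)
  have s: "0 < \<rho> ^ 4" "\<rho> ^ 4 \<le> 1" using rho by (auto simp: power_le_one)
  have d: "(\<rho> ^ 4)\<^sup>2 \<le> \<rho>" using power_decreasing[of 1 8 \<rho>] rho by (simp add: power_mult[symmetric])
  define Fk where "Fk = (\<lambda>i k \<omega>. indicator (ev R (t (Suc k))) \<omega> * (test_fun l (X (t (Suc k)) \<omega> i) - test_fun l (X (t k) \<omega> i)))"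
  define Wk where "Wk = (\<lambda>i k \<omega>. indicator (ev R (t (Suc k))) \<omega> * wint i (t k) (t (Suc k)) \<omega>)"
  define Vk where "Vk = (\<lambda>i k \<omega>. indicator (ev R (t (Suc k))) \<omega> * (l * exp (- l * X (t k) \<omega> i) * vint i (t k) (t (Suc k)) \<omega>))"
  have Vg: "Vk i k = grid_term R l h i k" for i k by (simp add: Vk_def grid_term_def[abs_def] t_def)
  define E where "E = 11000 * l\<^sup>2 * c ^ 6"
  have E0: "0 \<le> E" using c by (simp add: E_def)
  define p where "p = (\<lambda>k. measure M (ev R (t k) - ev R (t (Suc k))))"
  note blk = site_block[OF adm t0 tS s l rho d]
  have iV: "integrable M (Vk i k)" and iW: "integrable M (Wk i k)" and iF: "integrable M (Fk i k)" for i k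
    unfolding Vk_def Wk_def Fk_def by (rule blk)+
  have b4: "integral\<^sup>L M (Vk i k) / 4 \<le> integral\<^sup>L M (Fk i k) + (Q + L) * integral\<^sup>L M (Wk i k) + E * (\<rho> ^ 10 + \<rho> * p k)" for i k
  proof -
    \<comment> \<open>Over \<open>m = T / \<rho> ^ 8\<close> steps the error
      \<open>\<rho> ^ 10\<close> accumulates to \<open>T * \<rho>\<^sup>2\<close>.\<close>
    have "(\<rho> ^ 4) ^ 3 / \<rho>\<^sup>2 = \<rho> ^ 10" using rho by (simp add: power_mult[symmetric] power_diff[symmetric])
    then show ?thesis using blk(4)[of k i] by (simp add: Vk_def Wk_def Fk_def E_def p_def)
  qed
  show int: "integrable M (\<lambda>\<omega>. \<Sum>i\<in>A. \<Sum>k<m. grid_term R l h i k \<omega>)"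
    unfolding Vg[symmetric] by (intro Bochner_Integration.integrable_sum iV)
  have sumF: "(\<Sum>i\<in>A. \<Sum>k<m. integral\<^sup>L M (Fk i k)) \<le> R"
  proof -
    have "(\<Sum>i\<in>A. \<Sum>k<m. integral\<^sup>L M (Fk i k)) = integral\<^sup>L M (\<lambda>\<omega>. \<Sum>i\<in>A. \<Sum>k<m. Fk i k \<omega>)"
      using iF by (simp add: Bochner_Integration.integral_sum)
    also have "\<dots> \<le> integral\<^sup>L M (\<lambda>\<omega>. R)"
    proof (rule integral_mono)
      show "integrable M (\<lambda>\<omega>. \<Sum>i\<in>A. \<Sum>k<m. Fk i k \<omega>)" by (intro Bochner_Integration.integrable_sum iF)
      fix \<omega>
      \<comment> \<open>Summed over sites, the increments telescope along the grid until the mass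
        level is exceeded; the final value is at most the mass and the initial one is
        nonnegative.\<close>
      define u where "u = (\<lambda>k. \<Sum>i\<in>A. test_fun l (X (t k) \<omega> i))"
      obtain K where K: "K \<le> m" "\<omega> \<in> ev R (t K) \<or> K = 0"
        "(\<Sum>k<m. if \<omega> \<in> ev R (t (Suc k)) then u (Suc k) - u k else 0) = u K - u 0"
        using telescope_until_exit[of "\<lambda>k. \<omega> \<in> ev R (t k)" m u] ev_antimono[OF tmono] by blast
      have "(\<Sum>i\<in>A. \<Sum>k<m. Fk i k \<omega>) = (\<Sum>k<m. \<Sum>i\<in>A. Fk i k \<omega>)" by (rule sum.swap)
      also have "\<dots> = (\<Sum>k<m. if \<omega> \<in> ev R (t (Suc k)) then u (Suc k) - u k else 0)"
        by (intro sum.cong) (auto simp: Fk_def u_def sum_subtractf)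
      also have "\<dots> = u K - u 0" by (rule K(3))
      also have "\<dots> \<le> R"
      proof (cases "K = 0")
        case False
        then have w: "\<omega> \<in> ev R (t K)" using K by blast
        have "u K \<le> (\<Sum>i\<in>A. X (t K) \<omega> i)"
          unfolding u_def by (intro sum_mono test_fun_le[OF l]) (use ev_X[OF w t0] in auto)
        also have "\<dots> \<le> R" using w by (intro mass_le[OF _ _ t0 order_refl A]) (auto simp: ev_def)
        finally have "u K \<le> R" .
        moreover have "0 \<le> u 0" unfolding u_def by (intro sum_nonneg test_fun_nonneg[OF l])
        ultimately show ?thesis by simp
      qed (use R0 in simp)
      finally show "(\<Sum>i\<in>A. \<Sum>k<m. Fk i k \<omega>) \<le> R" .
    qed simp
    also have "\<dots> = R" by (simp add: prob_space)
    finally show ?thesis .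
  qed
  have sumW: "(\<Sum>i\<in>A. \<Sum>k<m. integral\<^sup>L M (Wk i k)) \<le> R * T"
  proof -
    have "(\<Sum>i\<in>A. \<Sum>k<m. integral\<^sup>L M (Wk i k)) = integral\<^sup>L M (\<lambda>\<omega>. \<Sum>i\<in>A. \<Sum>k<m. Wk i k \<omega>)"
      using iW by (simp add: Bochner_Integration.integral_sum)
    also have "\<dots> \<le> integral\<^sup>L M (\<lambda>\<omega>. R * T)"
    proof (rule integral_mono)
      show "integrable M (\<lambda>\<omega>. \<Sum>i\<in>A. \<Sum>k<m. Wk i k \<omega>)" by (intro Bochner_Integration.integrable_sum iW)
      fix \<omega>
      have "(\<Sum>i\<in>A. \<Sum>k<m. Wk i k \<omega>) = (\<Sum>k<m. \<Sum>i\<in>A. Wk i k \<omega>)" by (rule sum.swap)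
      also have "\<dots> \<le> (\<Sum>k<m. R * h)"
      proof (rule sum_mono)
        fix k
        have hk: "t (Suc k) - t k = h" by (simp add: t_def algebra_simps)
        show "(\<Sum>i\<in>A. Wk i k \<omega>) \<le> R * h"
        proof (cases "\<omega> \<in> ev R (t (Suc k))")
          case True
          then have "(\<Sum>i\<in>A. Wk i k \<omega>) = (\<Sum>i\<in>A. wint i (t k) (t (Suc k)) \<omega>)" by (simp add: Wk_def)
          then show ?thesis using sum_wint_le[OF True t0[of k] tmono A] hk by simp
        qed (use R0 h in \<open>simp add: Wk_def\<close>)
      qed
      also have "\<dots> = R * T" by (simp add: T_def)
      finally show "(\<Sum>i\<in>A. \<Sum>k<m. Wk i k \<omega>) \<le> R * T" .
    qed simp
    also have "\<dots> = R * T" by (simp add: prob_space)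
    finally show ?thesis .
  qed
  \<comment> \<open>The exit probabilities telescope, so their sum does not grow with the number of
    steps and the factor \<open>\<rho>\<close> in front makes it negligible.\<close>
  have sump: "(\<Sum>k<m. p k) \<le> 1"
  proof -
    have "p k = measure M (ev R (t k)) - measure M (ev R (t (Suc k)))" for k
      unfolding p_def by (rule finite_measure_Diff) (use ev_sets t0 ev_antimono[OF tmono] in auto)
    then have "(\<Sum>k<m. p k) = measure M (ev R (t 0)) - measure M (ev R (t m))"
      using sum_lessThan_telescope'[of "\<lambda>k. measure M (ev R (t k))" m] by simp
    then show ?thesis using prob_le_1[of "ev R (t 0)"] measure_nonneg[of M "ev R (t m)"] by linarith
  qed
  have sumE: "(\<Sum>k<m. E * (\<rho> ^ 10 + \<rho> * p k)) \<le> E * (T * \<rho>\<^sup>2 + \<rho>)"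
  proof -
    have "(\<Sum>k<m. E * (\<rho> ^ 10 + \<rho> * p k)) = E * (real m * \<rho> ^ 10 + \<rho> * (\<Sum>k<m. p k))"
      by (simp add: sum_distrib_left[symmetric] sum.distrib)
    also have "real m * \<rho> ^ 10 = T * \<rho>\<^sup>2" by (simp add: T_def h_def power_add[symmetric])
    also have "E * (T * \<rho>\<^sup>2 + \<rho> * (\<Sum>k<m. p k)) \<le> E * (T * \<rho>\<^sup>2 + \<rho>)"
      using sump rho E0 by (intro mult_left_mono add_left_mono) (auto simp: mult_left_le)
    finally show ?thesis .
  qed
  have QL: "0 \<le> Q + L" using Q_nonneg L_nonneg by simp
  have quarter: "a / 4 \<le> r + x + z \<Longrightarrow> b = a \<Longrightarrow> y = 4 * z \<Longrightarrow> b \<le> 4 * (r + x) + y" for a b r x y z :: real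
    by simp
  have "(\<Sum>i\<in>A. \<Sum>k<m. integral\<^sup>L M (Vk i k) / 4)
     \<le> (\<Sum>i\<in>A. \<Sum>k<m. integral\<^sup>L M (Fk i k) + (Q + L) * integral\<^sup>L M (Wk i k) + E * (\<rho> ^ 10 + \<rho> * p k))"
    by (intro sum_mono b4)
  also have "\<dots> = (\<Sum>i\<in>A. \<Sum>k<m. integral\<^sup>L M (Fk i k)) + (Q + L) * (\<Sum>i\<in>A. \<Sum>k<m. integral\<^sup>L M (Wk i k))
       + real (card A) * (\<Sum>k<m. E * (\<rho> ^ 10 + \<rho> * p k))"
    by (simp add: sum.distrib sum_distrib_left)
  also have "\<dots> \<le> R + (Q + L) * (R * T) + real (card A) * (E * (T * \<rho>\<^sup>2 + \<rho>))"
    by (intro add_mono sumF mult_left_mono sumW sumE QL) simp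
  finally have "(\<Sum>i\<in>A. \<Sum>k<m. integral\<^sup>L M (Vk i k)) / 4 \<le> R + (Q + L) * (R * T) + real (card A) * (E * (T * \<rho>\<^sup>2 + \<rho>))"
    by (simp add: sum_divide_distrib)
  moreover have "integral\<^sup>L M (\<lambda>\<omega>. \<Sum>i\<in>A. \<Sum>k<m. grid_term R l h i k \<omega>) = (\<Sum>i\<in>A. \<Sum>k<m. integral\<^sup>L M (Vk i k))"
    unfolding Vg[symmetric] using iV by (simp add: Bochner_Integration.integral_sum)
  moreover have "real (card A) * (44000 * l\<^sup>2 * c ^ 6 * (T * \<rho>\<^sup>2 + \<rho>)) = 4 * (real (card A) * (E * (T * \<rho>\<^sup>2 + \<rho>)))"
    by (simp add: E_def)
  ultimately show "integral\<^sup>L M (\<lambda>\<omega>. \<Sum>i\<in>A. \<Sum>k<m. grid_term R l h i k \<omega>)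
     \<le> 4 * (R + (Q + L) * R * T) + real (card A) * (44000 * l\<^sup>2 * c ^ 6 * (T * \<rho>\<^sup>2 + \<rho>))"
    unfolding mult.assoc[of "Q + L" R T] by (rule quarter)
qed

section \<open>Passage to the limit in the grid\<close>

text \<open>The density of the Ito correction for \<open>test_fun l\<close>, without the factor
  1/2.\<close>

definition occ :: "real \<Rightarrow> (int ^ 'd) \<Rightarrow> real \<Rightarrow> 'a \<Rightarrow> real" where
  "occ l i s \<omega> = l * exp (- l * W i s \<omega>) * (\<sigma> (W i s \<omega>))\<^sup>2"

lemma occ_nonneg: "1 \<le> l \<Longrightarrow> 0 \<le> occ l i s \<omega>"
  by (simp add: occ_def)

lemma occ_integrable:
  assumes "\<omega> \<in> \<Omega>" "0 \<le> a"
  shows "set_integrable lborel {a..b} (\<lambda>s. occ l i s \<omega>)"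
  unfolding occ_def
  by (intro borel_integrable_atLeastAtMost' continuous_intros W_cont sigma_W_cont assms)

text \<open>On a fine grid the path moves by less than \<open>\<epsilon>\<close> within a step, so
  freezing the exponential costs at most the factor \<open>exp (l * \<epsilon>)\<close>. The mesh
  required depends on the path, hence the statement for all large \<open>n\<close>.\<close>

lemma grid_terms_lower_bound:
  assumes T: "0 < T" and w: "\<omega> \<in> ev R T" and l: "1 \<le> l" and e: "0 < \<epsilon>"
  shows "\<forall>\<^sub>F n in sequentially. (LINT s:{0..T}|lborel. occ l i s \<omega>)
    \<le> exp (l * \<epsilon>) * (\<Sum>k<Suc n. grid_term R l (T / real (Suc n)) i k \<omega>)"
proof -
  have wO: "\<omega> \<in> \<Omega>" using w by (simp add: ev_def)
  have "uniformly_continuous_on {0..T} (\<lambda>s. W i s \<omega>)"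
    by (intro compact_uniformly_continuous W_cont[OF wO]) auto
  then obtain d where d: "d > 0" "\<And>s u. s \<in> {0..T} \<Longrightarrow> u \<in> {0..T} \<Longrightarrow> dist u s < d \<Longrightarrow> dist (W i u \<omega>) (W i s \<omega>) < \<epsilon>"
    using e unfolding uniformly_continuous_on_def by metis
  have "(\<lambda>n. T * inverse (real (Suc n))) \<longlonglongrightarrow> T * 0"
    by (intro tendsto_mult tendsto_const LIMSEQ_inverse_real_of_nat)
  then have "\<forall>\<^sub>F n in sequentially. T / real (Suc n) < d"
    using d(1) by (intro order_tendstoD(2)[of _ 0]) (simp_all add: divide_inverse)
  then show ?thesis
  proof eventually_elim
    case (elim n)
    define h where "h = T / real (Suc n)"
    have h: "0 < h" "h < d" "h * real (Suc n) = T" using T elim by (auto simp: h_def)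
    have blk: "(LINT s:{h * real k..h * real (Suc k)}|lborel. occ l i s \<omega>) \<le> exp (l * \<epsilon>) * grid_term R l h i k \<omega>"
      if k: "k < Suc n" for k
    proof -
      define a b where "a = h * real k" and "b = h * real (Suc k)"
      have ab: "0 \<le> a" "a \<le> b" "b - a = h" using h by (auto simp: a_def b_def algebra_simps)
      have bT: "b \<le> T" unfolding b_def h(3)[symmetric] using k h by (intro mult_left_mono) auto
      have wb: "\<omega> \<in> ev R b" using w ev_antimono[OF bT] by blast
      have Wa: "W i a \<omega> = X a \<omega> i" using ab wO by (simp add: W_def)
      have i2: "set_integrable lborel {a..b} (\<lambda>s. (exp (l * \<epsilon>) * (l * exp (- l * X a \<omega> i))) * (\<sigma> (W i s \<omega>))\<^sup>2)"
        by (rule set_integrable_mult_right) (rule path_integrable(2)[OF wO ab(1)])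
      have "(LINT s:{a..b}|lborel. occ l i s \<omega>)
         \<le> (LINT s:{a..b}|lborel. (exp (l * \<epsilon>) * (l * exp (- l * X a \<omega> i))) * (\<sigma> (W i s \<omega>))\<^sup>2)"
      proof (rule set_integral_mono[OF occ_integrable[OF wO ab(1)] i2])
        fix s assume s: "s \<in> {a..b}"
        have "dist (W i a \<omega>) (W i s \<omega>) < \<epsilon>"
          by (rule d(2)) (use s ab bT h in \<open>auto simp: dist_real_def\<close>)
        then have "X a \<omega> i \<le> W i s \<omega> + \<epsilon>" by (simp add: Wa dist_real_def abs_less_iff)
        then have "l * X a \<omega> i \<le> l * (W i s \<omega> + \<epsilon>)" using l by (intro mult_left_mono) auto
        then have "exp (- l * W i s \<omega>) \<le> exp (l * \<epsilon> + - l * X a \<omega> i)" by (simp add: algebra_simps)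
        also have "\<dots> = exp (l * \<epsilon>) * exp (- l * X a \<omega> i)" by (rule exp_add)
        finally have "l * exp (- l * W i s \<omega>) \<le> exp (l * \<epsilon>) * (l * exp (- l * X a \<omega> i))"
          using l by (simp add: mult.left_commute)
        then show "occ l i s \<omega> \<le> (exp (l * \<epsilon>) * (l * exp (- l * X a \<omega> i))) * (\<sigma> (W i s \<omega>))\<^sup>2"
          unfolding occ_def by (rule mult_right_mono) simp
      qed
      also have "\<dots> = exp (l * \<epsilon>) * grid_term R l h i k \<omega>"
        using wb by (subst set_integral_mult_right) (simp add: grid_term_def vint_def a_def b_def)
      finally show ?thesis by (simp add: a_def b_def)
    qed
    have "(LINT s:{0..T}|lborel. occ l i s \<omega>) = (\<Sum>k<Suc n. LINT s:{h * real k..h * real (Suc k)}|lborel. occ l i s \<omega>)"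
      using sum_block_integrals[of h "Suc n" "\<lambda>s. occ l i s \<omega>"] occ_integrable[OF wO order_refl, of T l i] h by simp
    also have "\<dots> \<le> (\<Sum>k<Suc n. exp (l * \<epsilon>) * grid_term R l h i k \<omega>)" by (rule sum_mono) (rule blk, simp)
    also have "\<dots> = exp (l * \<epsilon>) * (\<Sum>k<Suc n. grid_term R l h i k \<omega>)" by (rule sum_distrib_left[symmetric])
    finally show ?case by (simp only: h_def)
  qed
qed

lemma grid_term_nonneg: "1 \<le> l \<Longrightarrow> 0 \<le> grid_term R l h i k \<omega>"
  unfolding grid_term_def vint_def by (intro mult_nonneg_nonneg set_integral_nonneg') auto

text \<open>Fatou's lemma is used along grids of mesh \<open>T / (n + 1)\<close>, as the pathwise
  comparison is not uniform. For fixed \<open>A\<close> the error of \<open>grid_occupation\<close>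
  tends to 0, and afterwards \<open>\<epsilon>\<close> does. The resulting bound is free of
  \<open>l\<close> and \<open>A\<close>, and the constant \<open>c\<close> has disappeared with the
  error.\<close>

lemma occupation_estimate:
  fixes A :: "(int ^ 'd) set"
  assumes T: "0 < T" and R: "0 \<le> R" and l: "1 \<le> l" and A: "finite A"
  shows "(\<integral>\<^sup>+ \<omega>. ennreal (indicator (ev R T) \<omega> * (\<Sum>i\<in>A. LINT s:{0..T}|lborel. occ l i s \<omega>)) \<partial>M)
    \<le> ennreal (4 * (R + (Q + L) * R * T))" (is "?J \<le> ennreal ?C")
proof -
  obtain c where adm: "admissible R c" using admissible_exists[OF R] .
  \<comment> \<open>\<open>grid_occupation\<close> takes its time step in the form
    \<open>\<rho> ^ 8\<close>; three square roots give the eighth root of the mesh.\<close>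
  define \<rho> where "\<rho> = (\<lambda>n. sqrt (sqrt (sqrt (T / real (Suc n)))))"
  have rho0: "0 < \<rho> n" for n using T by (simp add: \<rho>_def)
  have rho8: "\<rho> n ^ 8 = T / real (Suc n)" for n
  proof -
    have "\<rho> n ^ 8 = (((\<rho> n)\<^sup>2)\<^sup>2)\<^sup>2" by (simp add: power_mult[symmetric])
    also have "\<dots> = T / real (Suc n)" using T by (simp add: \<rho>_def)
    finally show ?thesis .
  qed
  have "(\<lambda>n. T * inverse (real (Suc n))) \<longlonglongrightarrow> T * 0"
    by (intro tendsto_mult tendsto_const LIMSEQ_inverse_real_of_nat)
  then have "(\<lambda>n. sqrt (sqrt (sqrt (T * inverse (real (Suc n)))))) \<longlonglongrightarrow> sqrt (sqrt (sqrt (T * 0)))"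
    by (intro tendsto_real_sqrt)
  then have rlim: "\<rho> \<longlonglongrightarrow> 0" by (simp add: \<rho>_def divide_inverse)
  define err where "err = (\<lambda>n. real (card A) * (44000 * l\<^sup>2 * c ^ 6 * (T * (\<rho> n)\<^sup>2 + \<rho> n)))"
  have "err \<longlonglongrightarrow> real (card A) * (44000 * l\<^sup>2 * c ^ 6 * (T * 0\<^sup>2 + 0))"
    unfolding err_def by (intro tendsto_intros rlim)
  then have elim: "err \<longlonglongrightarrow> 0" by simp
  define Y where "Y = (\<lambda>n \<omega>. \<Sum>i\<in>A. \<Sum>k<Suc n. grid_term R l (T / real (Suc n)) i k \<omega>)"
  have Ym [measurable]: "Y n \<in> borel_measurable M" for n
    unfolding Y_def using T by (intro borel_measurable_sum grid_term_measurable) auto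
  have Y0: "0 \<le> Y n \<omega>" for n \<omega> unfolding Y_def by (intro sum_nonneg grid_term_nonneg l)
  have bound: "?J \<le> ennreal (exp (l * \<epsilon>) * ?C)" if e: "0 < \<epsilon>" for \<epsilon>
  proof -
    have "?J \<le> (\<integral>\<^sup>+ \<omega>. liminf (\<lambda>n. ennreal (exp (l * \<epsilon>) * Y n \<omega>)) \<partial>M)"
    proof (rule nn_integral_mono)
      fix \<omega>
      show "ennreal (indicator (ev R T) \<omega> * (\<Sum>i\<in>A. LINT s:{0..T}|lborel. occ l i s \<omega>))
        \<le> liminf (\<lambda>n. ennreal (exp (l * \<epsilon>) * Y n \<omega>))"
      proof (cases "\<omega> \<in> ev R T")
        case True
        have "\<forall>\<^sub>F n in sequentially. \<forall>i\<in>A. (LINT s:{0..T}|lborel. occ l i s \<omega>)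
          \<le> exp (l * \<epsilon>) * (\<Sum>k<Suc n. grid_term R l (T / real (Suc n)) i k \<omega>)"
          using grid_terms_lower_bound[OF T True l e] A by (intro eventually_ball_finite) auto
        then have "\<forall>\<^sub>F n in sequentially. ennreal (indicator (ev R T) \<omega> * (\<Sum>i\<in>A. LINT s:{0..T}|lborel. occ l i s \<omega>))
          \<le> ennreal (exp (l * \<epsilon>) * Y n \<omega>)"
        proof eventually_elim
          case (elim n)
          have "(\<Sum>i\<in>A. LINT s:{0..T}|lborel. occ l i s \<omega>) \<le> exp (l * \<epsilon>) * Y n \<omega>"
            unfolding Y_def sum_distrib_left[of "exp (l * \<epsilon>)" _ A] by (rule sum_mono) (use elim in blast)
          then show ?case using True by (intro ennreal_leI) simp
        qed
        then show ?thesis by (rule Liminf_bounded)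
      qed simp
    qed
    also have "\<dots> \<le> liminf (\<lambda>n. \<integral>\<^sup>+ \<omega>. ennreal (exp (l * \<epsilon>) * Y n \<omega>) \<partial>M)"
      by (rule nn_integral_liminf) measurable
    also have "\<dots> \<le> liminf (\<lambda>n. ennreal (exp (l * \<epsilon>) * (?C + err n)))"
    proof (rule Liminf_mono)
      have "\<forall>\<^sub>F n in sequentially. \<rho> n < 1" by (rule order_tendstoD(2)[OF rlim]) simp
      then show "\<forall>\<^sub>F n in sequentially. (\<integral>\<^sup>+ \<omega>. ennreal (exp (l * \<epsilon>) * Y n \<omega>) \<partial>M) \<le> ennreal (exp (l * \<epsilon>) * (?C + err n))"
      proof eventually_elim
        case (elim n)
        have r1: "\<rho> n \<le> 1" using elim by simp
        have hT: "T / real (Suc n) * real (Suc n) = T" by simp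
        note go = grid_occupation[OF adm rho0 r1 l A, of "Suc n", unfolded rho8 hT]
        have iY: "integrable M (Y n)" and EY: "integral\<^sup>L M (Y n) \<le> ?C + err n"
          using go unfolding Y_def err_def by auto
        have "(\<integral>\<^sup>+ \<omega>. ennreal (exp (l * \<epsilon>) * Y n \<omega>) \<partial>M) = ennreal (integral\<^sup>L M (\<lambda>\<omega>. exp (l * \<epsilon>) * Y n \<omega>))"
          using iY Y0 by (intro nn_integral_eq_integral) auto
        also have "\<dots> \<le> ennreal (exp (l * \<epsilon>) * (?C + err n))"
          using EY by (intro ennreal_leI) simp
        finally show ?case .
      qed
    qed
    also have "\<dots> = ennreal (exp (l * \<epsilon>) * ?C)"
    proof (rule lim_imp_Liminf)
      have "(\<lambda>n. exp (l * \<epsilon>) * (?C + err n)) \<longlonglongrightarrow> exp (l * \<epsilon>) * (?C + 0)"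
        by (intro tendsto_intros elim)
      then show "(\<lambda>n. ennreal (exp (l * \<epsilon>) * (?C + err n))) \<longlonglongrightarrow> ennreal (exp (l * \<epsilon>) * ?C)"
        by (intro tendsto_ennrealI) simp
    qed simp
    finally show ?thesis .
  qed
  have "(\<lambda>n. exp (l * inverse (real (Suc n))) * ?C) \<longlonglongrightarrow> exp (l * 0) * ?C"
    by (intro tendsto_intros LIMSEQ_inverse_real_of_nat)
  then have "(\<lambda>n. ennreal (exp (l * inverse (real (Suc n))) * ?C)) \<longlonglongrightarrow> ennreal ?C"
    by (intro tendsto_ennrealI) simp
  then show ?thesis by (rule LIMSEQ_le_const) (use bound in auto)
qed

end

section \<open>Finiteness of the support\<close>

text \<open>The least \<open>n\<close> with \<open>2 ^ n * x > 1\<close> is positive because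
  \<open>x \<le> 1\<close>; its predecessor is the scale of \<open>x\<close>.\<close>

lemma dyadic_scale:
  fixes x :: real
  assumes "0 < x" "x \<le> 1"
  obtains l where "2 ^ l * x \<le> 1" "1 < 2 ^ Suc l * x"
proof -
  obtain n where "1 / x < 2 ^ n" using real_arch_pow[of 2 "1 / x"] by auto
  then have ex: "\<exists>n. 1 < 2 ^ n * x" using assms by (auto simp: field_simps)
  define n where "n = (LEAST n. 1 < 2 ^ n * x)"
  have n: "1 < 2 ^ n * x" unfolding n_def by (rule LeastI_ex[OF ex])
  then have "n \<noteq> 0" using assms by (intro notI) simp
  then obtain l where l: "n = Suc l" by (cases n) auto
  then have "\<not> 1 < 2 ^ l * x" using not_less_Least[of l "\<lambda>n. 1 < 2 ^ n * x"] by (simp add: n_def)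
  then show ?thesis using that[of l] n l by simp
qed

lemma Liminf_power_lower_bound:
  fixes \<sigma> :: "real \<Rightarrow> real"
  assumes "Liminf (at_right 0) (\<lambda>x. ereal (\<sigma> x / x powr \<gamma>)) > 0"
  obtains k x0 where "0 < k" "0 < x0" "x0 \<le> 1" "\<And>x. 0 < x \<Longrightarrow> x \<le> x0 \<Longrightarrow> k * x powr \<gamma> \<le> \<sigma> x"
proof -
  obtain k where k: "0 < ereal k" "ereal k < Liminf (at_right 0) (\<lambda>x. ereal (\<sigma> x / x powr \<gamma>))"
    using ereal_dense2[OF assms] by auto
  have "\<forall>\<^sub>F x in at_right 0. k < \<sigma> x / x powr \<gamma>"
    using less_LiminfD[OF k(2)] by simp
  then obtain b where b: "0 < b" "\<And>x. 0 < x \<Longrightarrow> x < b \<Longrightarrow> k < \<sigma> x / x powr \<gamma>"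
    unfolding eventually_at_right_field by auto
  show ?thesis
  \<comment> \<open>Halving \<open>b\<close> makes the range closed on the right, and the cap at 1
    puts \<open>x\<close> within the reach of \<open>dyadic_scale\<close>.\<close>
  proof (rule that[of k "min (b / 2) 1"])
    fix x :: real assume x: "0 < x" "x \<le> min (b / 2) 1"
    then have "k < \<sigma> x / x powr \<gamma>" using b by (intro b(2)) auto
    then show "k * x powr \<gamma> \<le> \<sigma> x" using x by (simp add: pos_less_divide_eq)
  qed (use k b in auto)
qed

text \<open>For \<open>x\<close> of order \<open>2\<^sup>-\<^sup>l\<close> already the \<open>l\<close>-th term of the series is bounded below, because
  \<open>r\<^sup>l 2\<^sup>l = (2\<^sup>l)\<^sup>2\<^sup>\<gamma>\<close>.\<close>

lemma dyadic_series_lower_bound: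
  fixes \<sigma> :: "real \<Rightarrow> real"
  assumes k: "0 < k" and g: "0 < \<gamma>" "\<gamma> < 1 / 2" and x: "0 < x" "x \<le> 1" and s: "k * x powr \<gamma> \<le> \<sigma> x"
  defines "r \<equiv> 2 powr (2 * \<gamma> - 1)"
  shows "ennreal (k\<^sup>2 * exp (- 1) / 2) \<le> (\<Sum>l. ennreal (r ^ l) * ennreal (2 ^ l * exp (- (2 ^ l) * x) * (\<sigma> x)\<^sup>2))"
proof -
  obtain l where l: "2 ^ l * x \<le> 1" "1 < 2 ^ Suc l * x" using dyadic_scale[OF x] .
  define y where "y = (2::real) ^ l"
  have y: "0 < y" "y * x \<le> 1" "1 / 2 < y * x" using l by (auto simp: y_def)
  have "r ^ l = 2 powr ((2 * \<gamma> - 1) * real l)" by (simp add: r_def powr_power mult.commute)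
  moreover have "y = 2 powr real l" by (simp add: y_def powr_realpow)
  ultimately have ry: "r ^ l * y = y powr (2 * \<gamma>)"
    by (simp add: powr_add[symmetric] powr_powr algebra_simps)
  have "k\<^sup>2 * x powr (2 * \<gamma>) = (k * x powr \<gamma>)\<^sup>2"
    using x by (simp add: power_mult_distrib powr_power mult.commute)
  also have "\<dots> \<le> (\<sigma> x)\<^sup>2" using k x s by (intro power_mono) auto
  finally have s2: "k\<^sup>2 * x powr (2 * \<gamma>) \<le> (\<sigma> x)\<^sup>2" .
  \<comment> \<open>The product \<open>y * x\<close> is only known to exceed 1/2; since the exponent
    \<open>2 * \<gamma>\<close> lies below 1, its power is still at least 1/2.\<close>
  have "1 / 2 \<le> (1 / 2) powr (2 * \<gamma>)"
    using powr_mono'[of "2 * \<gamma>" 1 "1 / 2 :: real"] g by simp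
  also have "\<dots> \<le> (y * x) powr (2 * \<gamma>)" using y g by (intro powr_mono2) auto
  also have "\<dots> = y powr (2 * \<gamma>) * x powr (2 * \<gamma>)" using y x by (simp add: powr_mult)
  finally have yx: "1 / 2 \<le> y powr (2 * \<gamma>) * x powr (2 * \<gamma>)" .
  have "k\<^sup>2 * exp (- 1) / 2 = exp (- 1) * k\<^sup>2 * (1 / 2)" by simp
  also have "\<dots> \<le> exp (- 1) * k\<^sup>2 * (y powr (2 * \<gamma>) * x powr (2 * \<gamma>))"
    by (rule mult_left_mono[OF yx]) simp
  also have "\<dots> = exp (- 1) * y powr (2 * \<gamma>) * (k\<^sup>2 * x powr (2 * \<gamma>))" by simp
  also have "\<dots> \<le> exp (- (y * x)) * y powr (2 * \<gamma>) * (\<sigma> x)\<^sup>2"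
    using y s2 by (intro mult_mono) auto
  also have "\<dots> = r ^ l * (y * exp (- y * x) * (\<sigma> x)\<^sup>2)" by (simp add: ry[symmetric])
  finally have "ennreal (k\<^sup>2 * exp (- 1) / 2) \<le> ennreal (r ^ l) * ennreal (y * exp (- y * x) * (\<sigma> x)\<^sup>2)"
    by (subst ennreal_mult[symmetric]) (auto intro!: ennreal_leI simp: r_def y_def)
  also have "\<dots> \<le> (\<Sum>l. ennreal (r ^ l) * ennreal (2 ^ l * exp (- (2 ^ l) * x) * (\<sigma> x)\<^sup>2))"
    using sum_le_suminf[of "\<lambda>l. ennreal (r ^ l) * ennreal (2 ^ l * exp (- (2 ^ l) * x) * (\<sigma> x)\<^sup>2)" "{l}"]
    by (simp add: y_def)
  finally show ?thesis .
qed

section \<open>Time spent at small positive values\<close>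

context lattice_system
begin

lemma occ_joint_measurable: "(\<lambda>p. occ l i (fst p) (snd p)) \<in> borel_measurable (borel \<Otimes>\<^sub>M M)"
proof -
  note [measurable] = W_joint_measurable sigma_W_joint_measurable
  show ?thesis unfolding occ_def by measurable
qed

definition small_count :: "real \<Rightarrow> nat \<Rightarrow> real \<Rightarrow> 'a \<Rightarrow> ennreal" where
  "small_count x0 n s \<omega> = (\<Sum>i\<in>sites n. indicator {x. 0 < x \<and> x \<le> x0} (W i s \<omega>))"

lemma small_count_joint_measurable:
  "(\<lambda>p. small_count x0 n (fst p) (snd p)) \<in> borel_measurable (borel \<Otimes>\<^sub>M M)"
proof -
  note [measurable] = W_joint_measurable
  show ?thesis unfolding small_count_def by measurable
qed

lemma incseq_small_count: "incseq (\<lambda>n. small_count x0 n s \<omega>)"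
  unfolding small_count_def by (intro incseq_SucI sum_mono2 finite_sites) (auto simp: sites_def)

lemma finite_small:
  assumes "(SUP n. small_count x0 n s \<omega>) \<noteq> \<top>"
  shows "finite {i. 0 < W i s \<omega> \<and> W i s \<omega> \<le> x0}"
proof (rule ccontr)
  assume inf: "infinite {i. 0 < W i s \<omega> \<and> W i s \<omega> \<le> x0}"
  obtain c where c: "(SUP n. small_count x0 n s \<omega>) = ennreal c" "0 \<le> c"
    using assms by (cases "SUP n. small_count x0 n s \<omega>") auto
  obtain N where N: "c < real N" using reals_Archimedean2 by blast
  obtain S where S: "S \<subseteq> {i. 0 < W i s \<omega> \<and> W i s \<omega> \<le> x0}" "finite S" "card S = N"
    using infinite_arbitrarily_large[OF inf] by blast
  obtain n where n: "S \<subseteq> sites n" using finite_subset_sites[OF S(2)] .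
  have "ennreal (real N) = (\<Sum>i\<in>S. indicator {x. 0 < x \<and> x \<le> x0} (W i s \<omega>))"
  proof -
    have "(\<Sum>i\<in>S. indicator {x. 0 < x \<and> x \<le> x0} (W i s \<omega>)) = (\<Sum>i\<in>S. (1::ennreal))"
      using S(1) by (intro sum.cong) auto
    then show ?thesis using S(3) by (simp add: ennreal_of_nat_eq_real_of_nat)
  qed
  also have "\<dots> \<le> small_count x0 n s \<omega>" unfolding small_count_def by (rule sum_mono2) (use n in auto)
  also have "\<dots> \<le> ennreal c" unfolding c(1)[symmetric] by (rule SUP_upper) simp
  finally show False using N c by simp
qed

text \<open>By the dyadic series, a constant times the number of small positive coordinates is at
  most the sum of the densities \<open>occ (2 ^ l)\<close> with weights \<open>r ^ l\<close>. Each
  density has integral at most \<open>C\<close> over time, sites and probability, whatever the level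
  and the finite set of sites, so the weighted total is at most \<open>C / (1 - r)\<close>. Monotone
  convergence then removes the restriction to finitely many sites.\<close>

lemma AE_finite_small:
  assumes T: "0 < T" and R: "0 \<le> R" and g: "0 < \<gamma>" "\<gamma> < 1 / 2" and k: "0 < k" and x0: "0 < x0" "x0 \<le> 1"
    and low: "\<And>x. 0 < x \<Longrightarrow> x \<le> x0 \<Longrightarrow> k * x powr \<gamma> \<le> \<sigma> x"
  shows "AE \<omega> in M. \<omega> \<in> ev R T \<longrightarrow> (AE s in lborel. s \<in> {0..T} \<longrightarrow> finite {i. 0 < W i s \<omega> \<and> W i s \<omega> \<le> x0})"
proof -
  define r where "r = 2 powr (2 * \<gamma> - 1)"
  \<comment> \<open>Here \<open>\<gamma> < 1 / 2\<close> is decisive: it makes the weights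
    summable.\<close>
  have r: "0 < r" "r < 1" using g by (auto simp: r_def powr_less_one)
  define \<kappa> where "\<kappa> = k\<^sup>2 * exp (- 1) / 2"
  have kap: "0 < \<kappa>" using k by (simp add: \<kappa>_def)
  define C where "C = 4 * (R + (Q + L) * R * T)"
  have C0: "0 \<le> C" using R T Q_nonneg L_nonneg by (simp add: C_def)
  have evT [measurable]: "ev R T \<in> sets M" using ev_sets T by simp
  define z where "z = (\<lambda>n l \<omega>. indicator (ev R T) \<omega> * (\<Sum>i\<in>sites n. LINT s:{0..T}|lborel. occ (2 ^ l) i s \<omega>))"
  have zm [measurable]: "(\<lambda>\<omega>. z n l \<omega>) \<in> borel_measurable M" for n l
  proof -
    have "(\<lambda>\<omega>. LINT s:{0..T}|lborel. occ (2 ^ l) i s \<omega>) \<in> borel_measurable M" for i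
    proof -
      note [measurable] = occ_joint_measurable
      have "(\<lambda>p. indicator {0..T} (fst p) * occ (2 ^ l) i (fst p) (snd p)) \<in> borel_measurable (borel \<Otimes>\<^sub>M M)" by measurable
      from lborel.borel_measurable_lebesgue_integral[OF borel_measurable_swap_lborel[OF this]]
      show ?thesis by (simp add: set_lebesgue_integral_def)
    qed
    then have [measurable]: "(\<lambda>\<omega>. \<Sum>i\<in>sites n. LINT s:{0..T}|lborel. occ (2 ^ l) i s \<omega>) \<in> borel_measurable M"
      by (intro borel_measurable_sum)
    show ?thesis unfolding z_def by measurable
  qed
  have zC: "(\<integral>\<^sup>+ \<omega>. ennreal (z n l \<omega>) \<partial>M) \<le> ennreal C" for n l
    unfolding z_def C_def by (rule occupation_estimate[OF T R]) auto
  define J where "J = (\<lambda>n \<omega>. indicator (ev R T) \<omega> * (\<integral>\<^sup>+ s\<in>{0..T}. small_count x0 n s \<omega> \<partial>lborel))"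
  have Jm [measurable]: "J n \<in> borel_measurable M" for n
  proof -
    note [measurable] = small_count_joint_measurable
    have "(\<lambda>p. small_count x0 n (fst p) (snd p) * indicator {0..T} (fst p)) \<in> borel_measurable (borel \<Otimes>\<^sub>M M)" by measurable
    from lborel.borel_measurable_nn_integral[OF borel_measurable_swap_lborel[OF this]]
    have [measurable]: "(\<lambda>\<omega>. \<integral>\<^sup>+ s\<in>{0..T}. small_count x0 n s \<omega> \<partial>lborel) \<in> borel_measurable M" by simp
    show ?thesis unfolding J_def by measurable
  qed
  have sc_path [measurable]: "(\<lambda>s. small_count x0 n s \<omega>) \<in> borel_measurable borel" if "\<omega> \<in> space M" for n \<omega>
    using measurable_compose[OF measurable_Pair2'[OF that] small_count_joint_measurable] by simp
  have occ_path: "(\<lambda>s. occ l i s \<omega>) \<in> borel_measurable borel" if "\<omega> \<in> space M" for l i \<omega>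
    using measurable_compose[OF measurable_Pair2'[OF that] occ_joint_measurable] by simp
  \<comment> \<open>The comparison for one path: the dyadic bound is applied at each site and time,
    and all terms being nonnegative, series, sum and time integral may be exchanged.\<close>
  have Jz: "ennreal \<kappa> * J n \<omega> \<le> (\<Sum>l. ennreal (r ^ l) * ennreal (z n l \<omega>))" if w: "\<omega> \<in> space M" for n \<omega>
  proof (cases "\<omega> \<in> ev R T")
    case True
    then have wO: "\<omega> \<in> \<Omega>" by (simp add: ev_def)
    note [measurable] = sc_path[OF w] occ_path[OF w]
    have "ennreal \<kappa> * J n \<omega> = (\<integral>\<^sup>+ s. ennreal \<kappa> * (small_count x0 n s \<omega> * indicator {0..T} s) \<partial>lborel)"
      using True by (subst nn_integral_cmult) (auto simp: J_def)
    also have "\<dots> \<le> (\<integral>\<^sup>+ s. (\<Sum>l. ennreal (r ^ l) * (\<Sum>i\<in>sites n. ennreal (indicator {0..T} s * occ (2 ^ l) i s \<omega>))) \<partial>lborel)"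
    proof (rule nn_integral_mono)
      fix s
      show "ennreal \<kappa> * (small_count x0 n s \<omega> * indicator {0..T} s)
        \<le> (\<Sum>l. ennreal (r ^ l) * (\<Sum>i\<in>sites n. ennreal (indicator {0..T} s * occ (2 ^ l) i s \<omega>)))"
      proof (cases "s \<in> {0..T}")
        case s: True
        have one: "ennreal \<kappa> * indicator {x. 0 < x \<and> x \<le> x0} (W i s \<omega>) \<le> (\<Sum>l. ennreal (r ^ l) * ennreal (occ (2 ^ l) i s \<omega>))" for i
        proof (cases "0 < W i s \<omega> \<and> W i s \<omega> \<le> x0")
          case True
          then have "ennreal \<kappa> \<le> (\<Sum>l. ennreal (r ^ l) * ennreal (occ (2 ^ l) i s \<omega>))"
            unfolding \<kappa>_def r_def occ_def using x0 by (intro dyadic_series_lower_bound[OF k g _ _ low]) auto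
          then show ?thesis using True by simp
        qed simp
        have "ennreal \<kappa> * small_count x0 n s \<omega> \<le> (\<Sum>i\<in>sites n. \<Sum>l. ennreal (r ^ l) * ennreal (occ (2 ^ l) i s \<omega>))"
          unfolding small_count_def sum_distrib_left by (intro sum_mono one)
        also have "\<dots> = (\<Sum>l. \<Sum>i\<in>sites n. ennreal (r ^ l) * ennreal (occ (2 ^ l) i s \<omega>))"
          by (rule suminf_sum[symmetric]) simp
        finally show ?thesis using s by (simp add: sum_distrib_left)
      qed simp
    qed
    also have "\<dots> = (\<Sum>l. ennreal (r ^ l) * (\<Sum>i\<in>sites n. \<integral>\<^sup>+ s. ennreal (indicator {0..T} s * occ (2 ^ l) i s \<omega>) \<partial>lborel))"
      by (subst nn_integral_suminf) (auto simp: nn_integral_cmult nn_integral_sum)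
    also have "\<dots> = (\<Sum>l. ennreal (r ^ l) * ennreal (z n l \<omega>))"
    proof (intro suminf_cong arg_cong2[where f="(*)"] refl)
      fix l
      have "(\<integral>\<^sup>+ s. ennreal (indicator {0..T} s * occ (2 ^ l) i s \<omega>) \<partial>lborel) = ennreal (LINT s:{0..T}|lborel. occ (2 ^ l) i s \<omega>)" for i
        using occ_integrable[OF wO order_refl, of T "2 ^ l" i] occ_nonneg[of "2 ^ l" i _ \<omega>]
        unfolding set_lebesgue_integral_def set_integrable_def by (subst nn_integral_eq_integral) auto
      moreover have "0 \<le> (LINT s:{0..T}|lborel. occ (2 ^ l) i s \<omega>)" for i
        by (rule set_integral_nonneg'[OF occ_nonneg]) simp
      ultimately show "(\<Sum>i\<in>sites n. \<integral>\<^sup>+ s. ennreal (indicator {0..T} s * occ (2 ^ l) i s \<omega>) \<partial>lborel) = ennreal (z n l \<omega>)"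
        using True by (simp add: z_def sum_ennreal)
    qed
    finally show ?thesis .
  qed (simp add: J_def)
  have "(\<integral>\<^sup>+ \<omega>. ennreal \<kappa> * J n \<omega> \<partial>M) \<le> ennreal (C / (1 - r))" for n
  proof -
    have "(\<integral>\<^sup>+ \<omega>. ennreal \<kappa> * J n \<omega> \<partial>M) \<le> (\<integral>\<^sup>+ \<omega>. (\<Sum>l. ennreal (r ^ l) * ennreal (z n l \<omega>)) \<partial>M)"
      by (intro nn_integral_mono Jz)
    also have "\<dots> = (\<Sum>l. ennreal (r ^ l) * (\<integral>\<^sup>+ \<omega>. ennreal (z n l \<omega>) \<partial>M))"
      by (subst nn_integral_suminf) (auto simp: nn_integral_cmult)
    also have "\<dots> \<le> (\<Sum>l. ennreal (r ^ l) * ennreal C)"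
      by (intro suminf_le mult_left_mono zC) auto
    also have "\<dots> = (\<Sum>l. ennreal (r ^ l * C))" using r C0 by (simp add: ennreal_mult)
    also have "\<dots> = ennreal (C / (1 - r))"
    proof (rule suminf_ennreal_eq)
      show "(\<lambda>l. r ^ l * C) sums (C / (1 - r))"
        using sums_mult2[OF geometric_sums[of r], of C] r by simp
    qed (use r C0 in simp)
    finally show ?thesis .
  qed
  moreover have incJ: "incseq (\<lambda>n \<omega>. ennreal \<kappa> * J n \<omega>)"
    unfolding J_def
    by (intro incseq_SucI le_funI mult_left_mono nn_integral_mono mult_right_mono incseq_SucD[OF incseq_small_count]) auto
  ultimately have JC: "(\<integral>\<^sup>+ \<omega>. (SUP n. ennreal \<kappa> * J n \<omega>) \<partial>M) \<le> ennreal (C / (1 - r))"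
    by (subst nn_integral_monotone_convergence_SUP[OF incJ]) (auto intro: SUP_least)
  have "AE \<omega> in M. (SUP n. ennreal \<kappa> * J n \<omega>) \<noteq> \<infinity>"
  proof (rule nn_integral_PInf_AE)
    show "(\<integral>\<^sup>+ \<omega>. (SUP n. ennreal \<kappa> * J n \<omega>) \<partial>M) \<noteq> \<infinity>" using JC by (auto simp: top_unique)
  qed measurable
  then show ?thesis
    using AE_space
  proof eventually_elim
    case (elim \<omega>)
    show ?case
    proof
      assume ev: "\<omega> \<in> ev R T"
      note [measurable] = sc_path[OF elim(2)]
      have inc: "incseq (\<lambda>n s. small_count x0 n s \<omega> * indicator {0..T} s)"
        by (intro incseq_SucI le_funI mult_right_mono incseq_SucD[OF incseq_small_count]) simp
      \<comment> \<open>Monotone convergence again, now in time along a fixed path: a finite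
        integral forces a finite count at almost every time.\<close>
      have "(\<integral>\<^sup>+ s. (SUP n. small_count x0 n s \<omega> * indicator {0..T} s) \<partial>lborel) = (SUP n. J n \<omega>)"
        using ev inc by (subst nn_integral_monotone_convergence_SUP) (auto simp: J_def)
      moreover have "(SUP n. J n \<omega>) \<noteq> \<infinity>"
        using elim(1) kap by (auto simp: SUP_mult_left_ennreal[symmetric] ennreal_mult_eq_top_iff)
      moreover have "(\<lambda>s. small_count x0 n s \<omega> * indicator {0..T} s) \<in> borel_measurable lborel" for n
        using sc_path[OF elim(2), of n] by simp
      then have "(\<lambda>s. SUP n. small_count x0 n s \<omega> * indicator {0..T} s) \<in> borel_measurable lborel"
        by (intro borel_measurable_SUP) auto
      ultimately have "AE s in lborel. (SUP n. small_count x0 n s \<omega> * indicator {0..T} s) \<noteq> \<infinity>"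
        by (intro nn_integral_PInf_AE) simp_all
      then show "AE s in lborel. s \<in> {0..T} \<longrightarrow> finite {i. 0 < W i s \<omega> \<and> W i s \<omega> \<le> x0}"
      proof eventually_elim
        case (elim s)
        show ?case
        proof
          assume "s \<in> {0..T}"
          then have ind: "indicator {0..T} s = (1 :: ennreal)" by simp
          show "finite {i. 0 < W i s \<omega> \<and> W i s \<omega> \<le> x0}"
            by (rule finite_small) (use elim in \<open>unfold ind mult_1_right infinity_ennreal_def\<close>)
        qed
      qed
    qed
  qed
qed

text \<open>The levels \<open>R\<close> run through the natural numbers so that one null set serves
  all of them. Every path in \<open>\<Omega>\<close> has bounded mass on \<open>[0, T]\<close> and
  therefore lies in one of the events \<open>ev R T\<close>.\<close>

lemma AE_finite_supp:
  fixes \<gamma> :: real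
  assumes T: "0 < T" and g: "0 < \<gamma>" "\<gamma> < 1 / 2"
    and lim: "Liminf (at_right 0) (\<lambda>x. ereal (\<sigma> x / x powr \<gamma>)) > 0"
    and ell1: "\<And>\<omega> t. \<omega> \<in> \<Omega> \<Longrightarrow> 0 \<le> t \<Longrightarrow> X t \<omega> \<in> ell1_nonneg"
    and bounded: "\<And>\<omega>. \<omega> \<in> \<Omega> \<Longrightarrow> \<exists>K. \<forall>t\<in>{0..T}. ell1_norm (X t \<omega>) \<le> K"
  shows "AE \<omega> in M. emeasure lborel {t \<in> {0..T}. finite (supp (X t \<omega>))} = ennreal T"
proof -
  obtain k x0 where k: "0 < k" and x0: "0 < x0" "x0 \<le> 1"
    and low: "\<And>x. 0 < x \<Longrightarrow> x \<le> x0 \<Longrightarrow> k * x powr \<gamma> \<le> \<sigma> x"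
    using Liminf_power_lower_bound[OF lim] by metis
  have "AE \<omega> in M. \<forall>R::nat. \<omega> \<in> ev (real R) T \<longrightarrow>
      (AE s in lborel. s \<in> {0..T} \<longrightarrow> finite {i. 0 < W i s \<omega> \<and> W i s \<omega> \<le> x0})"
    unfolding AE_all_countable by (intro allI AE_finite_small[OF T _ g k x0 low]) simp_all
  then show ?thesis
    using AE_Om
  proof eventually_elim
    case (elim \<omega>)
    note w = elim(2)
    have X0: "0 \<le> X t \<omega> i" if "0 \<le> t" for t i by (rule nonneg[OF that Om_space[OF w]])
    have sumX: "(\<Sum>i\<in>S. X t \<omega> i) \<le> ell1_norm (X t \<omega>)" if "0 \<le> t" "finite S" for t S
    proof -
      have "(\<Sum>i\<in>S. \<bar>X t \<omega> i\<bar>) \<le> ell1_norm (X t \<omega>)"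
        unfolding ell1_norm_def by (rule finite_sum_le_infsum) (use ell1[OF w that(1)] that in \<open>auto simp: ell1_nonneg_def\<close>)
      then show ?thesis using X0[OF that(1)] by simp
    qed
    obtain K where K: "\<And>t. t \<in> {0..T} \<Longrightarrow> ell1_norm (X t \<omega>) \<le> K" using bounded[OF w] by blast
    obtain R where R: "K < real R" using reals_Archimedean2 by blast
    have "\<omega> \<in> ev (real R) T"
      unfolding ev_def mass_event_def
    proof (intro IntI CollectI conjI allI impI w Om_space[OF w])
      fix r :: rat and n assume r: "0 \<le> real_of_rat r \<and> real_of_rat r \<le> T"
      then have "(\<Sum>i\<in>sites n. X (real_of_rat r) \<omega> i) \<le> ell1_norm (X (real_of_rat r) \<omega>)"
        by (intro sumX) auto
      also have "\<dots> \<le> real R" using K[of "real_of_rat r"] r R by simp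
      finally show "(\<Sum>i\<in>sites n. X (real_of_rat r) \<omega> i) \<le> real R" .
    qed
    then have ae: "AE s in lborel. s \<in> {0..T} \<longrightarrow> finite {i. 0 < W i s \<omega> \<and> W i s \<omega> \<le> x0}"
      using elim(1) by blast
    have large: "finite {i. x0 < X t \<omega> i}" if t: "0 \<le> t" for t
    proof (rule ccontr)
      assume inf: "infinite {i. x0 < X t \<omega> i}"
      obtain N where N: "ell1_norm (X t \<omega>) / x0 < real N" using reals_Archimedean2 by blast
      obtain S where S: "S \<subseteq> {i. x0 < X t \<omega> i}" "finite S" "card S = N"
        using infinite_arbitrarily_large[OF inf] by blast
      have "real N * x0 = (\<Sum>i\<in>S. x0)" using S by simp
      also have "\<dots> \<le> (\<Sum>i\<in>S. X t \<omega> i)" using S(1) by (intro sum_mono) auto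
      also have "\<dots> \<le> ell1_norm (X t \<omega>)" by (rule sumX[OF t S(2)])
      finally show False using N x0 by (simp add: pos_divide_less_eq)
    qed
    have supp: "finite (supp (X t \<omega>))" if t: "t \<in> {0..T}" and fin: "finite {i. 0 < W i t \<omega> \<and> W i t \<omega> \<le> x0}" for t
    proof (rule finite_subset)
      show "supp (X t \<omega>) \<subseteq> {i. 0 < W i t \<omega> \<and> W i t \<omega> \<le> x0} \<union> {i. x0 < X t \<omega> i}"
      proof
        fix i assume "i \<in> supp (X t \<omega>)"
        then have "0 < X t \<omega> i" using X0[of t i] t by (simp add: supp_def less_le)
        then show "i \<in> {i. 0 < W i t \<omega> \<and> W i t \<omega> \<le> x0} \<union> {i. x0 < X t \<omega> i}"
          using t w by (auto simp: W_def)
      qed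
      show "finite ({i. 0 < W i t \<omega> \<and> W i t \<omega> \<le> x0} \<union> {i. x0 < X t \<omega> i})" using fin large[of t] t by simp
    qed
    \<comment> \<open>The set of good times must be shown measurable for its measure to be
      meaningful. The support lies in \<open>sites n\<close> iff all coordinates outside vanish, a
      closed condition in time by path continuity, so a countable union of closed sets
      results.\<close>
    have "{t \<in> {0..T}. finite (supp (X t \<omega>))} = (\<Union>n. \<Inter>i\<in>- sites n. {0..T} \<inter> (\<lambda>t. W i t \<omega>) -` {0}) \<inter> {0..T}"
    proof (intro set_eqI iffI)
      fix t assume t: "t \<in> {t \<in> {0..T}. finite (supp (X t \<omega>))}"
      then obtain n where n: "supp (X t \<omega>) \<subseteq> sites n" using finite_subset_sites by blast
      show "t \<in> (\<Union>n. \<Inter>i\<in>- sites n. {0..T} \<inter> (\<lambda>t. W i t \<omega>) -` {0}) \<inter> {0..T}"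
        using t n w by (auto simp: supp_def W_def intro!: exI[of _ n])
    next
      fix t assume "t \<in> (\<Union>n. \<Inter>i\<in>- sites n. {0..T} \<inter> (\<lambda>t. W i t \<omega>) -` {0}) \<inter> {0..T}"
      then obtain n where "t \<in> (\<Inter>i\<in>- sites n. {0..T} \<inter> (\<lambda>t. W i t \<omega>) -` {0})" and t: "t \<in> {0..T}" by blast
      then have n: "\<And>i. i \<notin> sites n \<Longrightarrow> W i t \<omega> = 0" by blast
      have "supp (X t \<omega>) \<subseteq> sites n"
      proof
        fix i assume "i \<in> supp (X t \<omega>)"
        then show "i \<in> sites n" using n[of i] t w by (auto simp: supp_def W_def)
      qed
      then show "t \<in> {t \<in> {0..T}. finite (supp (X t \<omega>))}"
        using t finite_subset[OF _ finite_sites] by blast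
    qed
    moreover have "closed ({0..T} \<inter> (\<lambda>t. W i t \<omega>) -` {0})" for i
      by (rule continuous_closed_preimage[OF W_cont[OF w]]) auto
    then have "closed (\<Inter>i\<in>- sites n. {0..T} \<inter> (\<lambda>t. W i t \<omega>) -` {0})" for n
      by (intro closed_INT ballI)
    then have "(\<Inter>i\<in>- sites n. {0..T} \<inter> (\<lambda>t. W i t \<omega>) -` {0}) \<in> sets borel" for n
      by (rule borel_closed)
    then have "(\<Union>n. \<Inter>i\<in>- sites n. {0..T} \<inter> (\<lambda>t. W i t \<omega>) -` {0}) \<inter> {0..T} \<in> sets borel"
      by (intro sets.Int sets.countable_UN image_subsetI) auto
    ultimately have A: "{t \<in> {0..T}. finite (supp (X t \<omega>))} \<in> sets lborel" by simp
    have "emeasure lborel {t \<in> {0..T}. finite (supp (X t \<omega>))} = emeasure lborel {0..T}"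
    proof (rule emeasure_eq_AE[OF _ A])
      show "AE t in lborel. (t \<in> {t \<in> {0..T}. finite (supp (X t \<omega>))}) = (t \<in> {0..T})"
        using ae by eventually_elim (use supp in blast)
    qed simp
    then show ?case using T by simp
  qed
qed

end

section \<open>Boundedness of the mass and conclusion\<close>

lemma ell1_norm_diff:
  assumes x: "x \<in> ell1_nonneg" and y: "y \<in> ell1_nonneg"
  shows "\<bar>ell1_norm x - ell1_norm y\<bar> \<le> ell1_norm (\<lambda>i. x i - y i)"
proof -
  have s: "(\<lambda>i. \<bar>x i\<bar>) summable_on UNIV" "(\<lambda>i. \<bar>y i\<bar>) summable_on UNIV"
    using x y by (auto simp: ell1_nonneg_def)
  have d: "(\<lambda>i. \<bar>x i - y i\<bar>) summable_on UNIV"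
    using Infinite_Sum.abs_summable_on_comparison_test'[OF summable_on_add[OF s], of "\<lambda>i. x i - y i"] by simp
  have "ell1_norm x \<le> ell1_norm (\<lambda>i. x i - y i) + ell1_norm y"
    unfolding ell1_norm_def infsum_add[OF d s(2), symmetric]
    by (rule infsum_mono[OF s(1) summable_on_add[OF d s(2)]]) simp
  moreover have "ell1_norm y \<le> ell1_norm (\<lambda>i. x i - y i) + ell1_norm x"
    unfolding ell1_norm_def infsum_add[OF d s(1), symmetric]
    by (rule infsum_mono[OF s(2) summable_on_add[OF d s(1)]]) simp
  ultimately show ?thesis by linarith
qed

text \<open>By the reverse triangle inequality the mass is continuous in time, hence bounded on
  compact intervals.\<close>

lemma ell1_norm_bounded:
  fixes x :: "real \<Rightarrow> (int ^ 'd) \<Rightarrow> real"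
  assumes ell1: "\<And>t. 0 \<le> t \<Longrightarrow> x t \<in> ell1_nonneg"
    and cont: "\<And>t. 0 \<le> t \<Longrightarrow> ((\<lambda>s. ell1_norm (\<lambda>i. x s i - x t i)) \<longlongrightarrow> 0) (at t within {0..})"
  shows "\<exists>K. \<forall>t\<in>{0..T}. ell1_norm (x t) \<le> K"
proof -
  have "continuous_on {0..} (\<lambda>t. ell1_norm (x t))"
    unfolding continuous_on_def
  proof
    fix t :: real assume t: "t \<in> {0..}"
    then have t0: "0 \<le> t" by simp
    show "((\<lambda>t. ell1_norm (x t)) \<longlongrightarrow> ell1_norm (x t)) (at t within {0..})"
    proof (rule LIM_zero_cancel, rule Lim_null_comparison[OF _ cont[OF t0]])
      show "\<forall>\<^sub>F s in at t within {0..}. norm (ell1_norm (x s) - ell1_norm (x t)) \<le> ell1_norm (\<lambda>i. x s i - x t i)"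
        unfolding eventually_at_filter
        by (rule always_eventually) (use ell1_norm_diff[OF ell1 ell1[OF t0]] in auto)
    qed
  qed
  then have "continuous_on {0..T} (\<lambda>t. ell1_norm (x t))"
    by (rule continuous_on_subset) auto
  then have "compact ((\<lambda>t. ell1_norm (x t)) ` {0..T})"
    by (rule compact_continuous_image) simp
  then obtain K where K: "\<forall>y\<in>(\<lambda>t. ell1_norm (x t)) ` {0..T}. norm y \<le> K"
    using bounded_iff[THEN iffD1, OF compact_imp_bounded] by blast
  show ?thesis
  proof (intro exI ballI)
    fix t assume "t \<in> {0..T}"
    then have "norm (ell1_norm (x t)) \<le> K" using K by blast
    then show "ell1_norm (x t) \<le> K" by simp
  qed
qed

theorem theorem2p2:
  fixes M :: "'a measure"
    and F :: "real \<Rightarrow> 'a measure"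
    and B :: "(int ^ 'd) \<Rightarrow> real \<Rightarrow> 'a \<Rightarrow> real"
    and q :: "(int ^ 'd) \<Rightarrow> real"
    and f \<sigma> :: "real \<Rightarrow> real"
    and X :: "real \<Rightarrow> 'a \<Rightarrow> (int ^ 'd) \<Rightarrow> real"
  assumes "filtered_prob_space M F"
    and "independent_brownian_motions M F B"
    and "q \<in> ell1_nonneg" and "q 0 = 0"
    and "\<exists>L. L-lipschitz_on {0..} f" and "f 0 = 0"
    and "continuous_on {0..} \<sigma>" and "\<sigma> 0 = 0" and "\<And>x. x > 0 \<Longrightarrow> \<sigma> x > 0"
    and "\<exists>C\<ge>1. \<exists>\<theta>\<in>{0<..<1}. \<forall>x\<ge>0. \<sigma> x \<le> C * (x powr \<theta> + x)"
    and "\<exists>\<gamma>\<in>{0<..<1/2}. Liminf (at_right 0) (\<lambda>x. ereal (\<sigma> x / x powr \<gamma>)) > 0"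
    and "is_continuous_ell1_solution M F B q f \<sigma> X"
    and "AE \<omega> in M. finite (supp (X 0 \<omega>))"
  shows "\<forall>T>0. AE \<omega> in M.
           emeasure lborel {t \<in> {0..T}. finite (supp (X t \<omega>))} = ennreal T"
proof (intro allI impI)
  fix T :: real assume T: "0 < T"
  note filt = assms(1) and ibm = assms(2) and q = assms(3)
  obtain L where L: "L-lipschitz_on {0..} f" using assms(5) by blast
  obtain \<gamma> where g: "0 < \<gamma>" "\<gamma> < 1 / 2" and lim: "Liminf (at_right 0) (\<lambda>x. ereal (\<sigma> x / x powr \<gamma>)) > 0"
    using assms(11) by auto
  have sol: "is_solution M F B q f \<sigma> X" and ell1: "AE \<omega> in M. (\<forall>t\<ge>0. X t \<omega> \<in> ell1_nonneg) \<and>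
        (\<forall>t\<ge>0. ((\<lambda>s. ell1_norm (\<lambda>i. X s \<omega> i - X t \<omega> i)) \<longlongrightarrow> 0) (at t within {0..}))"
    using assms(12) by (simp_all add: is_continuous_ell1_solution_def)
  define eqn where "eqn = (\<lambda>i I \<omega>. \<forall>t\<ge>0.
                set_integrable lborel {0..t} (\<lambda>s. drift q (X s \<omega>) i) \<and>
                set_integrable lborel {0..t} (\<lambda>s. f (X s \<omega> i)) \<and>
                X t \<omega> i = X 0 \<omega> i
                  + (LINT s:{0..t}|lborel. drift q (X s \<omega>) i)
                  + (LINT s:{0..t}|lborel. f (X s \<omega> i))
                  + I t \<omega>)"
  have nonneg: "\<And>t \<omega> i. 0 \<le> t \<Longrightarrow> \<omega> \<in> space M \<Longrightarrow> 0 \<le> X t \<omega> i"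
    and ad: "\<And>i. adapted F (\<lambda>t \<omega>. X t \<omega> i)" and cont: "\<And>i. AE \<omega> in M. continuous_on {0..} (\<lambda>t. X t \<omega> i)"
    and ex: "\<forall>i. \<exists>I. is_ito_integral M F (B i) (\<lambda>t \<omega>. \<sigma> (X t \<omega> i)) I \<and>
             (AE \<omega> in M. eqn i I \<omega>)"
    using sol unfolding is_solution_def eqn_def by blast+
  obtain I where I: "\<And>i. is_ito_integral M F (B i) (\<lambda>t \<omega>. \<sigma> (X t \<omega> i)) (I i)"
    and eq: "\<And>i. AE \<omega> in M. eqn i (I i) \<omega>"
    using choice[OF ex] by blast
  \<comment> \<open>The almost sure properties of the single coordinates are collected for all sites
    at once, which is possible because the lattice is countable.\<close>
  define good where "good = (\<lambda>\<omega>. (\<forall>i. continuous_on {0..} (\<lambda>t. X t \<omega> i)) \<and> (\<forall>i. eqn i (I i) \<omega>) \<and> (\<forall>t\<ge>0. X t \<omega> \<in> ell1_nonneg) \<and>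
        (\<forall>t\<ge>0. ((\<lambda>s. ell1_norm (\<lambda>i. X s \<omega> i - X t \<omega> i)) \<longlongrightarrow> 0) (at t within {0..})))"
  have "AE \<omega> in M. good \<omega>"
    unfolding good_def using ell1 cont eq by (intro AE_conjI) (simp_all add: AE_all_countable)
  \<comment> \<open>The good outcomes need not form a measurable set, so \<open>\<Omega>\<close> is
    taken as the complement of a measurable null set containing all the others.\<close>
  then obtain N where N: "{\<omega> \<in> space M. \<not> good \<omega>} \<subseteq> N" "emeasure M N = 0" "N \<in> sets M"
    by (rule AE_E)
  define \<Omega> where "\<Omega> = space M - N"
  have good: "good \<omega>" if "\<omega> \<in> \<Omega>" for \<omega> using that N(1) by (auto simp: \<Omega>_def)
  have AE: "AE \<omega> in M. \<omega> \<in> \<Omega>"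
    by (rule AE_I[OF _ N(2,3)]) (auto simp: \<Omega>_def)
  interpret lattice_system M F B q f \<sigma> X I L \<Omega>
  proof (rule lattice_system.intro)
    show "filtered_brownian M F (B i)" for i
      using filt ibm unfolding filtered_brownian_def filtered_brownian_axioms_def filtered_prob_space_def
        independent_brownian_motions_def by blast
    show "(\<lambda>\<omega>. X t \<omega> i) \<in> borel_measurable (F t)" if "0 \<le> t" for t i
      using ad[of i] that by (simp add: adapted_def)
    show "\<Omega> \<in> sets M" using N(3) by (simp add: \<Omega>_def)
    fix \<omega> i assume "\<omega> \<in> \<Omega>"
    note G = good[OF this, unfolded good_def eqn_def]
    show "continuous_on {0..} (\<lambda>t. X t \<omega> i)" using G by blast
    fix t :: real assume t: "0 \<le> t"
    show "set_integrable lborel {0..t} (\<lambda>s. drift q (X s \<omega>) i) \<and> set_integrable lborel {0..t} (\<lambda>s. f (X s \<omega> i))"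
      using G t by blast
    show "X t \<omega> i = X 0 \<omega> i + (LINT s:{0..t}|lborel. drift q (X s \<omega>) i)
        + (LINT s:{0..t}|lborel. f (X s \<omega> i)) + I i t \<omega>"
      using G t by blast
  qed (fact q L assms(6,7) nonneg I AE)+
  show "AE \<omega> in M. emeasure lborel {t \<in> {0..T}. finite (supp (X t \<omega>))} = ennreal T"
  proof (rule AE_finite_supp[OF T g lim])
    fix \<omega> assume "\<omega> \<in> \<Omega>"
    note G = good[OF this, unfolded good_def]
    show ell1: "X t \<omega> \<in> ell1_nonneg" if "0 \<le> t" for t using G that by blast
    have "((\<lambda>s. ell1_norm (\<lambda>i. X s \<omega> i - X t \<omega> i)) \<longlongrightarrow> 0) (at t within {0..})" if "0 \<le> t" for t
      using G that by blast
    with ell1 show "\<exists>K. \<forall>t\<in>{0..T}. ell1_norm (X t \<omega>) \<le> K" by (rule ell1_norm_bounded)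
  qed
qed

end
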